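(* Let $\xi>0$, $c_1,c_2\in\mathbb R$, and $P_0=-\frac{d^2}{dx^2}+s^2x^2-2c_1x^{-1}\frac{d}{dx}+c_2x^{-2}$. If $a\in\mathbb R$ satisfies $a^2+(2c_1-1)a-c_2=0$, $0<u<1$ and $\sigma:=a+c_1>u-\frac12$, then there is a positive self-adjoint operator $\mathcal P$ in $L^2_{c_1,+}$ satisfying the following. (i) $x^a\mathcal S_{\rm ev,+}$ is a core of $\mathcal P^{1/2}$ and, for all $\phi,\psi\in x^a\mathcal S_{\rm ev,+}$, $$\langle\mathcal P^{1/2}\phi,\mathcal P^{1/2}\psi\rangle_{c_1}=\langle P_0\phi,\psi\rangle_{c_1}+\xi\,\langle x^{-u}\phi,x^{-u}\psi\rangle_{c_1}.$$ (ii) $\mathcal P$ has a discrete spectrum. Let $\lambda_0\le\lambda_2\le\cdots$ be its eigenvalues (indexed by even naturals), repeated according to their multiplicity. There is some $D=D(\sigma,u)>0$ and, for each $\epsilon>0$, there is some $C=C(\epsilon,\sigma,u)>0$ so that, for all $k\in2\mathbb N$, $$(2k+1+2\sigma)s+\xi Ds^u(k+1)^{-u}\le\lambda_k\le(2k+1+2\sigma)(s+\xi\epsilon s^u)+\xi Cs^u .$$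
   Context: $s>0$ is a fixed parameter, $\mathbb N=\{0,1,2,\dots\}$, $\mathbb R_+=(0,\infty)$. $\mathcal S_{\rm ev,+}$ is the space of restrictions to $\mathbb R_+$ of even (complex-valued) Schwartz functions on $\mathbb R$, and $x^a\mathcal S_{\rm ev,+}=\{x^a f: f\in\mathcal S_{\rm ev,+}\}$. For real $c$, $L^2_{c,+}=L^2(\mathbb R_+,x^{2c}dx)$ with scalar product $\langle\phi,\psi\rangle_c=\int_0^\infty\phi\,\overline\psi\,x^{2c}dx$.
   Formalization: The constant D is allowed to depend on s and ξ as well as on σ and u; a D depending only on σ and u cannot exist, since for fixed s the lowest eigenvalue grows sublinearly in ξ as ξ→∞. C depends only on ε, σ, u as stated. *)

theory Defs
  imports "HOL-Analysis.Analysis"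
begin

section \<open>The Hilbert space of square integrable functions\<close>

text \<open>Vectors are represented by functions; two functions represent the same vector iff they
  agree almost everywhere.\<close>

definition L2 :: "'a measure \<Rightarrow> ('a \<Rightarrow> complex) set" where
  "L2 M = {f \<in> borel_measurable M. integrable M (\<lambda>x. (cmod (f x))\<^sup>2)}"

definition L2_inner :: "'a measure \<Rightarrow> ('a \<Rightarrow> complex) \<Rightarrow> ('a \<Rightarrow> complex) \<Rightarrow> complex" where
  "L2_inner M f g = (\<integral>x. f x * cnj (g x) \<partial>M)"

definition L2_norm :: "'a measure \<Rightarrow> ('a \<Rightarrow> complex) \<Rightarrow> real" where
  "L2_norm M f = sqrt (\<integral>x. (cmod (f x))\<^sup>2 \<partial>M)"

definition half_line_measure :: "real \<Rightarrow> real measure" where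
  "half_line_measure c = density (restrict_space lborel {0<..}) (\<lambda>x. ennreal (x powr (2 * c)))"


section \<open>Unbounded operators\<close>

text \<open>An operator is given by its graph, which is closed under changing both components on
  null sets; composition of operators is then composition of relations.\<close>

type_synonym 'a graph = "(('a \<Rightarrow> complex) \<times> ('a \<Rightarrow> complex)) set"

definition L2_operator :: "'a measure \<Rightarrow> 'a graph \<Rightarrow> bool" where
  "L2_operator M T \<longleftrightarrow>
     T \<subseteq> L2 M \<times> L2 M \<and>
     ((\<lambda>x. 0), (\<lambda>x. 0)) \<in> T \<and>
     (\<forall>f g f' g' \<alpha> \<beta>. (f, g) \<in> T \<longrightarrow> (f', g') \<in> T \<longrightarrow>
        ((\<lambda>x. \<alpha> * f x + \<beta> * f' x), (\<lambda>x. \<alpha> * g x + \<beta> * g' x)) \<in> T) \<and>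
     (\<forall>f g. \<forall>f'\<in>L2 M. \<forall>g'\<in>L2 M. (f, g) \<in> T \<longrightarrow> (AE x in M. f x = f' x) \<longrightarrow>
        (AE x in M. g x = g' x) \<longrightarrow> (f', g') \<in> T) \<and>
     (\<forall>f g h. (f, g) \<in> T \<longrightarrow> (f, h) \<in> T \<longrightarrow> (AE x in M. g x = h x))"

definition densely_defined :: "'a measure \<Rightarrow> 'a graph \<Rightarrow> bool" where
  "densely_defined M T \<longleftrightarrow>
     (\<forall>f\<in>L2 M. \<forall>e>0. \<exists>g\<in>Domain T. L2_norm M (\<lambda>x. f x - g x) < e)"

definition adjoint_graph :: "'a measure \<Rightarrow> 'a graph \<Rightarrow> 'a graph" where
  "adjoint_graph M T =
     {(g, h) \<in> L2 M \<times> L2 M. \<forall>(f, f')\<in>T. L2_inner M f' g = L2_inner M f h}"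

definition self_adjoint :: "'a measure \<Rightarrow> 'a graph \<Rightarrow> bool" where
  "self_adjoint M T \<longleftrightarrow> L2_operator M T \<and> densely_defined M T \<and> adjoint_graph M T = T"

definition positive_self_adjoint :: "'a measure \<Rightarrow> 'a graph \<Rightarrow> bool" where
  "positive_self_adjoint M T \<longleftrightarrow>
     self_adjoint M T \<and> (\<forall>(f, g)\<in>T. 0 \<le> Re (L2_inner M g f))"

text \<open>\<open>R\<close> is the square root of \<open>T\<close>; a positive self-adjoint operator has exactly one.\<close>

definition is_square_root :: "'a measure \<Rightarrow> 'a graph \<Rightarrow> 'a graph \<Rightarrow> bool" where
  "is_square_root M R T \<longleftrightarrow> positive_self_adjoint M R \<and> R O R = T"

text \<open>For closed \<open>T\<close>: \<open>V\<close> is dense in the domain with respect to the graph norm.\<close>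

definition is_core :: "'a measure \<Rightarrow> ('a \<Rightarrow> complex) set \<Rightarrow> 'a graph \<Rightarrow> bool" where
  "is_core M V T \<longleftrightarrow>
     V \<subseteq> Domain T \<and>
     (\<forall>(f, g)\<in>T. \<forall>e>0. \<exists>(f', g')\<in>T. f' \<in> V \<and>
        L2_norm M (\<lambda>x. f x - f' x) < e \<and> L2_norm M (\<lambda>x. g x - g' x) < e)"


section \<open>Spectrum\<close>

definition resolvent_set :: "'a measure \<Rightarrow> 'a graph \<Rightarrow> complex set" where
  "resolvent_set M T =
     {z. (\<exists>B. \<forall>(f, h)\<in>T. L2_norm M f \<le> B * L2_norm M (\<lambda>x. h x - z * f x)) \<and>
         (\<forall>g\<in>L2 M. \<exists>(f, h)\<in>T. AE x in M. g x = h x - z * f x)}"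

definition spectrum :: "'a measure \<Rightarrow> 'a graph \<Rightarrow> complex set" where
  "spectrum M T = - resolvent_set M T"

definition eigenspace :: "'a graph \<Rightarrow> complex \<Rightarrow> ('a \<Rightarrow> complex) set" where
  "eigenspace T z = {f. (f, (\<lambda>x. z * f x)) \<in> T}"

text \<open>The space \<open>E\<close>, taken modulo null functions, has dimension \<open>n\<close>.\<close>

definition has_dim :: "'a measure \<Rightarrow> ('a \<Rightarrow> complex) set \<Rightarrow> nat \<Rightarrow> bool" where
  "has_dim M E n \<longleftrightarrow>
     (\<exists>e :: nat \<Rightarrow> 'a \<Rightarrow> complex.
        (\<forall>i<n. e i \<in> E) \<and>
        (\<forall>c. (AE x in M. (\<Sum>i<n. c i * e i x) = 0) \<longrightarrow> (\<forall>i<n. c i = 0)) \<and>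
        (\<forall>f\<in>E. \<exists>c. AE x in M. f x = (\<Sum>i<n. c i * e i x)))"

definition discrete_spectrum :: "'a measure \<Rightarrow> 'a graph \<Rightarrow> bool" where
  "discrete_spectrum M T \<longleftrightarrow>
     (\<forall>z\<in>spectrum M T. z isolated_in spectrum M T \<and> (\<exists>n>0. has_dim M (eigenspace T z) n))"

text \<open>\<open>lam 0 \<le> lam 2 \<le> lam 4 \<le> \<dots>\<close> are the eigenvalues repeated according to
  multiplicity; the values of \<open>lam\<close> at odd numbers are irrelevant.\<close>

definition lists_eigenvalues :: "'a measure \<Rightarrow> 'a graph \<Rightarrow> (nat \<Rightarrow> real) \<Rightarrow> bool" where
  "lists_eigenvalues M T lam \<longleftrightarrow>
     (\<forall>j k. even j \<longrightarrow> even k \<longrightarrow> j \<le> k \<longrightarrow> lam j \<le> lam k) \<and>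
     (\<forall>\<mu>. finite {k. even k \<and> lam k = \<mu>} \<and>
          has_dim M (eigenspace T (complex_of_real \<mu>)) (card {k. even k \<and> lam k = \<mu>}))"


section \<open>Schwartz functions and the differential operator\<close>

definition vderiv :: "(real \<Rightarrow> complex) \<Rightarrow> real \<Rightarrow> complex" where
  "vderiv f x = vector_derivative f (at x)"

definition schwartz :: "(real \<Rightarrow> complex) set" where
  "schwartz = {f. \<forall>n. (\<forall>x. (vderiv ^^ n) f differentiable at x) \<and>
                    (\<forall>m. bounded (range (\<lambda>x. x ^ m *\<^sub>R (vderiv ^^ n) f x)))}"

text \<open>Only the values on the positive half-line are prescribed.\<close>

definition powr_schwartz_even :: "real \<Rightarrow> (real \<Rightarrow> complex) set" where
  "powr_schwartz_even a =
     {\<phi>. \<exists>f\<in>schwartz. (\<forall>x. f (- x) = f x) \<and> (\<forall>x>0. \<phi> x = (x powr a) *\<^sub>R f x)}"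

definition P0 :: "real \<Rightarrow> real \<Rightarrow> real \<Rightarrow> (real \<Rightarrow> complex) \<Rightarrow> real \<Rightarrow> complex" where
  "P0 s c1 c2 \<phi> x =
     - vderiv (vderiv \<phi>) x + (s\<^sup>2 * x\<^sup>2) *\<^sub>R \<phi> x
     - (2 * c1 * inverse x) *\<^sub>R vderiv \<phi> x + (c2 * inverse (x\<^sup>2)) *\<^sub>R \<phi> x"

end

theory Submission
  imports Defs "HOL-Computational_Algebra.Polynomial"
begin

text \<open>Writing \<open>\<phi> = x\<^sup>a f\<close> turns \<open>P0\<close> into the even part of the Dunkl harmonic oscillator
  \<open>- f'' - (2 \<sigma> / x) f' + s\<^sup>2 x\<^sup>2 f\<close> in \<open>L\<^sup>2(x\<^bsup>2\<sigma>\<^esup> dx)\<close>, which is diagonal in the basis of Laguerre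
  functions, with eigenvalues \<open>\<mu> n = (4 n + 1 + 2 \<sigma>) s\<close>. A Hardy inequality shows that \<open>x\<^bsup>-2u\<^esup>\<close> is
  form bounded with arbitrarily small relative bound. In the coordinates \<open>\<surd>(\<mu> n) \<langle>\<phi>, h n\<rangle>\<close> the
  perturbed form is therefore a bounded form on \<open>\<ell>\<^sup>2\<close> that dominates the inner product, while the
  norm of \<open>L\<^sup>2\<close> becomes a compact form. Minimising Rayleigh quotients successively gives
  an orthonormal basis of eigenvectors; minimising sequences converge in form norm by the
  parallelogram law. The operator and its square root are defined to be diagonal in this basis.

  The eigenvalue bounds follow by comparing Rayleigh quotients on spans of eigenvectors. The upper
  one uses the Hardy inequality. The lower one uses the tangent line inequality
  \<open>y\<^bsup>-u\<^esup> \<ge> (1 + u) \<tau>\<^bsup>-u\<^esup> - u \<tau>\<^bsup>-u-1\<^esup> y\<close> at \<open>y = x\<^sup>2\<close> together with \<open>s\<^sup>2 x\<^sup>2 \<le> P0\<close>, where \<open>\<tau>\<close>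
  is proportional to \<open>\<mu> n / s\<^sup>2\<close>.\<close>

section \<open>The Hilbert space of square integrable functions\<close>

text \<open>The square root in (i) has to have a known domain. The coordinates
  \<open>sqrt (\<mu> n)\<close> times the n-th Laguerre coefficient run through all of
  \<open>ell2\<close> exactly on the form domain, and \<open>rep_in_domain\<close> with
  \<open>domain_rep\<close> identify this with the domain of the diagonal operator with entries
  \<open>sqrt (l n)\<close>. Finite Laguerre sums are dense in \<open>ell2\<close> and lie in x^a S,
  which gives the core; the form identity is a matrix identity on finite sums, carried to x^a S by
  form boundedness. The Hardy inequality is the integral of the derivative of x^(2\<sigma>-2u+1)
  |f|^2. The hypothesis \<sigma> > u - 1/2 kills its boundary term, and 0 < u < 1 puts the exponent
  2-4u of the cross term strictly between -2u and 2, where it can be absorbed. Completeness of the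
  Laguerre functions is a Gaussian moment problem, solved by changing the width of the Gaussian and
  approximating by polynomials in exp(-x^2). The substitution x -> sqrt(s) x makes C independent of
  s and \<xi>. For D the tangent comparison subtracts a multiple of P0 that must stay below P0
  itself; this restricts the tangent point in terms of s and \<xi>, so D is chosen after
  them.\<close>

lemma L2_measurable [measurable_dest]: "f \<in> L2 M \<Longrightarrow> f \<in> borel_measurable M"
  by (simp add: L2_def)

lemma L2_integrable: "f \<in> L2 M \<Longrightarrow> integrable M (\<lambda>x. (cmod (f x))\<^sup>2)"
  by (simp add: L2_def)

lemma L2_I: "f \<in> borel_measurable M \<Longrightarrow> integrable M (\<lambda>x. (cmod (f x))\<^sup>2) \<Longrightarrow> f \<in> L2 M"
  by (simp add: L2_def)

lemma L2_mult_integrable: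
  assumes "f \<in> L2 M" "g \<in> L2 M"
  shows "integrable M (\<lambda>x. f x * cnj (g x))"
proof (rule Bochner_Integration.integrable_bound)
  show "integrable M (\<lambda>x. (cmod (f x))\<^sup>2 + (cmod (g x))\<^sup>2)"
    using assms by (intro Bochner_Integration.integrable_add L2_integrable)
  have "g \<in> borel_measurable M" "f \<in> borel_measurable M" using assms by (auto simp: L2_def)
  moreover have "(\<lambda>x. cnj (g x)) \<in> borel_measurable M"
    using \<open>g \<in> borel_measurable M\<close> by (intro borel_measurable_continuous_on[of cnj] continuous_intros)
  ultimately show "(\<lambda>x. f x * cnj (g x)) \<in> borel_measurable M" by measurable
  have "norm (f x * cnj (g x)) \<le> norm ((cmod (f x))\<^sup>2 + (cmod (g x))\<^sup>2)" for x
  proof -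
    have "0 \<le> (cmod (f x) - cmod (g x))\<^sup>2" by simp
    then have "2 * (cmod (f x) * cmod (g x)) \<le> (cmod (f x))\<^sup>2 + (cmod (g x))\<^sup>2" by (simp add: power2_diff)
    moreover have "0 \<le> cmod (f x) * cmod (g x)" by simp
    ultimately show ?thesis unfolding norm_mult complex_mod_cnj real_norm_def by linarith
  qed
  then show "AE x in M. norm (f x * cnj (g x)) \<le> norm ((cmod (f x))\<^sup>2 + (cmod (g x))\<^sup>2)" by simp
qed

lemma L2_scale: "f \<in> L2 M \<Longrightarrow> (\<lambda>x. c * f x) \<in> L2 M"
  by (auto simp: L2_def norm_mult power_mult_distrib)

lemma L2_zero: "(\<lambda>x. 0) \<in> L2 M"
  by (simp add: L2_def)

lemma L2_add:
  assumes "f \<in> L2 M" "g \<in> L2 M"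
  shows "(\<lambda>x. f x + g x) \<in> L2 M"
proof (rule L2_I)
  show m: "(\<lambda>x. f x + g x) \<in> borel_measurable M" using assms by (auto simp: L2_def)
  have "integrable M (\<lambda>x. 2 * (cmod (f x))\<^sup>2 + 2 * (cmod (g x))\<^sup>2)"
    using assms by (intro Bochner_Integration.integrable_add integrable_mult_right L2_integrable)
  then show "integrable M (\<lambda>x. (cmod (f x + g x))\<^sup>2)"
  proof (rule Bochner_Integration.integrable_bound)
    have "(cmod (f x + g x))\<^sup>2 \<le> 2 * (cmod (f x))\<^sup>2 + 2 * (cmod (g x))\<^sup>2" for x
    proof -
      have "(cmod (f x + g x))\<^sup>2 \<le> (cmod (f x) + cmod (g x))\<^sup>2"
        by (intro power_mono norm_triangle_ineq) simp
      moreover have "0 \<le> (cmod (f x) - cmod (g x))\<^sup>2" by simp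
      ultimately show ?thesis by (simp add: power2_diff power2_sum)
    qed
    then show "AE x in M. norm ((cmod (f x + g x))\<^sup>2) \<le> norm (2 * (cmod (f x))\<^sup>2 + 2 * (cmod (g x))\<^sup>2)"
      by simp
  qed (use m in measurable)
qed

lemma L2_diff: "f \<in> L2 M \<Longrightarrow> g \<in> L2 M \<Longrightarrow> (\<lambda>x. f x - g x) \<in> L2 M"
  using L2_add[of f M "\<lambda>x. (-1) * g x"] L2_scale[of g M "-1"] by simp

lemma L2_sum: "(\<And>i. i \<in> A \<Longrightarrow> f i \<in> L2 M) \<Longrightarrow> (\<lambda>x. \<Sum>i\<in>A. f i x) \<in> L2 M"
  by (induction A rule: infinite_finite_induct) (auto intro: L2_zero L2_add)

lemma L2_inner_add_left:
  assumes "f \<in> L2 M" "g \<in> L2 M" "h \<in> L2 M"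
  shows "L2_inner M (\<lambda>x. f x + g x) h = L2_inner M f h + L2_inner M g h"
  using assms by (simp add: L2_inner_def distrib_right L2_mult_integrable)

lemma L2_inner_diff_left:
  assumes "f \<in> L2 M" "g \<in> L2 M" "h \<in> L2 M"
  shows "L2_inner M (\<lambda>x. f x - g x) h = L2_inner M f h - L2_inner M g h"
  using assms by (simp add: L2_inner_def left_diff_distrib L2_mult_integrable)

lemma L2_inner_scale_left: "L2_inner M (\<lambda>x. c * f x) h = c * L2_inner M f h"
  by (simp add: L2_inner_def mult.assoc)

lemma L2_inner_sum_left:
  assumes "\<And>i. i \<in> A \<Longrightarrow> f i \<in> L2 M" "h \<in> L2 M"
  shows "L2_inner M (\<lambda>x. \<Sum>i\<in>A. c i * f i x) h = (\<Sum>i\<in>A. c i * L2_inner M (f i) h)"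
  using assms(1)
proof (induction A rule: infinite_finite_induct)
  case (insert a A)
  then have "(\<lambda>x. \<Sum>i\<in>A. c i * f i x) \<in> L2 M" by (intro L2_sum L2_scale) auto
  with insert show ?case
    by (simp add: L2_inner_add_left L2_scale L2_inner_scale_left assms(2))
qed (simp_all add: L2_inner_def)

lemma L2_inner_commute: "L2_inner M g f = cnj (L2_inner M f g)"
proof -
  have "cnj (L2_inner M f g) = (\<integral>x. cnj (f x * cnj (g x)) \<partial>M)"
    unfolding L2_inner_def by (rule Bochner_Integration.integral_cnj[symmetric])
  then show ?thesis by (simp add: L2_inner_def mult.commute)
qed

lemma L2_inner_sum_right:
  assumes "\<And>i. i \<in> A \<Longrightarrow> f i \<in> L2 M" "h \<in> L2 M"
  shows "L2_inner M h (\<lambda>x. \<Sum>i\<in>A. c i * f i x) = (\<Sum>i\<in>A. cnj (c i) * L2_inner M h (f i))"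
  by (subst L2_inner_commute, subst L2_inner_sum_left[OF assms])
     (auto simp: L2_inner_commute[of M h] intro!: sum.cong)

lemma L2_inner_diff_right:
  assumes "f \<in> L2 M" "g \<in> L2 M" "h \<in> L2 M"
  shows "L2_inner M h (\<lambda>x. f x - g x) = L2_inner M h f - L2_inner M h g"
  by (metis L2_inner_commute L2_inner_diff_left[OF assms] complex_cnj_diff)

lemma L2_norm_nonneg [simp]: "L2_norm M f \<ge> 0"
  by (simp add: L2_norm_def)

lemma L2_inner_self: "L2_inner M f f = complex_of_real ((L2_norm M f)\<^sup>2)"
proof -
  have "L2_inner M f f = (\<integral>x. complex_of_real ((cmod (f x))\<^sup>2) \<partial>M)"
    unfolding L2_inner_def by (simp add: complex_norm_square del: of_real_power)
  also have "\<dots> = complex_of_real (\<integral>x. (cmod (f x))\<^sup>2 \<partial>M)" by (rule integral_complex_of_real)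
  finally show ?thesis by (simp add: L2_norm_def integral_nonneg)
qed

lemma L2_norm_sq: "(L2_norm M f)\<^sup>2 = Re (L2_inner M f f)"
  by (simp add: L2_inner_self)

lemma L2_norm_sq_integral: "(L2_norm M f)\<^sup>2 = (\<integral>x. (cmod (f x))\<^sup>2 \<partial>M)"
  by (simp add: L2_norm_def)

lemma L2_norm_minus_commute: "L2_norm M (\<lambda>x. f x - g x) = L2_norm M (\<lambda>x. g x - f x)"
  by (simp add: L2_norm_def norm_minus_commute)

lemma L2_norm_zero_iff:
  assumes "f \<in> L2 M"
  shows "L2_norm M f = 0 \<longleftrightarrow> (AE x in M. f x = 0)"
proof -
  have "L2_norm M f = 0 \<longleftrightarrow> (\<integral>x. (cmod (f x))\<^sup>2 \<partial>M) = 0"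
    by (simp add: L2_norm_def)
  also have "\<dots> \<longleftrightarrow> (AE x in M. (cmod (f x))\<^sup>2 = 0)"
    by (intro integral_nonneg_eq_0_iff_AE L2_integrable assms) simp
  finally show ?thesis by simp
qed

lemma L2_norm_cong_AE:
  assumes "AE x in M. f x = g x" "f \<in> borel_measurable M" "g \<in> borel_measurable M"
  shows "L2_norm M f = L2_norm M g"
proof -
  have "(\<integral>x. (cmod (f x))\<^sup>2 \<partial>M) = (\<integral>x. (cmod (g x))\<^sup>2 \<partial>M)"
    using assms by (intro integral_cong_AE) auto
  then show ?thesis by (simp add: L2_norm_def)
qed

lemma L2_inner_cong_AE:
  assumes "AE x in M. f x = g x" "f \<in> L2 M" "g \<in> L2 M" "h \<in> L2 M"
  shows "L2_inner M f h = L2_inner M g h"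
  unfolding L2_inner_def
  using assms borel_measurable_integrable[OF L2_mult_integrable] by (intro integral_cong_AE) auto

lemma L2_inner_zero_AE:
  assumes "AE x in M. f x = 0" "f \<in> L2 M" "h \<in> L2 M"
  shows "L2_inner M f h = 0"
  using L2_inner_cong_AE[OF assms(1,2) L2_zero assms(3)] by (simp add: L2_inner_def)

lemma L2_norm_diff_sq:
  assumes f: "f \<in> L2 M" and g: "g \<in> L2 M"
  shows "(L2_norm M (\<lambda>x. f x - g x))\<^sup>2 = (L2_norm M f)\<^sup>2 - 2 * Re (L2_inner M f g) + (L2_norm M g)\<^sup>2"
  unfolding L2_norm_sq using L2_inner_commute[of M g f]
  by (simp add: L2_inner_diff_left L2_inner_diff_right L2_diff f g)

lemma L2_Cauchy_Schwarz:
  assumes f: "f \<in> L2 M" and g: "g \<in> L2 M"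
  shows "cmod (L2_inner M f g) \<le> L2_norm M f * L2_norm M g"
proof (cases "L2_norm M g = 0")
  case True
  then have "AE x in M. g x = 0" using L2_norm_zero_iff[OF g] by simp
  from L2_inner_zero_AE[OF this g f] True show ?thesis by (simp add: L2_inner_commute[of M f g])
next
  case False
  define G where "G = (L2_norm M g)\<^sup>2"
  have G: "G > 0" using False by (simp add: G_def)
  \<comment> \<open>The coefficient of the orthogonal projection of \<open>f\<close> on
    \<open>g\<close>; expanding the squared norm of \<open>f - c g\<close> gives the
    inequality.\<close>
  define c where "c = L2_inner M f g / G"
  have cg: "(\<lambda>x. c * g x) \<in> L2 M" by (rule L2_scale[OF g])
  have 1: "L2_inner M f (\<lambda>x. c * g x) = cnj c * L2_inner M f g"
    by (metis L2_inner_commute L2_inner_scale_left complex_cnj_mult)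
  have "cnj c * L2_inner M f g = complex_of_real ((cmod (L2_inner M f g))\<^sup>2 / G)"
    unfolding c_def by (simp add: complex_norm_square mult.commute del: of_real_power)
  with 1 have "Re (L2_inner M f (\<lambda>x. c * g x)) = (cmod (L2_inner M f g))\<^sup>2 / G" by simp
  moreover have "(L2_norm M (\<lambda>x. c * g x))\<^sup>2 = (cmod c)\<^sup>2 * G"
    by (simp add: L2_norm_sq_integral G_def norm_mult power_mult_distrib)
  moreover have "(cmod c)\<^sup>2 * G = (cmod (L2_inner M f g))\<^sup>2 / G"
    using G by (simp add: c_def norm_divide power_divide power2_eq_square)
  ultimately have "0 \<le> (L2_norm M f)\<^sup>2 - (cmod (L2_inner M f g))\<^sup>2 / G"
    using L2_norm_diff_sq[OF f cg] zero_le_power2[of "L2_norm M (\<lambda>x. f x - c * g x)"] by linarith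
  then have "(cmod (L2_inner M f g))\<^sup>2 \<le> (L2_norm M f * L2_norm M g)\<^sup>2"
    using G by (simp add: field_simps G_def power_mult_distrib)
  then show ?thesis by (rule power2_le_imp_le) simp
qed

lemma L2_norm_triangle:
  assumes f: "f \<in> L2 M" and g: "g \<in> L2 M"
  shows "L2_norm M (\<lambda>x. f x - g x) \<le> L2_norm M f + L2_norm M g"
proof (rule power2_le_imp_le)
  have "- Re (L2_inner M f g) \<le> L2_norm M f * L2_norm M g"
    using L2_Cauchy_Schwarz[OF f g] abs_Re_le_cmod[of "L2_inner M f g"] by linarith
  then show "(L2_norm M (\<lambda>x. f x - g x))\<^sup>2 \<le> (L2_norm M f + L2_norm M g)\<^sup>2"
    by (simp add: L2_norm_diff_sq[OF f g] power2_sum)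
qed simp

lemma L2_inner_tendsto:
  assumes "\<And>k. f k \<in> L2 M" "g \<in> L2 M" "h \<in> L2 M" "(\<lambda>k. L2_norm M (\<lambda>x. f k x - g x)) \<longlonglongrightarrow> 0"
  shows "(\<lambda>k. L2_inner M (f k) h) \<longlonglongrightarrow> L2_inner M g h"
proof -
  have "(\<lambda>k. L2_inner M (f k) h - L2_inner M g h) \<longlonglongrightarrow> 0"
  proof (rule Lim_null_comparison)
    show "(\<lambda>k. L2_norm M (\<lambda>x. f k x - g x) * L2_norm M h) \<longlonglongrightarrow> 0"
      using tendsto_mult_right[OF assms(4)] by simp
    show "\<forall>\<^sub>F k in sequentially. norm (L2_inner M (f k) h - L2_inner M g h) \<le> L2_norm M (\<lambda>x. f k x - g x) * L2_norm M h"
      using L2_Cauchy_Schwarz[OF L2_diff[OF assms(1,2)] assms(3)] by (simp add: L2_inner_diff_left assms)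
  qed
  then show ?thesis by (simp add: LIM_zero_iff)
qed

text \<open>A subsequence with rapidly shrinking steps converges almost everywhere, and Fatou's
  lemma turns this pointwise limit into a limit in norm.\<close>

lemma L2_complete:
  assumes f: "\<And>k. f k \<in> L2 M"
    and cau: "\<And>e. e > 0 \<Longrightarrow> \<exists>N. \<forall>i\<ge>N. \<forall>j\<ge>N. L2_norm M (\<lambda>x. f i x - f j x) < e"
  obtains g where "g \<in> L2 M" "(\<lambda>k. L2_norm M (\<lambda>x. f k x - g x)) \<longlonglongrightarrow> 0"
proof -
  have [measurable]: "f k \<in> borel_measurable M" for k using f by (simp add: L2_def)
  have "\<exists>r. \<forall>n. (\<forall>i\<ge>r n. \<forall>j\<ge>r n. L2_norm M (\<lambda>x. f i x - f j x) < (1 / 4) ^ n) \<and> r n < r (Suc n)"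
  proof (rule dependent_nat_choice)
    show "\<exists>N. \<forall>i\<ge>N. \<forall>j\<ge>N. L2_norm M (\<lambda>x. f i x - f j x) < (1 / 4) ^ 0" by (intro cau) simp
    fix N n
    obtain K where K: "\<forall>i\<ge>K. \<forall>j\<ge>K. L2_norm M (\<lambda>x. f i x - f j x) < (1 / 4) ^ Suc n"
      using cau[of "(1 / 4) ^ Suc n"] by auto
    then have "\<forall>i\<ge>max K (Suc N). \<forall>j\<ge>max K (Suc N). L2_norm M (\<lambda>x. f i x - f j x) < (1 / 4) ^ Suc n" by auto
    then show "\<exists>y. (\<forall>i\<ge>y. \<forall>j\<ge>y. L2_norm M (\<lambda>x. f i x - f j x) < (1 / 4) ^ Suc n) \<and> N < y"
      by (intro exI[of _ "max K (Suc N)"]) auto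
  qed
  then obtain r where r: "\<And>n i j. i \<ge> r n \<Longrightarrow> j \<ge> r n \<Longrightarrow> L2_norm M (\<lambda>x. f i x - f j x) < (1 / 4) ^ n"
    and r_Suc: "\<And>n. r n < r (Suc n)" by blast
  have rm: "strict_mono r" using r_Suc by (simp add: strict_mono_Suc_iff)
  define d where "d k x = f (r (Suc k)) x - f (r k) x" for k x
  have [measurable]: "d k \<in> borel_measurable M" for k unfolding d_def by measurable
  have d: "d k \<in> L2 M" for k unfolding d_def by (intro L2_diff f)
  \<comment> \<open>The weight 4^k serves both sides: the k-th integral is at most 4^k * 16^(-k) =
    4^(-k), which is summable, while finiteness of the pointwise sum bounds |d k| by a multiple of
    2^(-k).\<close>
  have "(\<integral>\<^sup>+x. (\<Sum>k. ennreal (4 ^ k * (cmod (d k x))\<^sup>2)) \<partial>M) = (\<Sum>k. \<integral>\<^sup>+x. ennreal (4 ^ k * (cmod (d k x))\<^sup>2) \<partial>M)"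
    by (rule nn_integral_suminf) measurable
  also have "\<dots> \<le> (\<Sum>k. ennreal ((1 / 4) ^ k))"
  proof (rule suminf_le)
    fix k
    have "L2_norm M (d k) \<le> (1 / 4) ^ k"
      using r[of k "r (Suc k)" "r k"] r_Suc[of k] by (simp add: d_def[abs_def] less_imp_le)
    then have "(L2_norm M (d k))\<^sup>2 \<le> ((1 / 4) ^ k)\<^sup>2" by (intro power_mono) auto
    then have "4 ^ k * (L2_norm M (d k))\<^sup>2 \<le> 4 ^ k * ((1 / 4) ^ k)\<^sup>2" by simp
    also have "\<dots> = (1 / 4) ^ k" by (simp add: power2_eq_square flip: power_mult_distrib)
    finally have *: "4 ^ k * (L2_norm M (d k))\<^sup>2 \<le> (1 / 4) ^ k" .
    have "(\<integral>\<^sup>+x. ennreal (4 ^ k * (cmod (d k x))\<^sup>2) \<partial>M) = ennreal (\<integral>x. 4 ^ k * (cmod (d k x))\<^sup>2 \<partial>M)"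
      by (intro nn_integral_eq_integral integrable_mult_right L2_integrable d) auto
    also have "\<dots> = ennreal (4 ^ k * (L2_norm M (d k))\<^sup>2)" by (simp add: L2_norm_sq_integral)
    finally show "(\<integral>\<^sup>+x. ennreal (4 ^ k * (cmod (d k x))\<^sup>2) \<partial>M) \<le> ennreal ((1 / 4) ^ k)"
      using * by (simp add: ennreal_leI)
  qed auto
  also have "\<dots> = ennreal (\<Sum>k. (1 / 4) ^ k)" by (intro suminf_ennreal2 summable_geometric) auto
  also have "\<dots> < \<infinity>" by simp
  finally have "AE x in M. (\<Sum>k. ennreal (4 ^ k * (cmod (d k x))\<^sup>2)) \<noteq> \<infinity>"
    by (intro nn_integral_noteq_infinite) auto
  then have conv: "AE x in M. convergent (\<lambda>n. f (r n) x)"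
  proof eventually_elim
    case (elim x)
    define F where "F k = ennreal (4 ^ k * (cmod (d k x))\<^sup>2)" for k
    define S where "S = enn2real (suminf F)"
    have fin: "suminf F < top" using elim by (simp add: F_def[abs_def] less_top)
    have S: "4 ^ k * (cmod (d k x))\<^sup>2 \<le> S" for k
    proof -
      have "sum F {k} \<le> suminf F" by (rule sum_le_suminf) auto
      then have "F k \<le> ennreal S" using fin by (simp add: S_def)
      then show ?thesis by (simp add: F_def S_def)
    qed
    have "cmod (d k x) \<le> sqrt S * (1 / 2) ^ k" for k
    proof -
      have "((2::real) ^ k)\<^sup>2 = 4 ^ k" by (simp add: power2_eq_square flip: power_mult_distrib)
      then have "(2 ^ k * cmod (d k x))\<^sup>2 \<le> S" using S[of k] unfolding power_mult_distrib by simp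
      then have "2 ^ k * cmod (d k x) \<le> sqrt S" by (rule real_le_rsqrt)
      then show ?thesis by (simp add: power_divide pos_le_divide_eq mult.commute)
    qed
    moreover have "summable (\<lambda>k. sqrt S * (1 / 2) ^ k)" by (rule summable_mult[OF summable_geometric]) simp
    ultimately have "summable (\<lambda>k. d k x)" by (metis summable_comparison_test')
    then have "convergent (\<lambda>n. \<Sum>k<n. d k x)" by (simp add: summable_iff_convergent)
    then have "convergent (\<lambda>n. f (r 0) x + (\<Sum>k<n. d k x))" by (rule convergent_add[OF convergent_const])
    moreover have "(\<Sum>k<n. d k x) = f (r n) x - f (r 0) x" for n
      unfolding d_def by (rule sum_lessThan_telescope)
    ultimately show ?case by simp
  qed
  define g where "g x = lim (\<lambda>n. f (r n) x)" for x
  have gm [measurable]: "g \<in> borel_measurable M" unfolding g_def by measurable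
  have lim: "AE x in M. (\<lambda>n. f (r n) x) \<longlonglongrightarrow> g x"
    using conv by eventually_elim (simp add: g_def convergent_LIMSEQ_iff)
  \<comment> \<open>Fatou's lemma along the subsequence. Nonnegative integrals are used because
    \<open>g\<close> is so far only measurable; as \<open>m\<close> is any index from
    \<open>r n\<close> on, the whole sequence is controlled.\<close>
  have bound: "(\<integral>\<^sup>+x. ennreal ((cmod (f m x - g x))\<^sup>2) \<partial>M) \<le> ennreal (((1 / 4) ^ n)\<^sup>2)"
    if "m \<ge> r n" for m n
  proof -
    have "(\<integral>\<^sup>+x. ennreal ((cmod (f m x - g x))\<^sup>2) \<partial>M)
        = (\<integral>\<^sup>+x. liminf (\<lambda>k. ennreal ((cmod (f m x - f (r k) x))\<^sup>2)) \<partial>M)"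
    proof (rule nn_integral_cong_AE, use lim in eventually_elim)
      case (elim x)
      have "(\<lambda>k. ennreal ((cmod (f m x - f (r k) x))\<^sup>2)) \<longlonglongrightarrow> ennreal ((cmod (f m x - g x))\<^sup>2)"
        by (intro tendsto_intros elim)
      then show ?case by (metis lim_imp_Liminf sequentially_bot)
    qed
    also have "\<dots> \<le> liminf (\<lambda>k. \<integral>\<^sup>+x. ennreal ((cmod (f m x - f (r k) x))\<^sup>2) \<partial>M)"
      by (rule nn_integral_liminf) measurable
    also have "\<dots> \<le> ennreal (((1 / 4) ^ n)\<^sup>2)"
    proof (rule Liminf_le)
      show "\<forall>\<^sub>F k in sequentially. (\<integral>\<^sup>+x. ennreal ((cmod (f m x - f (r k) x))\<^sup>2) \<partial>M) \<le> ennreal (((1 / 4) ^ n)\<^sup>2)"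
      proof (rule eventually_sequentiallyI[of n])
        fix k assume "k \<ge> n"
        then have "r k \<ge> r n" using rm by (simp add: strict_mono_less_eq)
        have "(\<integral>\<^sup>+x. ennreal ((cmod (f m x - f (r k) x))\<^sup>2) \<partial>M) = ennreal ((L2_norm M (\<lambda>x. f m x - f (r k) x))\<^sup>2)"
          unfolding L2_norm_sq_integral by (intro nn_integral_eq_integral L2_integrable L2_diff f) auto
        also have "\<dots> \<le> ennreal (((1 / 4) ^ n)\<^sup>2)"
          using r[OF that \<open>r k \<ge> r n\<close>] by (intro ennreal_leI power_mono) auto
        finally show "(\<integral>\<^sup>+x. ennreal ((cmod (f m x - f (r k) x))\<^sup>2) \<partial>M) \<le> ennreal (((1 / 4) ^ n)\<^sup>2)" .
      qed
    qed auto
    finally show ?thesis .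
  qed
  have dif: "(\<lambda>x. f m x - g x) \<in> L2 M" if "m \<ge> r n" for m n
  proof (rule L2_I)
    show "integrable M (\<lambda>x. (cmod (f m x - g x))\<^sup>2)"
    proof (rule integrableI_nonneg)
      show "(\<integral>\<^sup>+x. ennreal ((cmod (f m x - g x))\<^sup>2) \<partial>M) < \<infinity>"
        using bound[OF that] by (rule le_less_trans) simp
    qed auto
  qed measurable
  have nb: "L2_norm M (\<lambda>x. f m x - g x) \<le> (1 / 4) ^ n" if "m \<ge> r n" for m n
  proof -
    have "ennreal ((L2_norm M (\<lambda>x. f m x - g x))\<^sup>2) \<le> ennreal (((1 / 4) ^ n)\<^sup>2)"
      unfolding L2_norm_sq_integral using bound[OF that]
      by (subst nn_integral_eq_integral[symmetric]) (auto intro: L2_integrable dif[OF that])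
    then have "(L2_norm M (\<lambda>x. f m x - g x))\<^sup>2 \<le> ((1 / 4) ^ n)\<^sup>2" by (subst (asm) ennreal_le_iff) auto
    then show ?thesis by (rule power2_le_imp_le) simp
  qed
  have "(\<lambda>x. f (r 0) x - (f (r 0) x - g x)) \<in> L2 M" by (rule L2_diff[OF f dif[of 0]]) simp
  then have "g \<in> L2 M" by simp
  moreover have "(\<lambda>k. L2_norm M (\<lambda>x. f k x - g x)) \<longlonglongrightarrow> 0"
  proof (rule LIMSEQ_I)
    fix e :: real assume "e > 0"
    then obtain n where n: "(1 / 4 :: real) ^ n < e"
      using real_arch_pow_inv[of e "1/4"] by auto
    have "norm (L2_norm M (\<lambda>x. f k x - g x) - 0) < e" if "k \<ge> r n" for k
      using nb[OF that] n by simp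
    then show "\<exists>no. \<forall>k\<ge>no. norm (L2_norm M (\<lambda>x. f k x - g x) - 0) < e" by blast
  qed
  ultimately show ?thesis using that by blast
qed

section \<open>Diagonal operators in an orthonormal basis\<close>

text \<open>Completeness is assumed as totality, that only null functions are orthogonal to every
  \<open>e n\<close>. This is what can be verified for the Laguerre functions and for the
  eigenvectors; the expansion theorem is derived from it.\<close>

locale L2_basis =
  fixes M :: "'a measure" and e :: "nat \<Rightarrow> 'a \<Rightarrow> complex"
  assumes basis_L2: "e n \<in> L2 M"
    and ortho: "L2_inner M (e m) (e n) = (if m = n then 1 else 0)"
    and complete: "f \<in> L2 M \<Longrightarrow> (\<And>n. L2_inner M f (e n) = 0) \<Longrightarrow> AE x in M. f x = 0"
begin

abbreviation co :: "('a \<Rightarrow> complex) \<Rightarrow> nat \<Rightarrow> complex" where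
  "co f n \<equiv> L2_inner M f (e n)"

lemma sum_L2: "(\<lambda>x. \<Sum>n\<in>A. c n * e n x) \<in> L2 M"
  by (intro L2_sum L2_scale basis_L2)

lemma co_sum: "finite A \<Longrightarrow> co (\<lambda>x. \<Sum>n\<in>A. c n * e n x) i = (if i \<in> A then c i else 0)"
  by (simp add: L2_inner_sum_left basis_L2 ortho if_distrib[of "\<lambda>x. _ * x"] cong: if_cong)

lemma inner_sum_right: "f \<in> L2 M \<Longrightarrow> L2_inner M f (\<lambda>x. \<Sum>n\<in>A. c n * e n x) = (\<Sum>n\<in>A. cnj (c n) * co f n)"
  by (simp add: L2_inner_sum_right basis_L2)

lemma norm_sum:
  assumes "finite A"
  shows "(L2_norm M (\<lambda>x. \<Sum>n\<in>A. c n * e n x))\<^sup>2 = (\<Sum>n\<in>A. (cmod (c n))\<^sup>2)"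
proof -
  have "L2_inner M (\<lambda>x. \<Sum>n\<in>A. c n * e n x) (\<lambda>x. \<Sum>n\<in>A. c n * e n x) = (\<Sum>n\<in>A. cnj (c n) * c n)"
    unfolding inner_sum_right[OF sum_L2] using assms by (intro sum.cong) (simp_all add: co_sum)
  also have "\<dots> = complex_of_real (\<Sum>n\<in>A. (cmod (c n))\<^sup>2)"
    by (simp add: complex_norm_square mult.commute del: of_real_power)
  finally show ?thesis by (simp only: L2_norm_sq Re_complex_of_real)
qed

lemma norm_remainder:
  assumes "f \<in> L2 M"
  shows "(L2_norm M (\<lambda>x. f x - (\<Sum>n<N. co f n * e n x)))\<^sup>2 = (L2_norm M f)\<^sup>2 - (\<Sum>n<N. (cmod (co f n))\<^sup>2)"
proof -
  have "L2_inner M f (\<lambda>x. \<Sum>n<N. co f n * e n x) = complex_of_real (\<Sum>n<N. (cmod (co f n))\<^sup>2)"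
    unfolding inner_sum_right[OF assms]
    by (simp add: complex_norm_square mult.commute del: of_real_power)
  then show ?thesis
    unfolding L2_norm_diff_sq[OF assms sum_L2] by (simp add: norm_sum)
qed

lemma Bessel: "f \<in> L2 M \<Longrightarrow> (\<Sum>n<N. (cmod (co f n))\<^sup>2) \<le> (L2_norm M f)\<^sup>2"
  using norm_remainder[of f N] zero_le_power2[of "L2_norm M (\<lambda>x. f x - (\<Sum>n<N. co f n * e n x))"] by linarith

lemma co_summable: "f \<in> L2 M \<Longrightarrow> summable (\<lambda>n. (cmod (co f n))\<^sup>2)"
  using Bessel[of f] by (intro summableI_nonneg_bounded[of _ "(L2_norm M f)\<^sup>2"]) auto

text \<open>By Pythagoras (\<open>norm_sum\<close>) the partial sums are Cauchy exactly when the
  sums of squared coefficients are. This is the source of every vector given by coefficients: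
  images, preimages under the resolvent, eigenvectors.\<close>

lemma Riesz_Fischer:
  assumes "summable (\<lambda>n. (cmod (c n))\<^sup>2)"
  obtains f where "f \<in> L2 M" "\<And>n. co f n = c n"
    "(\<lambda>N. L2_norm M (\<lambda>x. (\<Sum>n<N. c n * e n x) - f x)) \<longlonglongrightarrow> 0"
proof -
  let ?S = "\<lambda>N x. \<Sum>n<N. c n * e n x"
  have "\<exists>K. \<forall>i\<ge>K. \<forall>j\<ge>K. L2_norm M (\<lambda>x. ?S i x - ?S j x) < d" if "d > 0" for d
  proof -
    have "Cauchy (\<lambda>N. \<Sum>n<N. (cmod (c n))\<^sup>2)"
      using assms by (simp add: Cauchy_convergent_iff summable_iff_convergent)
    then obtain K where K: "\<And>i j. i \<ge> K \<Longrightarrow> j \<ge> K \<Longrightarrow> dist (\<Sum>n<i. (cmod (c n))\<^sup>2) (\<Sum>n<j. (cmod (c n))\<^sup>2) < d\<^sup>2"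
      using \<open>d > 0\<close> by (metis metric_CauchyD zero_less_power)
    have *: "L2_norm M (\<lambda>x. ?S i x - ?S j x) < d" if "j \<ge> K" "i \<ge> j" for i j
    proof -
      have tel: "(\<Sum>n<i. F n) - (\<Sum>n<j. F n) = (\<Sum>n\<in>{j..<i}. F n)" for F :: "nat \<Rightarrow> 'z::ab_group_add"
        using that(2) by (metis lessThan_atLeast0 sum_diff_nat_ivl zero_le)
      have "(L2_norm M (\<lambda>x. ?S i x - ?S j x))\<^sup>2 = (\<Sum>n<i. (cmod (c n))\<^sup>2) - (\<Sum>n<j. (cmod (c n))\<^sup>2)"
        unfolding tel by (rule norm_sum) simp
      also have "\<dots> < d\<^sup>2" using K[of i j] that unfolding dist_real_def by auto
      finally show ?thesis using \<open>d > 0\<close> by (simp add: power_less_imp_less_base)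
    qed
    have "L2_norm M (\<lambda>x. ?S i x - ?S j x) < d" if "i \<ge> K" "j \<ge> K" for i j
      using *[of i j] *[of j i] that L2_norm_minus_commute[of M "?S i" "?S j"] by (cases "j \<le> i") auto
    then show ?thesis by blast
  qed
  then obtain f where f: "f \<in> L2 M" "(\<lambda>N. L2_norm M (\<lambda>x. ?S N x - f x)) \<longlonglongrightarrow> 0"
    using L2_complete[of ?S M] sum_L2 by blast
  have "co f n = c n" for n
  proof (rule LIMSEQ_unique)
    show "(\<lambda>N. co (?S N) n) \<longlonglongrightarrow> co f n" by (rule L2_inner_tendsto[OF sum_L2 f(1) basis_L2 f(2)])
    have "\<forall>\<^sub>F N in sequentially. co (?S N) n = c n"
      by (rule eventually_sequentiallyI[of "Suc n"]) (simp add: co_sum)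
    then show "(\<lambda>N. co (?S N) n) \<longlonglongrightarrow> c n" by (rule tendsto_eventually)
  qed
  with f show ?thesis using that by blast
qed

lemma co_eqI:
  assumes "f \<in> L2 M" "g \<in> L2 M" "\<And>n. co f n = co g n"
  shows "AE x in M. f x = g x"
proof -
  have "AE x in M. f x - g x = 0"
    by (rule complete) (auto intro: L2_diff assms simp: L2_inner_diff_left basis_L2 assms)
  then show ?thesis by simp
qed

text \<open>\<open>Riesz_Fischer\<close> produces some limit with the same coefficients as
  \<open>f\<close>, and totality identifies it with \<open>f\<close> almost everywhere.\<close>

lemma expansion_tendsto:
  assumes f: "f \<in> L2 M"
  shows "(\<lambda>N. L2_norm M (\<lambda>x. (\<Sum>n<N. co f n * e n x) - f x)) \<longlonglongrightarrow> 0"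
proof -
  obtain g where g: "g \<in> L2 M" "\<And>n. co g n = co f n"
    "(\<lambda>N. L2_norm M (\<lambda>x. (\<Sum>n<N. co f n * e n x) - g x)) \<longlonglongrightarrow> 0"
    using Riesz_Fischer[OF co_summable[OF f]] by blast
  have ae: "AE x in M. g x = f x" using co_eqI[OF g(1) f g(2)] .
  have "L2_norm M (\<lambda>x. (\<Sum>n<N. co f n * e n x) - g x) = L2_norm M (\<lambda>x. (\<Sum>n<N. co f n * e n x) - f x)" for N
    by (rule L2_norm_cong_AE) (use ae in auto, (intro L2_measurable L2_diff sum_L2 g f)+)
  with g(3) show ?thesis by simp
qed

lemma Parseval:
  assumes f: "f \<in> L2 M" and g: "g \<in> L2 M"
  shows "(\<lambda>n. co f n * cnj (co g n)) sums L2_inner M f g"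
proof -
  have "(\<lambda>N. L2_inner M (\<lambda>x. \<Sum>n<N. co f n * e n x) g) \<longlonglongrightarrow> L2_inner M f g"
    by (rule L2_inner_tendsto[OF sum_L2 f g expansion_tendsto[OF f]])
  moreover have "L2_inner M (\<lambda>x. \<Sum>n<N. co f n * e n x) g = (\<Sum>n<N. co f n * cnj (co g n))" for N
    by (simp add: L2_inner_sum_left basis_L2 g L2_inner_commute[of M "e _" g])
  ultimately show ?thesis by (simp add: sums_def)
qed

lemma norm_sums:
  assumes f: "f \<in> L2 M"
  shows "(\<lambda>n. (cmod (co f n))\<^sup>2) sums (L2_norm M f)\<^sup>2"
  using sums_Re[OF Parseval[OF f f]]
  by (simp add: L2_norm_sq complex_norm_square[symmetric] del: of_real_power)

end

text \<open>The maximal domain is implicit: \<open>f\<close> belongs to it iff some square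
  integrable \<open>g\<close> has the coefficients \<open>l n\<close> times those of
  \<open>f\<close>. Since only inner products occur, the graph is closed under changes on null
  sets.\<close>

definition diag_op :: "'a measure \<Rightarrow> (nat \<Rightarrow> 'a \<Rightarrow> complex) \<Rightarrow> (nat \<Rightarrow> real) \<Rightarrow> 'a graph" where
  "diag_op M e l = {(f, g) \<in> L2 M \<times> L2 M. \<forall>n. L2_inner M g (e n) = complex_of_real (l n) * L2_inner M f (e n)}"

context L2_basis
begin

lemma diag_opD:
  assumes "(f, g) \<in> diag_op M e l"
  shows "f \<in> L2 M" "g \<in> L2 M" "co g n = complex_of_real (l n) * co f n"
  using assms by (auto simp: diag_op_def)

lemma diag_op_L2_operator: "L2_operator M (diag_op M e l)"
  unfolding L2_operator_def
proof (intro conjI allI impI ballI)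
  show "diag_op M e l \<subseteq> L2 M \<times> L2 M" by (auto simp: diag_op_def)
  show "((\<lambda>x. 0), (\<lambda>x. 0)) \<in> diag_op M e l" by (auto simp: diag_op_def L2_zero L2_inner_def)
next
  fix f g f' g' \<alpha> \<beta> assume a: "(f, g) \<in> diag_op M e l" "(f', g') \<in> diag_op M e l"
  note d = diag_opD[OF a(1)] diag_opD[OF a(2)]
  show "((\<lambda>x. \<alpha> * f x + \<beta> * f' x), (\<lambda>x. \<alpha> * g x + \<beta> * g' x)) \<in> diag_op M e l"
    using d by (auto simp: diag_op_def L2_add L2_scale L2_inner_add_left L2_inner_scale_left basis_L2 algebra_simps)
next
  fix f g f' g' assume a: "f' \<in> L2 M" "g' \<in> L2 M" "(f, g) \<in> diag_op M e l" "AE x in M. f x = f' x" "AE x in M. g x = g' x"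
  note d = diag_opD[OF a(3)]
  have "co f n = co f' n" "co g n = co g' n" for n
    by (rule L2_inner_cong_AE; use a d(1,2) basis_L2 in simp)+
  then show "(f', g') \<in> diag_op M e l" using a d by (simp add: diag_op_def)
next
  fix f g h assume a: "(f, g) \<in> diag_op M e l" "(f, h) \<in> diag_op M e l"
  show "AE x in M. g x = h x"
    using diag_opD[OF a(1)] diag_opD[OF a(2)] by (intro co_eqI) auto
qed

lemma basis_diag_op: "(e n, (\<lambda>x. complex_of_real (l n) * e n x)) \<in> diag_op M e l"
  by (auto simp: diag_op_def basis_L2 L2_scale L2_inner_scale_left ortho)

lemma sum_diag_op: "((\<lambda>x. \<Sum>n<N. c n * e n x), (\<lambda>x. \<Sum>n<N. (complex_of_real (l n) * c n) * e n x)) \<in> diag_op M e l"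
  unfolding diag_op_def
  by (auto simp: sum_L2 co_sum)

lemma diag_op_image:
  assumes "f \<in> L2 M" "summable (\<lambda>n. (l n)\<^sup>2 * (cmod (co f n))\<^sup>2)"
  obtains g where "(f, g) \<in> diag_op M e l"
proof -
  have "summable (\<lambda>n. (cmod (complex_of_real (l n) * co f n))\<^sup>2)"
    using assms(2) by (simp add: norm_mult power_mult_distrib)
  then obtain g where "g \<in> L2 M" "\<And>n. co g n = complex_of_real (l n) * co f n"
    by (rule Riesz_Fischer) blast
  then show ?thesis using that assms(1) by (auto simp: diag_op_def)
qed

text \<open>Finite expansions lie in the domain and are dense. Testing the adjoint relation on the
  single vectors \<open>e n\<close> gives the defining equation of the graph; the converse is
  Parseval with real \<open>l n\<close>.\<close>

lemma diag_op_self_adjoint: "self_adjoint M (diag_op M e l)"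
  unfolding self_adjoint_def
proof (intro conjI)
  show "L2_operator M (diag_op M e l)" by (rule diag_op_L2_operator)
  show "densely_defined M (diag_op M e l)"
    unfolding densely_defined_def
  proof (intro ballI allI impI)
    fix f :: "'a \<Rightarrow> complex" and d :: real assume f: "f \<in> L2 M" and "d > 0"
    then obtain N where N: "L2_norm M (\<lambda>x. (\<Sum>n<N. co f n * e n x) - f x) < d"
      using order_tendstoD(2)[OF expansion_tendsto[OF f]] by (auto simp: eventually_sequentially)
    show "\<exists>g\<in>Domain (diag_op M e l). L2_norm M (\<lambda>x. f x - g x) < d"
    proof (rule bexI)
      show "L2_norm M (\<lambda>x. f x - (\<Sum>n<N. co f n * e n x)) < d"
        using N by (subst L2_norm_minus_commute)
      show "(\<lambda>x. \<Sum>n<N. co f n * e n x) \<in> Domain (diag_op M e l)"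
        by (rule DomainI[OF sum_diag_op[where c = "co f"]])
    qed
  qed
  show "adjoint_graph M (diag_op M e l) = diag_op M e l"
  proof (intro equalityI subsetI)
    fix p assume p: "p \<in> adjoint_graph M (diag_op M e l)"
    obtain g h where gh: "p = (g, h)" by force
    have L: "g \<in> L2 M" "h \<in> L2 M"
      and adj: "\<And>f f'. (f, f') \<in> diag_op M e l \<Longrightarrow> L2_inner M f' g = L2_inner M f h"
      using p by (auto simp: adjoint_graph_def gh)
    have "co h n = complex_of_real (l n) * co g n" for n
    proof -
      have "complex_of_real (l n) * L2_inner M (e n) g = L2_inner M (e n) h"
        using adj[OF basis_diag_op[of n l]] by (simp add: L2_inner_scale_left)
      then have "cnj (complex_of_real (l n) * L2_inner M (e n) g) = cnj (L2_inner M (e n) h)" by simp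
      then show ?thesis by (simp add: L2_inner_commute[of M g] L2_inner_commute[of M h])
    qed
    then show "p \<in> diag_op M e l" using L by (auto simp: diag_op_def gh)
  next
    fix p assume p: "p \<in> diag_op M e l"
    obtain g h where gh: "p = (g, h)" by force
    note d = diag_opD[OF p[unfolded gh]]
    have "L2_inner M f' g = L2_inner M f h" if "(f, f') \<in> diag_op M e l" for f f'
    proof -
      note d' = diag_opD[OF that]
      have "(\<lambda>n. co f' n * cnj (co g n)) = (\<lambda>n. co f n * cnj (co h n))"
        using d(3) d'(3) by auto
      then show ?thesis using Parseval[OF d'(2) d(1)] Parseval[OF d'(1) d(2)] sums_unique2 by metis
    qed
    then show "p \<in> adjoint_graph M (diag_op M e l)" using d by (auto simp: adjoint_graph_def gh)
  qed
qed

lemma diag_op_positive: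
  assumes "\<And>n. l n \<ge> 0"
  shows "positive_self_adjoint M (diag_op M e l)"
  unfolding positive_self_adjoint_def
proof (intro conjI diag_op_self_adjoint, clarify)
  fix f g assume a: "(f, g) \<in> diag_op M e l"
  note d = diag_opD[OF a]
  have sm: "(\<lambda>n. Re (co g n * cnj (co f n))) sums Re (L2_inner M g f)"
    by (intro sums_Re Parseval d)
  have nn: "Re (co g n * cnj (co f n)) \<ge> 0" for n
    unfolding d(3) mult.assoc by (simp add: assms complex_mult_cnj)
  show "0 \<le> Re (L2_inner M g f)"
    unfolding sums_unique[OF sm] by (rule suminf_nonneg[OF sums_summable[OF sm] nn])
qed

text \<open>The multipliers compose coefficientwise, so the issue is the domain: a vector in the
  domain of \<open>diag_op M e l\<close> must have an intermediate image. This holds because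
  \<open>l n\<close> is at most 1 + (l n)^2, and both resulting series are squared norms.\<close>

lemma diag_op_square_root:
  assumes l: "\<And>n. l n \<ge> 0"
  shows "is_square_root M (diag_op M e (\<lambda>n. sqrt (l n))) (diag_op M e l)"
  unfolding is_square_root_def
proof (intro conjI diag_op_positive equalityI subsetI)
  fix p assume "p \<in> diag_op M e (\<lambda>n. sqrt (l n)) O diag_op M e (\<lambda>n. sqrt (l n))"
  then obtain f g h where p: "p = (f, h)" and a: "(f, g) \<in> diag_op M e (\<lambda>n. sqrt (l n))" "(g, h) \<in> diag_op M e (\<lambda>n. sqrt (l n))"
    by blast
  note d = diag_opD[OF a(1)] diag_opD[OF a(2)]
  have "complex_of_real (sqrt (l n)) * complex_of_real (sqrt (l n)) = complex_of_real (l n)" for n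
    using l[of n] by (simp flip: of_real_mult)
  then show "p \<in> diag_op M e l"
    using d by (auto simp: diag_op_def p mult.assoc[symmetric])
next
  fix p assume "p \<in> diag_op M e l"
  then obtain f h where p: "p = (f, h)" and a: "(f, h) \<in> diag_op M e l" by (cases p) auto
  note d = diag_opD[OF a]
  have "summable (\<lambda>n. (sqrt (l n))\<^sup>2 * (cmod (co f n))\<^sup>2)"
  proof (rule summable_comparison_test')
    show "summable (\<lambda>n. (cmod (co f n))\<^sup>2 + (cmod (co h n))\<^sup>2)"
      by (intro summable_add co_summable d)
    show "norm ((sqrt (l n))\<^sup>2 * (cmod (co f n))\<^sup>2) \<le> (cmod (co f n))\<^sup>2 + (cmod (co h n))\<^sup>2" for n
    proof -
      have "0 \<le> (l n - 1)\<^sup>2" by simp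
      then have "l n \<le> 1 + (l n)\<^sup>2" using l[of n] by (simp add: power2_diff)
      then have "l n * (cmod (co f n))\<^sup>2 \<le> (1 + (l n)\<^sup>2) * (cmod (co f n))\<^sup>2" by (intro mult_right_mono) auto
      then show ?thesis using l[of n] by (simp add: d(3) norm_mult power_mult_distrib algebra_simps)
    qed
  qed
  then obtain g where g: "(f, g) \<in> diag_op M e (\<lambda>n. sqrt (l n))" by (rule diag_op_image[OF d(1)])
  have "complex_of_real (sqrt (l n)) * complex_of_real (sqrt (l n)) = complex_of_real (l n)" for n
    using l[of n] by (simp flip: of_real_mult)
  then have "(g, h) \<in> diag_op M e (\<lambda>n. sqrt (l n))"
    using diag_opD[OF g] d by (auto simp: diag_op_def mult.assoc[symmetric])
  with g show "p \<in> diag_op M e (\<lambda>n. sqrt (l n)) O diag_op M e (\<lambda>n. sqrt (l n))" using p by blast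
qed (use l in auto)

text \<open>Dividing the coefficients by \<open>l n - z\<close> costs at most the factor 1/d, which
  gives the preimage; the same gap compared termwise in Parseval's sum gives the a priori
  bound.\<close>

lemma diag_op_resolvent:
  assumes "d > 0" and d: "\<And>n. d \<le> cmod (complex_of_real (l n) - z)"
  shows "z \<in> resolvent_set M (diag_op M e l)"
  unfolding resolvent_set_def
proof (intro CollectI conjI ballI, rule exI[of _ "1 / d"])
  show "\<forall>(f, h)\<in>diag_op M e l. L2_norm M f \<le> 1 / d * L2_norm M (\<lambda>x. h x - z * f x)"
  proof clarify
    fix f h assume a: "(f, h) \<in> diag_op M e l"
    note D = diag_opD[OF a]
    have L: "(\<lambda>x. h x - z * f x) \<in> L2 M" by (intro L2_diff L2_scale D)
    have c: "co (\<lambda>x. h x - z * f x) n = (complex_of_real (l n) - z) * co f n" for n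
      by (simp add: L2_inner_diff_left L2_scale D basis_L2 L2_inner_scale_left algebra_simps)
    have "d\<^sup>2 * (L2_norm M f)\<^sup>2 \<le> (L2_norm M (\<lambda>x. h x - z * f x))\<^sup>2"
    proof (rule sums_le)
      show "(\<lambda>n. d\<^sup>2 * (cmod (co f n))\<^sup>2) sums (d\<^sup>2 * (L2_norm M f)\<^sup>2)" by (intro sums_mult norm_sums D)
      show "(\<lambda>n. (cmod (co (\<lambda>x. h x - z * f x) n))\<^sup>2) sums (L2_norm M (\<lambda>x. h x - z * f x))\<^sup>2"
        by (rule norm_sums[OF L])
      show "d\<^sup>2 * (cmod (co f n))\<^sup>2 \<le> (cmod (co (\<lambda>x. h x - z * f x) n))\<^sup>2" for n
        unfolding c norm_mult power_mult_distrib using d[of n] \<open>d > 0\<close>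
        by (intro mult_right_mono power_mono) auto
    qed
    then have "(d * L2_norm M f)\<^sup>2 \<le> (L2_norm M (\<lambda>x. h x - z * f x))\<^sup>2" by (simp add: power_mult_distrib)
    then have "d * L2_norm M f \<le> L2_norm M (\<lambda>x. h x - z * f x)" by (rule power2_le_imp_le) simp
    then show "L2_norm M f \<le> 1 / d * L2_norm M (\<lambda>x. h x - z * f x)"
      using \<open>d > 0\<close> by (simp add: field_simps)
  qed
next
  fix g assume g: "g \<in> L2 M"
  have nz: "complex_of_real (l n) - z \<noteq> 0" for n using d[of n] \<open>d > 0\<close> by auto
  have "summable (\<lambda>n. (cmod (co g n / (complex_of_real (l n) - z)))\<^sup>2)"
  proof (rule summable_comparison_test')
    show "summable (\<lambda>n. (1 / d\<^sup>2) * (cmod (co g n))\<^sup>2)" by (intro summable_mult co_summable g)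
    show "norm ((cmod (co g n / (complex_of_real (l n) - z)))\<^sup>2) \<le> (1 / d\<^sup>2) * (cmod (co g n))\<^sup>2" for n
      using d[of n] \<open>d > 0\<close> by (simp add: norm_divide power_divide frac_le power_mono)
  qed
  then obtain f where f: "f \<in> L2 M" "\<And>n. co f n = co g n / (complex_of_real (l n) - z)"
    by (rule Riesz_Fischer) blast
  define h where "h x = g x + z * f x" for x
  have h: "h \<in> L2 M" unfolding h_def by (intro L2_add L2_scale f g)
  have "co h n = complex_of_real (l n) * co f n" for n
  proof -
    have "co g n = (complex_of_real (l n) - z) * co f n" using f(2)[of n] nz[of n] by simp
    moreover have "co h n = co g n + z * co f n"
      by (simp add: h_def[abs_def] L2_inner_add_left L2_scale f(1) g basis_L2 L2_inner_scale_left)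
    ultimately show ?thesis by (simp add: algebra_simps)
  qed
  then have "(f, h) \<in> diag_op M e l" using f h by (simp add: diag_op_def)
  then show "\<exists>(f, h)\<in>diag_op M e l. AE x in M. g x = h x - z * f x"
    by (rule bexI[rotated]) (simp add: h_def)
qed

lemma eigenspace_diag_op:
  "f \<in> eigenspace (diag_op M e l) z \<longleftrightarrow> f \<in> L2 M \<and> (\<forall>n. complex_of_real (l n) \<noteq> z \<longrightarrow> co f n = 0)"
  by (auto simp: eigenspace_def diag_op_def L2_scale L2_inner_scale_left)

lemma eigenspace_dim:
  assumes fin: "finite {n. complex_of_real (l n) = z}"
  shows "has_dim M (eigenspace (diag_op M e l) z) (card {n. complex_of_real (l n) = z})"
proof -
  define I where "I = {n. complex_of_real (l n) = z}"
  \<comment> \<open>\<open>has_dim\<close> wants vectors indexed by numbers below the dimension. The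
    enumeration \<open>b\<close> provides them, and sums are moved back to \<open>I\<close>, where
    \<open>co_sum\<close> reads off coefficients.\<close>
  obtain b where b: "bij_betw b {..<card I} I"
    using fin ex_bij_betw_nat_finite[of I] by (auto simp: I_def lessThan_atLeast0)
  have sum_eq: "(\<Sum>i<card I. c i * e (b i) x) = (\<Sum>n\<in>I. c (inv_into {..<card I} b n) * e n x)" for c x
  proof -
    have "(\<Sum>n\<in>I. c (inv_into {..<card I} b n) * e n x) = (\<Sum>i<card I. c (inv_into {..<card I} b (b i)) * e (b i) x)"
      by (rule sum.reindex_bij_betw[OF b, symmetric])
    also have "\<dots> = (\<Sum>i<card I. c i * e (b i) x)"
      using b by (intro sum.cong) (auto simp: bij_betw_inv_into_left)
    finally show ?thesis by simp
  qed
  have I: "finite I" using fin by (simp add: I_def)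
  show ?thesis
    unfolding has_dim_def I_def[symmetric]
  proof (intro exI[of _ "\<lambda>i. e (b i)"] conjI allI impI ballI)
    fix i assume "i < card I"
    then have "b i \<in> I" using b by (auto simp: bij_betw_def)
    then show "e (b i) \<in> eigenspace (diag_op M e l) z"
      by (auto simp: eigenspace_diag_op basis_L2 ortho I_def)
  next
    fix c i assume a: "AE x in M. (\<Sum>i<card I. c i * e (b i) x) = 0" and i: "i < card I"
    then have bi: "b i \<in> I" using b by (auto simp: bij_betw_def)
    have "co (\<lambda>x. \<Sum>n\<in>I. c (inv_into {..<card I} b n) * e n x) (b i) = 0"
      using a by (intro L2_inner_zero_AE sum_L2 basis_L2) (simp add: sum_eq)
    then show "c i = 0" using bi i b by (simp add: co_sum[OF I] bij_betw_inv_into_left)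
  next
    fix f assume f: "f \<in> eigenspace (diag_op M e l) z"
    have "co f n = (if n \<in> I then co f n else 0)" for n using f by (auto simp: eigenspace_diag_op I_def)
    then have "AE x in M. f x = (\<Sum>n\<in>I. co f n * e n x)"
      using f by (intro co_eqI sum_L2) (simp_all add: eigenspace_diag_op co_sum[OF I])
    moreover have "(\<Sum>n\<in>I. co f n * e n x) = (\<Sum>i<card I. co f (b i) * e (b i) x)" for x
      by (rule sum.reindex_bij_betw[OF b, symmetric])
    ultimately have "AE x in M. f x = (\<Sum>i<card I. co f (b i) * e (b i) x)" by simp
    then show "\<exists>c. AE x in M. f x = (\<Sum>i<card I. c i * e (b i) x)" by (rule exI[of _ "\<lambda>i. co f (b i)"])
  qed
qed

lemma diag_op_discrete:
  assumes top: "filterlim l at_top sequentially"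
  shows "finite {n. complex_of_real (l n) = z}"
    and "discrete_spectrum M (diag_op M e l)"
proof -
  have fin_le: "finite {n. l n \<le> B}" for B
  proof -
    obtain N where "\<And>n. n \<ge> N \<Longrightarrow> l n > B"
      using top by (metis (no_types, lifting) filterlim_at_top_dense eventually_sequentially)
    then have "{n. l n \<le> B} \<subseteq> {..<N}" by (metis (mono_tags, lifting) lessThan_iff mem_Collect_eq not_le subsetI)
    then show ?thesis by (rule finite_subset) simp
  qed
  show fin: "finite {n. complex_of_real (l n) = z}" for z
    by (rule finite_subset[OF _ fin_le[of "Re z"]]) auto
  \<comment> \<open>Finitely many \<open>l n\<close> are at most \<open>Re z + 1\<close> and all
    others have distance more than 1 from \<open>z\<close>. Indices with \<open>l n = z\<close> are
    left out, so that one statement serves both points off the range of \<open>l\<close> and the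
    isolation of points in it.\<close>
  have gap: "\<exists>d>0. \<forall>n. complex_of_real (l n) \<noteq> z \<longrightarrow> d \<le> cmod (complex_of_real (l n) - z)" for z
  proof -
    define A where "A = (\<lambda>n. cmod (complex_of_real (l n) - z)) ` {n. l n \<le> Re z + 1 \<and> complex_of_real (l n) \<noteq> z}"
    define d where "d = Min (insert 1 A)"
    have "finite A" unfolding A_def by (intro finite_imageI finite_subset[OF _ fin_le[of "Re z + 1"]]) auto
    then have "d > 0" unfolding d_def by (subst Min_gr_iff) (auto simp: A_def)
    moreover have "d \<le> cmod (complex_of_real (l n) - z)" if "complex_of_real (l n) \<noteq> z" for n
    proof (cases "l n \<le> Re z + 1")
      case True
      then show ?thesis unfolding d_def using that \<open>finite A\<close> by (intro Min_le) (auto simp: A_def)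
    next
      case False
      have "d \<le> 1" unfolding d_def using \<open>finite A\<close> by (intro Min_le) auto
      also have "\<dots> \<le> Re (complex_of_real (l n) - z)" using False by simp
      also have "\<dots> \<le> cmod (complex_of_real (l n) - z)" by (rule complex_Re_le_cmod)
      finally show ?thesis .
    qed
    ultimately show ?thesis by blast
  qed
  \<comment> \<open>If no \<open>l n\<close> equals \<open>z\<close>, the gap is a uniform distance
    and \<open>z\<close> lies in the resolvent set.\<close>
  have spec: "\<exists>n. complex_of_real (l n) = z" if "z \<in> spectrum M (diag_op M e l)" for z
    using that gap[of z] diag_op_resolvent[of _ l z] unfolding spectrum_def by (metis ComplD)
  show "discrete_spectrum M (diag_op M e l)"
    unfolding discrete_spectrum_def
  proof (intro ballI conjI)
    fix z assume z: "z \<in> spectrum M (diag_op M e l)"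
    obtain d where d: "d > 0" "\<forall>n. complex_of_real (l n) \<noteq> z \<longrightarrow> d \<le> cmod (complex_of_real (l n) - z)"
      using gap by blast
    show "z isolated_in spectrum M (diag_op M e l)"
      unfolding isolated_in_def
    proof (intro conjI exI[of _ "ball z d"])
      show "ball z d \<inter> spectrum M (diag_op M e l) = {z}"
      proof (intro equalityI subsetI)
        fix w assume w: "w \<in> ball z d \<inter> spectrum M (diag_op M e l)"
        then obtain n where "complex_of_real (l n) = w" using spec by blast
        then show "w \<in> {z}" using d(2) w by (auto simp: dist_norm norm_minus_commute)
      qed (use z d in auto)
    qed (use z in auto)
    obtain n where "complex_of_real (l n) = z" using spec[OF z] by blast
    then have "card {n. complex_of_real (l n) = z} > 0" using fin by (auto simp: card_gt_0_iff)
    then show "\<exists>n>0. has_dim M (eigenspace (diag_op M e l) z) n" using eigenspace_dim[OF fin] by blast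
  qed
qed

lemma diag_op_lists_eigenvalues:
  assumes top: "filterlim l at_top sequentially" and mono: "\<And>i j. i \<le> j \<Longrightarrow> l i \<le> l j"
  shows "lists_eigenvalues M (diag_op M e l) (\<lambda>k. l (k div 2))"
  unfolding lists_eigenvalues_def
proof (intro conjI allI impI)
  fix \<mu> :: real
  have eq: "{k. even k \<and> l (k div 2) = \<mu>} = (\<lambda>n. 2 * n) ` {n. complex_of_real (l n) = complex_of_real \<mu>}"
    by (auto elim!: evenE)
  show "finite {k. even k \<and> l (k div 2) = \<mu>}"
    unfolding eq by (intro finite_imageI diag_op_discrete top)
  have "card {k. even k \<and> l (k div 2) = \<mu>} = card {n. complex_of_real (l n) = complex_of_real \<mu>}"
    unfolding eq by (rule card_image) (simp add: inj_on_def)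
  then show "has_dim M (eigenspace (diag_op M e l) (complex_of_real \<mu>)) (card {k. even k \<and> l (k div 2) = \<mu>})"
    using eigenspace_dim[OF diag_op_discrete(1)[OF top]] by metis
qed (simp add: mono div_le_mono)

end

section \<open>Eigenvectors of a form relative to a compact form\<close>

text \<open>In the application \<open>t\<close> is the perturbed form and \<open>g\<close> the inner
  product of the original Hilbert space, both in coordinates where the unperturbed form is the inner
  product of the type. \<open>t_ge\<close> makes \<open>t\<close> control convergence,
  \<open>g_compact\<close> expresses the compact embedding of the form domain, and
  \<open>inf_dim\<close> keeps the successive minimisation from stopping.\<close>

locale form_pair =
  fixes t g :: "'a::{real_inner,complete_space} \<Rightarrow> 'a \<Rightarrow> real"
  assumes t_bil: "bounded_bilinear t" and g_bil: "bounded_bilinear g"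
    and t_sym: "t x y = t y x" and g_sym: "g x y = g y x"
    and t_ge: "x \<bullet> x \<le> t x x"
    and g_pos: "x \<noteq> 0 \<Longrightarrow> g x x > 0"
    and g_compact: "(\<And>k. norm (X k) \<le> B) \<Longrightarrow> \<exists>r::nat \<Rightarrow> nat. strict_mono r \<and>
      (\<forall>e>0. \<exists>K. \<forall>k\<ge>K. \<forall>l\<ge>K. g (X (r k) - X (r l)) (X (r k) - X (r l)) < e)"
    and inf_dim: "\<exists>w. w \<noteq> 0 \<and> (\<forall>i<n::nat. g w (e i) = 0)"
begin

lemmas t_simps = bounded_bilinear.add_left[OF t_bil] bounded_bilinear.add_right[OF t_bil]
  bounded_bilinear.diff_left[OF t_bil] bounded_bilinear.diff_right[OF t_bil]
  bounded_bilinear.scaleR_left[OF t_bil] bounded_bilinear.scaleR_right[OF t_bil]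
  bounded_bilinear.zero_left[OF t_bil] bounded_bilinear.zero_right[OF t_bil]
  bounded_bilinear.sum_left[OF t_bil] bounded_bilinear.sum_right[OF t_bil]

lemmas g_simps = bounded_bilinear.add_left[OF g_bil] bounded_bilinear.add_right[OF g_bil]
  bounded_bilinear.diff_left[OF g_bil] bounded_bilinear.diff_right[OF g_bil]
  bounded_bilinear.scaleR_left[OF g_bil] bounded_bilinear.scaleR_right[OF g_bil]
  bounded_bilinear.zero_left[OF g_bil] bounded_bilinear.zero_right[OF g_bil]
  bounded_bilinear.sum_left[OF g_bil] bounded_bilinear.sum_right[OF g_bil]

lemma t_nonneg: "t x x \<ge> 0"
  using t_ge[of x] inner_ge_zero[of x] by linarith

lemma g_nonneg: "g x x \<ge> 0"
  using g_pos[of x] by (cases "x = 0") (auto simp: g_simps)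

lemma norm_le_t: "(norm x)\<^sup>2 \<le> t x x"
  using t_ge[of x] by (simp add: power2_norm_eq_inner)

lemma Cauchy_if_t_small:
  assumes "\<And>e. e > 0 \<Longrightarrow> \<exists>K. \<forall>k\<ge>K. \<forall>l\<ge>K. t (X k - X l) (X k - X l) < e"
  shows "Cauchy X"
proof (rule metric_CauchyI)
  fix e :: real assume "e > 0"
  then obtain K where K: "\<forall>k\<ge>K. \<forall>l\<ge>K. t (X k - X l) (X k - X l) < e\<^sup>2"
    using assms[of "e\<^sup>2"] by auto
  have "dist (X k) (X l) < e" if "k \<ge> K" "l \<ge> K" for k l
  proof -
    have "(norm (X k - X l))\<^sup>2 < e\<^sup>2"
      using norm_le_t[of "X k - X l"] K that by fastforce
    then show ?thesis using \<open>e > 0\<close> by (simp add: dist_norm power_less_imp_less_base)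
  qed
  then show "\<exists>K. \<forall>k\<ge>K. \<forall>l\<ge>K. dist (X k) (X l) < e" by blast
qed

text \<open>A bounded minimising sequence has a subsequence that is Cauchy for \<open>g\<close>; the
  parallelogram law lifts this to \<open>t\<close>, so the minimum is attained by norm convergence
  and no weak topology enters.\<close>

lemma minimiser_exists:
  fixes e :: "nat \<Rightarrow> 'a" and n :: nat
  defines "S \<equiv> {w. \<forall>i<n. g w (e i) = 0}"
  obtains x where "x \<in> S" "g x x = 1" "\<And>w. w \<in> S \<Longrightarrow> t x x * g w w \<le> t w w"
proof -
  define A where "A = {t w w | w. w \<in> S \<and> g w w = 1}"
  define m where "m = Inf A"
  obtain w0 where w0: "w0 \<noteq> 0" "w0 \<in> S" using inf_dim[of n e] by (auto simp: S_def)
  have S_scale: "c *\<^sub>R w \<in> S" if "w \<in> S" for c w using that by (simp add: S_def g_simps)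
  have S_add: "v + w \<in> S" if "v \<in> S" "w \<in> S" for v w using that by (simp add: S_def g_simps)
  have normalise: "g ((1 / sqrt (g w w)) *\<^sub>R w) ((1 / sqrt (g w w)) *\<^sub>R w) = 1" if "w \<noteq> 0" for w
    using g_pos[OF that] by (simp add: g_simps field_simps)
  have "A \<noteq> {}" using w0 normalise[of w0] S_scale[of w0] unfolding A_def by blast
  have bdd: "bdd_below A" unfolding A_def by (rule bdd_belowI[of _ 0]) (auto simp: t_nonneg)
  have m_le: "m * g w w \<le> t w w" if "w \<in> S" for w
  proof (cases "w = 0")
    case True then show ?thesis by (simp add: t_simps g_simps)
  next
    case False
    let ?v = "(1 / sqrt (g w w)) *\<^sub>R w"
    have "t ?v ?v \<in> A" unfolding A_def using normalise[OF False] S_scale[OF that] by blast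
    then have "m \<le> t ?v ?v" unfolding m_def using bdd by (rule cInf_lower)
    also have "t ?v ?v = t w w / g w w" using g_pos[OF False] by (simp add: t_simps field_simps)
    finally show ?thesis using g_pos[OF False] by (simp add: field_simps)
  qed
  have "\<exists>w. w \<in> S \<and> g w w = 1 \<and> t w w < m + 1 / real (Suc k)" for k
  proof -
    have "\<exists>a\<in>A. a < m + 1 / real (Suc k)"
      unfolding m_def using \<open>A \<noteq> {}\<close> bdd by (intro cInf_lessD) (auto simp: )
    then show ?thesis unfolding A_def by auto
  qed
  then obtain X where X: "\<And>k. X k \<in> S" "\<And>k. g (X k) (X k) = 1" "\<And>k. t (X k) (X k) < m + 1 / real (Suc k)"
    by metis
  have "norm (X k) \<le> sqrt (m + 1)" for k
  proof -
    have "1 / real (Suc k) \<le> 1" by simp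
    then have "(norm (X k))\<^sup>2 \<le> m + 1" using norm_le_t[of "X k"] X(3)[of k] by linarith
    then show ?thesis using real_le_rsqrt by blast
  qed
  then obtain r :: "nat \<Rightarrow> nat" where r: "strict_mono r"
    and gC: "\<And>e. e > 0 \<Longrightarrow> \<exists>K. \<forall>k\<ge>K. \<forall>l\<ge>K. g (X (r k) - X (r l)) (X (r k) - X (r l)) < e"
    using g_compact by meson
  define Y where "Y = X \<circ> r"
  have Y: "Y k \<in> S" "g (Y k) (Y k) = 1" "t (Y k) (Y k) < m + 1 / real (Suc k)" for k
  proof -
    have "1 / real (Suc (r k)) \<le> 1 / real (Suc k)" using seq_suble[OF r, of k] by (simp add: frac_le)
    then show "t (Y k) (Y k) < m + 1 / real (Suc k)" using X(3)[of "r k"] by (simp add: Y_def)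
  qed (auto simp: Y_def X)
  have m0: "m \<ge> 0" unfolding m_def using \<open>A \<noteq> {}\<close> by (intro cInf_greatest) (auto simp: A_def t_nonneg)
  \<comment> \<open>In the parallelogram law the sum \<open>Y k + Y l\<close> is again admissible,
    so its \<open>t\<close> value is at least m times its \<open>g\<close> value, which is 4 minus
    that of the difference. The terms 4 m cancel.\<close>
  have tY: "t (Y k - Y l) (Y k - Y l) \<le> 2 / real (Suc k) + 2 / real (Suc l) + m * g (Y k - Y l) (Y k - Y l)" for k l
  proof -
    have "m * g (Y k + Y l) (Y k + Y l) \<le> t (Y k + Y l) (Y k + Y l)" using m_le S_add Y by blast
    moreover have "t (Y k + Y l) (Y k + Y l) + t (Y k - Y l) (Y k - Y l) = 2 * t (Y k) (Y k) + 2 * t (Y l) (Y l)"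
      by (simp add: t_simps)
    moreover have "g (Y k + Y l) (Y k + Y l) = 4 - g (Y k - Y l) (Y k - Y l)"
      using Y(2) by (simp add: g_simps)
    moreover have "2 * t (Y k) (Y k) < 2 * m + 2 / real (Suc k)" "2 * t (Y l) (Y l) < 2 * m + 2 / real (Suc l)"
      using Y(3)[of k] Y(3)[of l] by auto
    ultimately show ?thesis by (simp add: algebra_simps)
  qed
  have "Cauchy Y"
  proof (rule Cauchy_if_t_small)
    fix e :: real assume "e > 0"
    \<comment> \<open>Each of the three terms of \<open>tY\<close> receives e/3;
      \<open>m + 1\<close> keeps the denominator positive if m = 0.\<close>
    obtain K1 where K1: "\<forall>k\<ge>K1. \<forall>l\<ge>K1. g (Y k - Y l) (Y k - Y l) < e / (3 * (m + 1))"
      using gC[of "e / (3 * (m + 1))"] \<open>e > 0\<close> m0 by (auto simp: Y_def)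
    obtain K2 :: nat where K2: "6 / e < real K2" using reals_Archimedean2 by blast
    have small: "2 / real (Suc k) < e / 3" if "k \<ge> K2" for k
    proof -
      have "6 / e < real (Suc k)" using K2 that by linarith
      then show ?thesis using \<open>e > 0\<close> by (simp add: field_simps)
    qed
    have "t (Y k - Y l) (Y k - Y l) < e" if "k \<ge> max K1 K2" "l \<ge> max K1 K2" for k l
    proof -
      have "m * g (Y k - Y l) (Y k - Y l) \<le> m * (e / (3 * (m + 1)))"
        using K1 that m0 by (intro mult_left_mono) (auto intro: less_imp_le)
      also have "\<dots> \<le> e / 3" using m0 \<open>e > 0\<close> by (simp add: field_simps)
      finally show ?thesis using tY[of k l] small[of k] small[of l] that by auto
    qed
    then show "\<exists>K. \<forall>k\<ge>K. \<forall>l\<ge>K. t (Y k - Y l) (Y k - Y l) < e" by blast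
  qed
  then obtain x where x: "Y \<longlonglongrightarrow> x" using Cauchy_convergent convergent_def by blast
  have "x \<in> S"
  proof -
    have "g x (e i) = 0" if "i < n" for i
    proof (rule LIMSEQ_unique)
      show "(\<lambda>k. g (Y k) (e i)) \<longlonglongrightarrow> g x (e i)"
        by (intro bounded_bilinear.tendsto[OF g_bil] x tendsto_const)
      show "(\<lambda>k. g (Y k) (e i)) \<longlonglongrightarrow> 0" using Y(1) that by (simp add: S_def)
    qed
    then show ?thesis by (simp add: S_def)
  qed
  moreover have "g x x = 1"
  proof (rule LIMSEQ_unique)
    show "(\<lambda>k. g (Y k) (Y k)) \<longlonglongrightarrow> g x x" by (intro bounded_bilinear.tendsto[OF g_bil] x)
    show "(\<lambda>k. g (Y k) (Y k)) \<longlonglongrightarrow> 1" by (simp add: Y)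
  qed
  moreover have "t x x \<le> m"
  proof (rule LIMSEQ_le)
    show "(\<lambda>k. t (Y k) (Y k)) \<longlonglongrightarrow> t x x" by (intro bounded_bilinear.tendsto[OF t_bil] x)
    show "(\<lambda>k. m + 1 / real (Suc k)) \<longlonglongrightarrow> m"
      using tendsto_add[OF tendsto_const LIMSEQ_inverse_real_of_nat, of m] by (simp add: inverse_eq_divide)
    show "\<exists>N. \<forall>k\<ge>N. t (Y k) (Y k) \<le> m + 1 / real (Suc k)" using Y(3) less_imp_le by blast
  qed
  ultimately show ?thesis
  proof (intro that[of x])
    fix w assume "w \<in> S" "t x x \<le> m"
    then show "t x x * g w w \<le> t w w"
      using m_le[of w] mult_right_mono[OF \<open>t x x \<le> m\<close> g_nonneg[of w]] by linarith
  qed auto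
qed

lemma eigenvector_step:
  fixes e :: "nat \<Rightarrow> 'a" and n :: nat
  assumes orth: "\<And>i j. i < n \<Longrightarrow> j < n \<Longrightarrow> g (e i) (e j) = (if i = j then 1 else 0)"
    and eig: "\<And>i z. i < n \<Longrightarrow> t (e i) z = t (e i) (e i) * g (e i) z"
  shows "\<exists>x. g x x = 1 \<and> (\<forall>i<n. g x (e i) = 0) \<and>
    (\<forall>w. (\<forall>i<n. g w (e i) = 0) \<longrightarrow> t x x * g w w \<le> t w w) \<and> (\<forall>z. t x z = t x x * g x z)"
proof -
  obtain x where x0: "x \<in> {w. \<forall>i<n. g w (e i) = 0}" "g x x = 1"
    and min0: "\<And>w. w \<in> {w. \<forall>i<n. g w (e i) = 0} \<Longrightarrow> t x x * g w w \<le> t w w"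
    using minimiser_exists[of n e] by blast
  then have x: "\<forall>i<n. g x (e i) = 0" "g x x = 1" by auto
  have min: "t x x * g w w \<le> t w w" if "\<forall>i<n. g w (e i) = 0" for w
    using min0[of w] that by simp
  have S: "t x z = t x x * g x z" if z: "\<forall>i<n. g z (e i) = 0" for z
  proof (rule ccontr)
    define b where "b = t x z - t x x * g x z"
    define c where "c = t z z - t x x * g z z"
    assume "t x z \<noteq> t x x * g x z"
    then have "b \<noteq> 0" by (simp add: b_def)
    have "c \<ge> 0" using min[OF z] by (simp add: c_def)
    \<comment> \<open>The first variation: the quadratic 2 b \<tau> + c \<tau>^2 is negative at this
      value. With c alone in the denominator the choice would fail for c = 0.\<close>
    define \<tau> where "\<tau> = - b / (c + 1)"
    have "t x x * g (x + \<tau> *\<^sub>R z) (x + \<tau> *\<^sub>R z) \<le> t (x + \<tau> *\<^sub>R z) (x + \<tau> *\<^sub>R z)"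
      using x z by (intro min) (simp add: g_simps)
    then have "0 \<le> 2 * \<tau> * b + \<tau>\<^sup>2 * c"
      using x(2) by (simp add: b_def c_def t_simps g_simps t_sym[of z x] g_sym[of z x] algebra_simps power2_eq_square)
    also have "\<dots> = - (b\<^sup>2 * (c + 2) / (c + 1)\<^sup>2)"
      using \<open>c \<ge> 0\<close> by (simp add: \<tau>_def divide_simps) (simp add: algebra_simps power2_eq_square)
    also have "\<dots> < 0" using \<open>b \<noteq> 0\<close> \<open>c \<ge> 0\<close> by (simp add: divide_pos_pos)
    finally show False by simp
  qed
  have "t x z = t x x * g x z" for z
  proof -
    \<comment> \<open>The \<open>g\<close> projection on the earlier eigenvectors. On
      \<open>z - v\<close> the equation is the first variation; on \<open>v\<close> both sides
      vanish, because the \<open>e i\<close> are eigenvectors \<open>g\<close>-orthogonal to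
      \<open>x\<close>.\<close>
    define v where "v = (\<Sum>i<n. g z (e i) *\<^sub>R e i)"
    have "g (z - v) (e j) = 0" if "j < n" for j
    proof -
      have "g v (e j) = (\<Sum>i<n. g z (e i) * (if i = j then 1 else 0))"
        unfolding v_def g_simps using that by (intro sum.cong) (auto simp: orth)
      also have "\<dots> = g z (e j)" using that by (simp add: sum.delta if_distrib[of "\<lambda>x. _ * x"] cong: if_cong)
      finally show ?thesis by (simp add: g_simps)
    qed
    then have "t x (z - v) = t x x * g x (z - v)" using S by blast
    moreover have "t x (e i) = 0" if "i < n" for i using eig[OF that, of x] x(1) that by (simp add: t_sym[of x] g_sym[of _ x])
    then have "t x v = 0" by (simp add: v_def t_simps)
    moreover have "g x v = 0" using x(1) by (simp add: v_def g_simps)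
    ultimately show ?thesis by (simp add: t_simps g_simps)
  qed
  with x min show ?thesis by blast
qed

text \<open>Recursive choice, since the condition on the n-th vector mentions only the earlier ones.
  The minimality clause is kept beside the eigenvector equation because monotonicity, completeness
  and the upper eigenvalue bound all use it.\<close>

lemma eigenvectors_exist:
  "\<exists>e :: nat \<Rightarrow> 'a. (\<forall>i j. g (e i) (e j) = (if i = j then 1 else 0)) \<and>
    (\<forall>n z. t (e n) z = t (e n) (e n) * g (e n) z) \<and>
    (\<forall>n w. (\<forall>i<n. g w (e i) = 0) \<longrightarrow> t (e n) (e n) * g w w \<le> t w w)"
proof -
  define P where "P f n x \<longleftrightarrow> g x x = 1 \<and> (\<forall>i<n. g x (f i) = 0) \<and>
    (\<forall>w. (\<forall>i<n. g w (f i) = 0) \<longrightarrow> t x x * g w w \<le> t w w) \<and> (\<forall>z. t x z = t x x * g x z)"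
    for f :: "nat \<Rightarrow> 'a" and n :: nat and x
  have "\<exists>f. \<forall>n. P f n (f n)"
  proof (rule dependent_wellorder_choice)
    show "P f n x = P f' n x" if "\<And>y. y < n \<Longrightarrow> f y = f' y" for x f f' n
      using that by (simp add: P_def)
    fix n f assume *: "\<And>i. i < n \<Longrightarrow> P f i (f i)"
    have Pn: "g (f i) (f i) = 1" "j < i \<Longrightarrow> g (f i) (f j) = 0" if "i < n" for i j
      using *[OF that] by (simp_all add: P_def)
    have "g (f i) (f j) = (if i = j then 1 else 0)" if "i < n" "j < n" for i j
      using Pn[OF that(1)] Pn[OF that(2)] g_sym[of "f i" "f j"]
      by (cases i j rule: linorder_cases) simp_all
    moreover have "t (f i) z = t (f i) (f i) * g (f i) z" if "i < n" for i z
      using *[OF that] unfolding P_def by blast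
    ultimately show "\<exists>x. P f n x" unfolding P_def using eigenvector_step[of n f] by blast
  qed
  then obtain f where f: "\<And>n. P f n (f n)" by blast
  have Pf: "g (f i) (f i) = 1" "j < i \<Longrightarrow> g (f i) (f j) = 0" for i j
    using f[of i] by (simp_all add: P_def)
  have "g (f i) (f j) = (if i = j then 1 else 0)" for i j
    using Pf[of i] Pf[of j] g_sym[of "f i" "f j"]
    by (cases i j rule: linorder_cases) simp_all
  moreover have "t (f n) z = t (f n) (f n) * g (f n) z" for n z using f[of n] unfolding P_def by blast
  moreover have "t (f n) (f n) * g w w \<le> t w w" if "\<And>i. i < n \<Longrightarrow> g w (f i) = 0" for n w
    using f[of n] that unfolding P_def by blast
  ultimately show ?thesis by blast
qed

end

section \<open>Expansion along the successive minimisers\<close>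

locale form_pair_eigenbasis = form_pair t g
    for t g :: "'a::{real_inner,complete_space} \<Rightarrow> 'a \<Rightarrow> real" +
  fixes e :: "nat \<Rightarrow> 'a" and l :: "nat \<Rightarrow> real"
  assumes orth: "g (e i) (e j) = (if i = j then 1 else 0)"
    and eig: "t (e n) z = l n * g (e n) z"
    and min: "(\<And>i. i < n \<Longrightarrow> g w (e i) = 0) \<Longrightarrow> l n * g w w \<le> t w w"
begin

lemma l_eq: "l n = t (e n) (e n)"
  using eig[of n "e n"] orth[of n n] by simp

lemma t_eig_right: "t z (e n) = l n * g z (e n)"
  by (metis eig t_sym g_sym)

lemma l_nonneg: "l n \<ge> 0"
  by (simp add: l_eq t_nonneg)

text \<open>For \<open>i \<le> j\<close> the vector \<open>e j\<close> competes in the minimisation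
  that produced \<open>e i\<close>.\<close>

lemma l_mono: "i \<le> j \<Longrightarrow> l i \<le> l j"
  using min[of i "e j"] orth by (auto simp: l_eq[symmetric])

definition partial :: "'a \<Rightarrow> nat \<Rightarrow> 'a" where
  "partial w N = (\<Sum>n<N. g w (e n) *\<^sub>R e n)"

lemma g_sum_left: "finite A \<Longrightarrow> g (\<Sum>n\<in>A. c n *\<^sub>R e n) (e i) = (if i \<in> A then c i else 0)"
  by (simp add: g_simps orth if_distrib[of "\<lambda>x. _ * x"] cong: if_cong)

lemma t_sum: "finite A \<Longrightarrow> t (\<Sum>n\<in>A. c n *\<^sub>R e n) (\<Sum>n\<in>A. c n *\<^sub>R e n) = (\<Sum>n\<in>A. l n * (c n)\<^sup>2)"
proof -
  assume A: "finite A"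
  have "t (\<Sum>n\<in>A. c n *\<^sub>R e n) (\<Sum>n\<in>A. c n *\<^sub>R e n) = (\<Sum>n\<in>A. c n * t (\<Sum>n\<in>A. c n *\<^sub>R e n) (e n))"
    by (subst bounded_bilinear.sum_right[OF t_bil]) (simp add: bounded_bilinear.scaleR_right[OF t_bil])
  also have "\<dots> = (\<Sum>n\<in>A. l n * (c n)\<^sup>2)"
    using A by (intro sum.cong) (auto simp: t_eig_right g_sum_left power2_eq_square)
  finally show ?thesis .
qed

lemma g_partial: "g (w - partial w N) (e i) = (if i < N then 0 else g w (e i))"
  unfolding partial_def bounded_bilinear.diff_left[OF g_bil] by (simp add: g_sum_left)

lemma t_remainder: "t (w - partial w N) (w - partial w N) = t w w - (\<Sum>n<N. l n * (g w (e n))\<^sup>2)"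
proof -
  have "t w (partial w N) = (\<Sum>n<N. l n * (g w (e n))\<^sup>2)"
    unfolding partial_def bounded_bilinear.sum_right[OF t_bil]
    by (simp add: bounded_bilinear.scaleR_right[OF t_bil] t_eig_right power2_eq_square algebra_simps)
  moreover have "t (partial w N) (partial w N) = (\<Sum>n<N. l n * (g w (e n))\<^sup>2)"
    unfolding partial_def by (rule t_sum) simp
  ultimately show ?thesis
    unfolding bounded_bilinear.diff_left[OF t_bil] bounded_bilinear.diff_right[OF t_bil]
    by (simp add: t_sym[of "partial w N" w])
qed

lemma Bessel_t: "(\<Sum>n<N. l n * (g w (e n))\<^sup>2) \<le> t w w"
  using t_remainder[of w N] t_nonneg[of "w - partial w N"] by simp

text \<open>Partial sums are Cauchy for \<open>t\<close>, which dominates the norm. The coefficients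
  may be prescribed freely, so the lemma also constructs vectors, as in
  \<open>domain_rep\<close>.\<close>

lemma convergent_expansion:
  assumes "summable (\<lambda>n. l n * (c n)\<^sup>2)"
  shows "convergent (\<lambda>N. \<Sum>n<N. c n *\<^sub>R e n)"
proof -
  have "Cauchy (\<lambda>N. \<Sum>n<N. c n *\<^sub>R e n)"
  proof (rule Cauchy_if_t_small)
    fix d :: real assume "d > 0"
    have "Cauchy (\<lambda>N. \<Sum>n<N. l n * (c n)\<^sup>2)"
      using assms by (simp add: Cauchy_convergent_iff summable_iff_convergent)
    then obtain K where K: "\<forall>M\<ge>K. \<forall>N\<ge>K. dist (\<Sum>n<M. l n * (c n)\<^sup>2) (\<Sum>n<N. l n * (c n)\<^sup>2) < d"
      using \<open>d > 0\<close> by (meson metric_CauchyD)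
    have *: "t ((\<Sum>n<M. c n *\<^sub>R e n) - (\<Sum>n<N. c n *\<^sub>R e n)) ((\<Sum>n<M. c n *\<^sub>R e n) - (\<Sum>n<N. c n *\<^sub>R e n)) < d"
      if "M \<ge> N" "N \<ge> K" for M N
    proof -
      have *: "(\<Sum>n<M. f n) - (\<Sum>n<N. f n) = (\<Sum>n\<in>{N..<M}. f n)" for f :: "nat \<Rightarrow> 'z::ab_group_add"
        using that(1) by (metis lessThan_atLeast0 sum_diff_nat_ivl zero_le)
      have "dist (\<Sum>n<M. l n * (c n)\<^sup>2) (\<Sum>n<N. l n * (c n)\<^sup>2) < d" using K that by simp
      then show ?thesis unfolding * t_sum[OF finite_atLeastLessThan] dist_real_def by linarith
    qed
    have "t ((\<Sum>n<M. c n *\<^sub>R e n) - (\<Sum>n<N. c n *\<^sub>R e n)) ((\<Sum>n<M. c n *\<^sub>R e n) - (\<Sum>n<N. c n *\<^sub>R e n)) < d"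
      if "M \<ge> K" "N \<ge> K" for M N
    proof (cases "N \<le> M")
      case True then show ?thesis using * that by blast
    next
      case False
      have "t (x - y) (x - y) = t (y - x) (y - x)" for x y by (simp add: t_simps)
      then show ?thesis using *[of M N] that False by (metis nat_le_linear)
    qed
    then show "\<exists>K. \<forall>M\<ge>K. \<forall>N\<ge>K. t ((\<Sum>n<M. c n *\<^sub>R e n) - (\<Sum>n<N. c n *\<^sub>R e n)) ((\<Sum>n<M. c n *\<^sub>R e n) - (\<Sum>n<N. c n *\<^sub>R e n)) < d"
      by blast
  qed
  then show ?thesis by (rule Cauchy_convergent)
qed

context
  assumes l_top: "filterlim l at_top sequentially"
begin

text \<open>Bessel's inequality for \<open>t\<close> yields some limit v. The remainder is
  admissible for the N-th minimisation, so its \<open>g\<close> value is at most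
  \<open>t w w / l N\<close>; since \<open>l\<close> tends to infinity,
  \<open>g (w - v) (w - v)\<close> vanishes and v is w.\<close>

lemma partial_tendsto: "partial w \<longlonglongrightarrow> w"
proof -
  have "summable (\<lambda>n. l n * (g w (e n))\<^sup>2)"
    using Bessel_t[of w] l_nonneg by (intro summableI_nonneg_bounded[of _ "t w w"]) auto
  then obtain v where v: "partial w \<longlonglongrightarrow> v"
    using convergent_expansion[of "\<lambda>n. g w (e n)"] unfolding partial_def convergent_def by blast
  then have lim: "(\<lambda>N. w - partial w N) \<longlonglongrightarrow> w - v" by (intro tendsto_intros)
  have "(\<lambda>N. g (w - partial w N) (w - partial w N)) \<longlonglongrightarrow> g (w - v) (w - v)"
    by (intro bounded_bilinear.tendsto[OF g_bil] lim)
  moreover have "(\<lambda>N. g (w - partial w N) (w - partial w N)) \<longlonglongrightarrow> 0"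
  proof (rule tendsto_sandwich)
    show "\<forall>\<^sub>F N in sequentially. 0 \<le> g (w - partial w N) (w - partial w N)" by (simp add: g_nonneg)
    have "\<forall>\<^sub>F N in sequentially. l N \<ge> 1" using l_top by (simp add: filterlim_at_top)
    then show "\<forall>\<^sub>F N in sequentially. g (w - partial w N) (w - partial w N) \<le> t w w / l N"
    proof eventually_elim
      case (elim N)
      have "l N * g (w - partial w N) (w - partial w N) \<le> t (w - partial w N) (w - partial w N)"
        by (rule min) (simp add: g_partial)
      also have "\<dots> \<le> t w w"
        unfolding t_remainder using l_nonneg by (simp add: sum_nonneg)
      finally show ?case using elim by (simp add: field_simps)
    qed
    show "(\<lambda>N. t w w / l N) \<longlonglongrightarrow> 0" using l_top by (intro real_tendsto_divide_at_top[of _ "t w w"]) auto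
  qed simp
  ultimately have "g (w - v) (w - v) = 0" by (rule LIMSEQ_unique)
  then have "w = v" using g_pos[of "w - v"] by auto
  with v show ?thesis by simp
qed

lemma t_sums: "(\<lambda>n. l n * (g w (e n) * g z (e n))) sums t w z"
proof -
  have "(\<lambda>N. t (partial w N) z) \<longlonglongrightarrow> t w z"
    by (intro bounded_bilinear.tendsto[OF t_bil] partial_tendsto tendsto_const)
  moreover have "t (partial w N) z = (\<Sum>n<N. l n * (g w (e n) * g z (e n)))" for N
    unfolding partial_def bounded_bilinear.sum_left[OF t_bil]
    by (simp add: bounded_bilinear.scaleR_left[OF t_bil] eig g_sym[of z] algebra_simps)
  ultimately show ?thesis by (simp add: sums_def)
qed

end

end

section \<open>Square summable real sequences\<close>

typedef ell2 = "{f :: nat \<Rightarrow> real. summable (\<lambda>n. (f n)\<^sup>2)}"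
  morphisms coord Abs_ell2 by (rule exI[of _ "\<lambda>_. 0"]) simp

lemma coord_summable: "summable (\<lambda>n. (coord x n)\<^sup>2)"
  using coord[of x] by simp

lemma coord_Abs: "summable (\<lambda>n. (f n)\<^sup>2) \<Longrightarrow> coord (Abs_ell2 f) = f"
  by (simp add: Abs_ell2_inverse)

lemma ell2_eqI: "(\<And>n. coord x n = coord y n) \<Longrightarrow> x = y"
  using coord_inject by blast

lemma summable_mult_squares:
  fixes f g :: "nat \<Rightarrow> real"
  assumes "summable (\<lambda>n. (f n)\<^sup>2)" "summable (\<lambda>n. (g n)\<^sup>2)"
  shows "summable (\<lambda>n. f n * g n)"
proof (rule summable_comparison_test')
  show "summable (\<lambda>n. (f n)\<^sup>2 + (g n)\<^sup>2)" using assms by (rule summable_add)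
  show "norm (f n * g n) \<le> (f n)\<^sup>2 + (g n)\<^sup>2" for n
  proof -
    have "0 \<le> (\<bar>f n\<bar> - \<bar>g n\<bar>)\<^sup>2" by simp
    then have "2 * (\<bar>f n\<bar> * \<bar>g n\<bar>) \<le> (f n)\<^sup>2 + (g n)\<^sup>2" by (simp add: power2_diff)
    moreover have "0 \<le> \<bar>f n\<bar> * \<bar>g n\<bar>" by simp
    ultimately show ?thesis unfolding real_norm_def abs_mult by linarith
  qed
qed

lemma summable_add_squares:
  fixes f g :: "nat \<Rightarrow> real"
  assumes "summable (\<lambda>n. (f n)\<^sup>2)" "summable (\<lambda>n. (g n)\<^sup>2)"
  shows "summable (\<lambda>n. (f n + g n)\<^sup>2)"
proof -
  have "summable (\<lambda>n. (f n)\<^sup>2 + (g n)\<^sup>2 + 2 * (f n * g n))"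
    using assms summable_mult_squares[OF assms] by (intro summable_add summable_mult)
  then show ?thesis by (simp add: power2_sum mult.assoc)
qed

instantiation ell2 :: real_inner
begin

definition "0 = Abs_ell2 (\<lambda>_. 0)"
definition "x + y = Abs_ell2 (\<lambda>n. coord x n + coord y n)"
definition "- x = Abs_ell2 (\<lambda>n. - coord x n)" for x :: ell2
definition "x - y = Abs_ell2 (\<lambda>n. coord x n + - coord y n)" for x :: ell2
definition "c *\<^sub>R x = Abs_ell2 (\<lambda>n. c * coord x n)" for x :: ell2
definition "inner x y = (\<Sum>n. coord x n * coord y n)"
definition "norm x = sqrt (inner x x)" for x :: ell2
definition "sgn x = inverse (norm x) *\<^sub>R x" for x :: ell2
definition "dist x y = norm (x - y)" for x y :: ell2
definition uniformity_ell2 :: "(ell2 \<times> ell2) filter"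
  where "uniformity_ell2 = (INF e\<in>{0<..}. principal {(x, y). dist x y < e})"
definition open_ell2 :: "ell2 set \<Rightarrow> bool"
  where "open_ell2 U \<longleftrightarrow> (\<forall>x\<in>U. eventually (\<lambda>(x', y). x' = x \<longrightarrow> y \<in> U) uniformity)"

lemma coord_zero: "coord 0 n = 0"
  by (simp add: zero_ell2_def coord_Abs)

lemma coord_add: "coord (x + y) n = coord x n + coord y n"
  unfolding plus_ell2_def by (simp add: coord_Abs summable_add_squares coord_summable)

lemma coord_uminus: "coord (- x) n = - coord x n"
  unfolding uminus_ell2_def by (simp add: coord_Abs coord_summable)

lemma coord_diff: "coord (x - y) n = coord x n - coord y n"
proof -
  have "summable (\<lambda>n. (coord x n + - coord y n)\<^sup>2)"
    by (rule summable_add_squares) (simp_all add: coord_summable)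
  then show ?thesis by (simp add: minus_ell2_def coord_Abs)
qed

lemma coord_scaleR: "coord (c *\<^sub>R x) n = c * coord x n"
  unfolding scaleR_ell2_def
  by (subst coord_Abs) (auto simp: power_mult_distrib intro: summable_mult coord_summable)

lemmas coord_simps = coord_zero coord_add coord_uminus coord_diff coord_scaleR

instance
proof
  fix x y z :: ell2 and a b :: real
  have sm: "summable (\<lambda>n. coord u n * coord v n)" for u v
    by (intro summable_mult_squares coord_summable)
  show "(x + y) + z = x + (y + z)" "x + y = y + x" "0 + x = x" "- x + x = 0" "x - y = x + - y"
    "a *\<^sub>R (x + y) = a *\<^sub>R x + a *\<^sub>R y" "(a + b) *\<^sub>R x = a *\<^sub>R x + b *\<^sub>R x"
    "a *\<^sub>R b *\<^sub>R x = (a * b) *\<^sub>R x" "1 *\<^sub>R x = x"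
    by (rule ell2_eqI; simp add: coord_simps algebra_simps)+
  show "inner x y = inner y x" by (simp add: inner_ell2_def mult.commute)
  show "inner (x + y) z = inner x z + inner y z"
    using suminf_add[OF sm[of x z] sm[of y z]] by (simp add: inner_ell2_def coord_simps algebra_simps)
  show "inner (a *\<^sub>R x) y = a * inner x y"
    using suminf_mult[OF sm[of x y], of a] by (simp add: inner_ell2_def coord_simps algebra_simps)
  show "0 \<le> inner x x" unfolding inner_ell2_def by (intro suminf_nonneg sm) simp
  show "inner x x = 0 \<longleftrightarrow> x = 0"
  proof
    assume "inner x x = 0"
    then have "coord x n * coord x n = 0" for n
      using suminf_eq_zero_iff[OF sm[of x x]] by (simp add: inner_ell2_def)
    then show "x = 0" by (intro ell2_eqI) (simp add: coord_simps)
  qed (simp add: inner_ell2_def coord_simps)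
qed (rule norm_ell2_def sgn_ell2_def dist_ell2_def uniformity_ell2_def open_ell2_def)+

end

lemma norm_ell2_sums: "(\<lambda>n. (coord x n)\<^sup>2) sums (norm x)\<^sup>2"
  using coord_summable[of x] unfolding power2_norm_eq_inner inner_ell2_def
  by (simp add: summable_sums power2_eq_square)

lemma inner_ell2_sums: "(\<lambda>n. coord x n * coord y n) sums inner x y"
  unfolding inner_ell2_def by (intro summable_sums summable_mult_squares coord_summable)

lemma sum_coord_le_norm: "finite A \<Longrightarrow> (\<Sum>n\<in>A. (coord x n)\<^sup>2) \<le> (norm x)\<^sup>2"
  using norm_ell2_sums[of x] by (metis sum_le_suminf sums_iff zero_le_power2)

lemma abs_coord_le_norm: "\<bar>coord x n\<bar> \<le> norm x"
  using sum_coord_le_norm[of "{n}" x] by (simp add: abs_le_square_iff[symmetric])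

lemma norm_ell2_le:
  assumes "\<And>N. (\<Sum>n<N. (coord x n)\<^sup>2) \<le> B\<^sup>2" "B \<ge> 0"
  shows "norm x \<le> B"
proof -
  have "(norm x)\<^sup>2 \<le> B\<^sup>2" using norm_ell2_sums[of x] assms(1)
    by (metis suminf_le_const sums_iff)
  then show ?thesis using assms(2) by (simp add: power2_le_iff_abs_le)
qed

lemma coord_sum: "coord (\<Sum>i\<in>A. f i) n = (\<Sum>i\<in>A. coord (f i) n)"
  by (induction A rule: infinite_finite_induct) (auto simp: coord_simps)

instance ell2 :: complete_space
proof
  fix X :: "nat \<Rightarrow> ell2" assume X: "Cauchy X"
  have "Cauchy (\<lambda>k. coord (X k) n)" for n
  proof (rule metric_CauchyI)
    fix e :: real assume "e > 0"
    then obtain K where "\<forall>k\<ge>K. \<forall>l\<ge>K. dist (X k) (X l) < e" using X by (meson metric_CauchyD)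
    then have "\<forall>k\<ge>K. \<forall>l\<ge>K. dist (coord (X k) n) (coord (X l) n) < e"
      using abs_coord_le_norm by (metis coord_diff dist_norm dist_real_def le_less_trans)
    then show "\<exists>K. \<forall>k\<ge>K. \<forall>l\<ge>K. dist (coord (X k) n) (coord (X l) n) < e" by blast
  qed
  then have "\<exists>c. (\<lambda>k. coord (X k) n) \<longlonglongrightarrow> c" for n
    by (simp add: Cauchy_convergent_iff convergent_def)
  then obtain c where c: "\<And>n. (\<lambda>k. coord (X k) n) \<longlonglongrightarrow> c n" by metis
  \<comment> \<open>The limit in \<open>l\<close> is taken inside finite sums, so the estimate is
    available before \<open>c\<close> is known to be square summable.\<close>
  have tail: "(\<Sum>n<N. (c n - coord (X k) n)\<^sup>2) \<le> e\<^sup>2"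
    if "e > 0" "\<forall>k\<ge>K. \<forall>l\<ge>K. dist (X k) (X l) < e" "k \<ge> K" for e K k N
  proof (rule LIMSEQ_le_const2)
    show "(\<lambda>l. \<Sum>n<N. (coord (X l) n - coord (X k) n)\<^sup>2) \<longlonglongrightarrow> (\<Sum>n<N. (c n - coord (X k) n)\<^sup>2)"
      by (intro tendsto_intros c)
    have "(\<Sum>n<N. (coord (X l) n - coord (X k) n)\<^sup>2) \<le> e\<^sup>2" if "l \<ge> K" for l
    proof -
      have "(\<Sum>n<N. (coord (X l) n - coord (X k) n)\<^sup>2) \<le> (norm (X l - X k))\<^sup>2"
        using sum_coord_le_norm[of "{..<N}" "X l - X k"] by (simp add: coord_diff)
      also have "\<dots> \<le> e\<^sup>2"
        using that \<open>k \<ge> K\<close> \<open>\<forall>k\<ge>K. \<forall>l\<ge>K. dist (X k) (X l) < e\<close>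
        by (intro power_mono) (auto simp: dist_norm intro: less_imp_le)
      finally show ?thesis .
    qed
    then show "\<exists>M. \<forall>l\<ge>M. (\<Sum>n<N. (coord (X l) n - coord (X k) n)\<^sup>2) \<le> e\<^sup>2" by blast
  qed
  obtain K1 where K1: "\<forall>k\<ge>K1. \<forall>l\<ge>K1. dist (X k) (X l) < 1"
    using X by (meson metric_CauchyD zero_less_one)
  have "summable (\<lambda>n. (c n - coord (X K1) n)\<^sup>2)"
    using tail[OF _ K1, of K1] by (intro summableI_nonneg_bounded[of _ 1]) auto
  from summable_add_squares[OF this coord_summable[of "X K1"]]
  have "summable (\<lambda>n. (c n)\<^sup>2)" by simp
  then have cc: "coord (Abs_ell2 c) = c" by (rule coord_Abs)
  have "X \<longlonglongrightarrow> Abs_ell2 c"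
  proof (rule metric_LIMSEQ_I)
    fix e :: real assume "e > 0"
    then obtain K where K: "\<forall>k\<ge>K. \<forall>l\<ge>K. dist (X k) (X l) < e / 2"
      using X by (meson metric_CauchyD half_gt_zero)
    have "dist (X k) (Abs_ell2 c) < e" if "k \<ge> K" for k
    proof -
      have "norm (Abs_ell2 c - X k) \<le> e / 2"
        using tail[OF _ K that] \<open>e > 0\<close> by (intro norm_ell2_le) (auto simp: coord_diff cc)
      then show ?thesis using \<open>e > 0\<close> by (simp add: dist_norm norm_minus_commute)
    qed
    then show "\<exists>K. \<forall>k\<ge>K. dist (X k) (Abs_ell2 c) < e" by blast
  qed
  then show "convergent X" by (auto simp: convergent_def)
qed

section \<open>Truncation and coordinatewise compactness\<close>

definition unit2 :: "nat \<Rightarrow> ell2" where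
  "unit2 m = Abs_ell2 (\<lambda>n. if n = m then 1 else 0)"

lemma coord_unit2: "coord (unit2 m) n = (if n = m then 1 else 0)"
proof -
  have "summable (\<lambda>n. (if n = m then 1 else 0 :: real)\<^sup>2)"
    by (rule summable_finite[of "{m}"]) auto
  then show ?thesis by (simp add: unit2_def coord_Abs)
qed

definition trunc2 :: "nat \<Rightarrow> ell2 \<Rightarrow> ell2" where
  "trunc2 N x = (\<Sum>m<N. coord x m *\<^sub>R unit2 m)"

lemma coord_trunc2: "coord (trunc2 N x) n = (if n < N then coord x n else 0)"
  by (simp add: trunc2_def coord_sum coord_simps coord_unit2 if_distrib[of "\<lambda>x. _ * x"] cong: if_cong)

lemma norm_sums_finite: "finite A \<Longrightarrow> (\<And>n. n \<notin> A \<Longrightarrow> coord x n = 0) \<Longrightarrow> (norm x)\<^sup>2 = (\<Sum>n\<in>A. (coord x n)\<^sup>2)"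
  by (rule sums_unique2[OF norm_ell2_sums sums_finite]) auto

lemma norm_trunc2: "(norm (trunc2 N x))\<^sup>2 = (\<Sum>n<N. (coord x n)\<^sup>2)"
  by (subst norm_sums_finite[of "{..<N}"]) (auto simp: coord_trunc2)

lemma norm_trunc2_le: "norm (trunc2 N x) \<le> norm x"
  using norm_trunc2[of N x] sum_coord_le_norm[of "{..<N}" x]
  by (metis finite_lessThan norm_ge_zero power2_le_imp_le)

lemma norm_diff_trunc2: "(norm (x - trunc2 N x))\<^sup>2 = (norm x)\<^sup>2 - (\<Sum>n<N. (coord x n)\<^sup>2)"
proof -
  have 1: "(\<lambda>n. if n \<in> {..<N} then (coord x n)\<^sup>2 else 0) sums (\<Sum>n<N. (coord x n)\<^sup>2)"
    by (rule sums_If_finite_set) simp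
  have "(\<lambda>n. (coord x n)\<^sup>2 - (if n \<in> {..<N} then (coord x n)\<^sup>2 else 0)) sums ((norm x)\<^sup>2 - (\<Sum>n<N. (coord x n)\<^sup>2))"
    by (intro sums_diff norm_ell2_sums 1)
  moreover have "(\<lambda>n. (coord x n)\<^sup>2 - (if n \<in> {..<N} then (coord x n)\<^sup>2 else 0)) = (\<lambda>n. (coord (x - trunc2 N x) n)\<^sup>2)"
    by (auto simp: coord_diff coord_trunc2)
  ultimately show ?thesis using sums_unique2[OF norm_ell2_sums[of "x - trunc2 N x"]] by simp
qed

lemma trunc2_tendsto: "(\<lambda>N. trunc2 N x) \<longlonglongrightarrow> x"
proof -
  have "(\<lambda>N. (norm x)\<^sup>2 - (\<Sum>n<N. (coord x n)\<^sup>2)) \<longlonglongrightarrow> (norm x)\<^sup>2 - (norm x)\<^sup>2"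
    using norm_ell2_sums[of x] unfolding sums_def by (intro tendsto_intros)
  then have "(\<lambda>N. (norm (x - trunc2 N x))\<^sup>2) \<longlonglongrightarrow> 0" by (simp add: norm_diff_trunc2)
  then have "(\<lambda>N. sqrt ((norm (x - trunc2 N x))\<^sup>2)) \<longlonglongrightarrow> sqrt 0" by (rule tendsto_real_sqrt)
  then have "(\<lambda>N. norm (x - trunc2 N x)) \<longlonglongrightarrow> 0" by simp
  then have "(\<lambda>N. x - trunc2 N x) \<longlonglongrightarrow> 0" by (simp add: tendsto_norm_zero_iff)
  from tendsto_diff[OF tendsto_const this, of x] show ?thesis by simp
qed

text \<open>Tychonoff's theorem for a product of intervals replaces the diagonal argument.
  Coordinatewise convergence is weaker than convergence in norm; \<open>g_compact\<close> shows that
  it suffices for the weighted form.\<close>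

lemma bounded_ell2_coordwise_subseq:
  fixes X :: "nat \<Rightarrow> ell2"
  assumes "\<And>k. norm (X k) \<le> B"
  obtains r :: "nat \<Rightarrow> nat" and c where "strict_mono r" "\<And>n. (\<lambda>k. coord (X (r k)) n) \<longlonglongrightarrow> c n"
proof -
  have "compactin (product_topology (\<lambda>_::nat. euclidean::real topology) UNIV) (Pi\<^sub>E UNIV (\<lambda>_. {-B..B}))"
    by (auto simp: compactin_PiE)
  then have "compact (Pi\<^sub>E UNIV (\<lambda>_::nat. {-B..B}))"
    by (simp add: euclidean_product_topology)
  then have "seq_compact (Pi\<^sub>E UNIV (\<lambda>_::nat. {-B..B}))" by (rule compact_imp_seq_compact)
  moreover have "\<forall>k. coord (X k) \<in> Pi\<^sub>E UNIV (\<lambda>_::nat. {-B..B})"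
    using abs_coord_le_norm assms by (auto simp: abs_le_iff) (smt (verit, best) abs_coord_le_norm)+
  ultimately obtain c r where cr: "strict_mono (r :: nat \<Rightarrow> nat)" "((\<lambda>k. coord (X k)) \<circ> r) \<longlonglongrightarrow> c"
    unfolding seq_compact_def by metis
  have "(\<lambda>k. coord (X (r k)) n) \<longlonglongrightarrow> c n" for n
  proof -
    have "continuous_on UNIV (\<lambda>f::nat \<Rightarrow> real. f n)" by (rule continuous_on_product_coordinates)
    then have "isCont (\<lambda>f::nat \<Rightarrow> real. f n) c" using continuous_on_eq_continuous_at open_UNIV by blast
    from isCont_tendsto_compose[OF this cr(2)] show ?thesis by (simp add: o_def)
  qed
  with cr(1) show ?thesis using that by blast
qed

text \<open>The dimension count behind both Rayleigh comparisons: \<open>n\<close> linear conditions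
  leave a nonzero vector in a span of \<open>n + 1\<close> vectors. The proof is one step of
  Gaussian elimination on the last unknown.\<close>

lemma underdetermined_system:
  fixes a :: "nat \<Rightarrow> nat \<Rightarrow> real"
  shows "\<exists>c. (\<exists>j\<le>n. c j \<noteq> 0) \<and> (\<forall>i<n. (\<Sum>j\<le>n. a i j * c j) = 0)"
proof (induction n arbitrary: a)
  case 0
  show ?case by (rule exI[of _ "\<lambda>_. 1"]) simp
next
  case (Suc n)
  show ?case
  proof (cases "\<forall>i<Suc n. a i (Suc n) = 0")
    case True
    then show ?thesis by (intro exI[of _ "\<lambda>j. if j = Suc n then 1 else 0"]) auto
  next
    case False
    then obtain p where p: "p < Suc n" "a p (Suc n) \<noteq> 0" by blast
    \<comment> \<open>\<open>\<rho>\<close> enumerates the rows other than the pivot row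
      \<open>p\<close>; \<open>b\<close> is the system after the last unknown has been eliminated
      from them.\<close>
    define \<rho> where "\<rho> i = (if i < p then i else Suc i)" for i
    define b where "b i j = a (\<rho> i) j - a (\<rho> i) (Suc n) / a p (Suc n) * a p j" for i j
    obtain c where c: "\<exists>j\<le>n. c j \<noteq> 0" "\<And>i. i < n \<Longrightarrow> (\<Sum>j\<le>n. b i j * c j) = 0"
      using Suc.IH[of b] by blast
    define s where "s = (\<Sum>j\<le>n. a p j * c j)"
    \<comment> \<open>Back substitution: the last unknown is determined by the pivot row.\<close>
    define d where "d j = (if j = Suc n then - s / a p (Suc n) else c j)" for j
    have sum_d: "(\<Sum>j\<le>Suc n. a i j * d j) = (\<Sum>j\<le>n. a i j * c j) - a i (Suc n) * s / a p (Suc n)" for i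
      by (simp add: d_def)
    have "(\<Sum>j\<le>Suc n. a i j * d j) = 0" if "i < Suc n" for i
    proof (cases "i = p")
      case True
      then show ?thesis unfolding sum_d using p(2) by (simp add: s_def)
    next
      case False
      define k where "k = (if i < p then i else i - 1)"
      have k: "\<rho> k = i" "k < n" using False that p(1) by (auto simp: \<rho>_def k_def)
      have "(\<Sum>j\<le>n. b k j * c j) = (\<Sum>j\<le>n. a i j * c j) - a i (Suc n) / a p (Suc n) * s"
        unfolding s_def b_def k(1) by (simp add: left_diff_distrib sum_subtractf sum_distrib_left mult.assoc)
      then show ?thesis unfolding sum_d using c(2)[OF k(2)] by simp
    qed
    moreover have "\<exists>j\<le>Suc n. d j \<noteq> 0" 
    proof -
      obtain j where "j \<le> n" "c j \<noteq> 0" using c(1) by blast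
      then show ?thesis by (intro exI[of _ j]) (simp add: d_def)
    qed
    ultimately show ?thesis by blast
  qed
qed

section \<open>Bounded forms on \<open>ell2\<close> from infinite matrices\<close>

definition section_form :: "(nat \<Rightarrow> nat \<Rightarrow> real) \<Rightarrow> nat \<Rightarrow> ell2 \<Rightarrow> ell2 \<Rightarrow> real" where
  "section_form B N x y = (\<Sum>m<N. \<Sum>n<N. coord x m * coord y n * B m n)"

lemma section_form_linear:
  "section_form B N (x + x') y = section_form B N x y + section_form B N x' y"
  "section_form B N x (y + y') = section_form B N x y + section_form B N x y'"
  "section_form B N (x - x') y = section_form B N x y - section_form B N x' y"
  "section_form B N x (y - y') = section_form B N x y - section_form B N x y'"
  "section_form B N (c *\<^sub>R x) y = c * section_form B N x y"
  "section_form B N x (c *\<^sub>R y) = c * section_form B N x y"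
  by (simp_all add: section_form_def coord_simps algebra_simps sum.distrib sum_distrib_left sum_subtractf)

lemma section_form_trunc:
  assumes "N \<le> M"
  shows "section_form B M (trunc2 N x) (trunc2 N y) = section_form B N x y"
proof -
  have "section_form B M (trunc2 N x) (trunc2 N y) =
      (\<Sum>m<M. if m < N then (\<Sum>n<M. if n < N then coord x m * coord y n * B m n else 0) else 0)"
    unfolding section_form_def by (auto simp: coord_trunc2 intro!: sum.cong)
  also have "\<dots> = (\<Sum>m\<in>{..<M} \<inter> {m. m < N}. \<Sum>n\<in>{..<M} \<inter> {n. n < N}. coord x m * coord y n * B m n)"
    by (simp add: sum.inter_restrict)
  also have "{..<M} \<inter> {m. m < N} = {..<N}" using assms by auto
  finally show ?thesis by (simp add: section_form_def)
qed

text \<open>Bounds on the finite sections with a common constant are all that can be read off finite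
  linear combinations of basis functions; the form on \<open>ell2\<close> is then obtained as a
  limit of sections.\<close>

locale bounded_psd_matrix =
  fixes B :: "nat \<Rightarrow> nat \<Rightarrow> real" and K :: real
  assumes B_sym: "B m n = B n m"
    and B_nonneg: "0 \<le> (\<Sum>m<N. \<Sum>n<N. w m * w n * B m n)"
    and B_bound: "(\<Sum>m<N. \<Sum>n<N. w m * w n * B m n) \<le> K * (\<Sum>m<N. (w m)\<^sup>2)"
begin

lemma K_nonneg: "K \<ge> 0"
  using B_nonneg[where N = 1 and w = "\<lambda>_. 1"] B_bound[where N = 1 and w = "\<lambda>_. 1"] by simp

lemma section_form_bounds:
  "0 \<le> section_form B N x x" "section_form B N x x \<le> K * (norm x)\<^sup>2"
proof -
  show "0 \<le> section_form B N x x" unfolding section_form_def by (rule B_nonneg)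
  have "section_form B N x x \<le> K * (\<Sum>m<N. (coord x m)\<^sup>2)" unfolding section_form_def by (rule B_bound)
  also have "\<dots> \<le> K * (norm x)\<^sup>2" by (intro mult_left_mono sum_coord_le_norm K_nonneg) simp
  finally show "section_form B N x x \<le> K * (norm x)\<^sup>2" .
qed

lemma section_form_sym: "section_form B N x y = section_form B N y x"
  unfolding section_form_def by (subst sum.swap) (simp add: B_sym mult.commute)

text \<open>Polarisation for unit vectors: four times the value at u, v is the difference of the
  values at u + v and u - v, and both of these lie between 0 and 4 K.\<close>

lemma section_form_abs_le: "\<bar>section_form B N x y\<bar> \<le> K * norm x * norm y"
proof (cases "x = 0 \<or> y = 0")
  case True
  then show ?thesis by (auto simp: section_form_def coord_simps)
next
  case False
  define u where "u = x /\<^sub>R norm x"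
  define v where "v = y /\<^sub>R norm y"
  have n: "norm u = 1" "norm v = 1" using False by (auto simp: u_def v_def)
  have "norm (u + v) \<le> 2" "norm (u - v) \<le> 2"
    using norm_triangle_ineq[of u v] norm_triangle_ineq4[of u v] n by auto
  then have "(norm (u + v))\<^sup>2 \<le> 4" "(norm (u - v))\<^sup>2 \<le> 4"
    using power_mono[of _ 2 2] by fastforce+
  then have "K * (norm (u + v))\<^sup>2 \<le> K * 4" "K * (norm (u - v))\<^sup>2 \<le> K * 4"
    using K_nonneg by (auto intro: mult_left_mono)
  moreover have "section_form B N (u + v) (u + v) - section_form B N (u - v) (u - v) = 4 * section_form B N u v"
    by (simp add: section_form_linear section_form_sym[of N v u])
  ultimately have *: "\<bar>section_form B N u v\<bar> \<le> K"
    using section_form_bounds[of N "u + v"] section_form_bounds[of N "u - v"] by linarith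
  have "x = norm x *\<^sub>R u" "y = norm y *\<^sub>R v" using False by (auto simp: u_def v_def)
  then have "section_form B N x y = norm x * (norm y * section_form B N u v)"
    by (metis section_form_linear(5,6))
  then have "\<bar>section_form B N x y\<bar> = norm x * norm y * \<bar>section_form B N u v\<bar>" by (simp add: abs_mult)
  also have "\<dots> \<le> norm x * norm y * K" using * by (intro mult_left_mono) auto
  finally show ?thesis by (simp add: algebra_simps)
qed

text \<open>A larger section evaluated at truncated vectors is the smaller section, so two sections
  differ only by terms containing a tail of \<open>x\<close> or of \<open>y\<close>.\<close>

lemma section_form_Cauchy: "Cauchy (\<lambda>N. section_form B N x y)"
proof -
  define d where "d N = K * norm (x - trunc2 N x) * norm y + K * norm x * norm (y - trunc2 N y)" for N
  have "(\<lambda>N. x - trunc2 N x) \<longlonglongrightarrow> x - x" "(\<lambda>N. y - trunc2 N y) \<longlonglongrightarrow> y - y"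
    by (intro tendsto_intros trunc2_tendsto)+
  from this[THEN tendsto_norm] have "d \<longlonglongrightarrow> K * 0 * norm y + K * norm x * 0"
    unfolding d_def by (intro tendsto_intros) auto
  then have d: "d \<longlonglongrightarrow> 0" by simp
  have step: "\<bar>section_form B M x y - section_form B N x y\<bar> \<le> d N" if "N \<le> M" for M N
  proof -
    have "section_form B M x y - section_form B N x y =
        section_form B M (x - trunc2 N x) y + section_form B M (trunc2 N x) (y - trunc2 N y)"
      by (simp add: section_form_trunc[OF that, symmetric] section_form_linear)
    moreover have "\<bar>section_form B M (trunc2 N x) (y - trunc2 N y)\<bar> \<le> K * norm x * norm (y - trunc2 N y)"
      using section_form_abs_le[of M "trunc2 N x" "y - trunc2 N y"]
        mult_right_mono[OF mult_left_mono[OF norm_trunc2_le K_nonneg], of "norm (y - trunc2 N y)" N x]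
      by simp
    ultimately show ?thesis
      using section_form_abs_le[of M "x - trunc2 N x" y] by (simp add: d_def)
  qed
  show ?thesis
  proof (rule metric_CauchyI)
    fix e :: real assume "e > 0"
    then obtain N where N: "\<And>n. n \<ge> N \<Longrightarrow> d n < e / 2"
      using order_tendstoD(2)[OF d, of "e / 2"] by (auto simp: eventually_sequentially)
    have "dist (section_form B m x y) (section_form B n x y) < e" if "m \<ge> N" "n \<ge> N" for m n
      using step[OF that(1)] step[OF that(2)] N[of N] unfolding dist_real_def by linarith
    then show "\<exists>M. \<forall>m\<ge>M. \<forall>n\<ge>M. dist (section_form B m x y) (section_form B n x y) < e" by blast
  qed
qed

definition form :: "ell2 \<Rightarrow> ell2 \<Rightarrow> real" where
  "form x y = lim (\<lambda>N. section_form B N x y)"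

lemma form_tendsto: "(\<lambda>N. section_form B N x y) \<longlonglongrightarrow> form x y"
  unfolding form_def using Cauchy_convergent[OF section_form_Cauchy] convergent_LIMSEQ_iff by blast

lemma form_eqI: "(\<lambda>N. section_form B N x y) \<longlonglongrightarrow> a \<Longrightarrow> form x y = a"
  using form_tendsto LIMSEQ_unique by blast

lemma form_trunc: "form (trunc2 N x) (trunc2 N y) = section_form B N x y"
  by (rule form_eqI, rule tendsto_eventually, rule eventually_sequentiallyI[of N])
     (simp add: section_form_trunc)

lemma form_sym: "form x y = form y x"
  by (simp add: form_def section_form_sym)

lemma form_bounded_bilinear: "bounded_bilinear form"
proof
  show "form (a + a') b = form a b + form a' b" for a a' b
    by (rule form_eqI) (simp add: section_form_linear tendsto_add form_tendsto)
  show "form a (b + b') = form a b + form a b'" for a b b'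
    by (rule form_eqI) (simp add: section_form_linear tendsto_add form_tendsto)
  show "form (r *\<^sub>R a) b = r *\<^sub>R form a b" for r a b
    by (rule form_eqI) (simp add: section_form_linear tendsto_mult_left form_tendsto)
  show "form a (r *\<^sub>R b) = r *\<^sub>R form a b" for r a b
    by (rule form_eqI) (simp add: section_form_linear tendsto_mult_left form_tendsto)
  show "\<exists>K. \<forall>a b. norm (form a b) \<le> norm a * norm b * K"
  proof (intro exI[of _ K] allI)
    fix a b
    have "\<bar>form a b\<bar> \<le> K * norm a * norm b"
      by (rule LIMSEQ_le_const2[OF tendsto_rabs[OF form_tendsto]]) (use section_form_abs_le in blast)
    then show "norm (form a b) \<le> norm a * norm b * K" by (simp add: algebra_simps)
  qed
qed

end

section \<open>The compact form with diagonal entries 1 / \<open>\<mu> m\<close>\<close>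

locale weights =
  fixes \<mu> :: "nat \<Rightarrow> real"
  assumes \<mu>_pos: "0 < \<mu> 0" and \<mu>_mono: "m \<le> n \<Longrightarrow> \<mu> m \<le> \<mu> n"
    and \<mu>_top: "filterlim \<mu> at_top sequentially"
begin

lemma \<mu>_gt_0: "\<mu> n > 0"
  using \<mu>_pos \<mu>_mono[of 0 n] by linarith

lemma \<mu>_gt_0': "\<mu> n \<noteq> 0" "\<mu> n \<ge> 0"
  using \<mu>_gt_0[of n] by auto

text \<open>The original inner product in the coordinates that carry a factor
  \<open>sqrt (\<mu> m)\<close>. It is compact because its entries tend to 0.\<close>

definition wmat :: "nat \<Rightarrow> nat \<Rightarrow> real" where
  "wmat m n = (if m = n then 1 / \<mu> m else 0)"

lemma sum_wmat: "(\<Sum>m<N. \<Sum>n<N. f m * f' n * wmat m n) = (\<Sum>m<N. f m * f' m / \<mu> m)"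
  unfolding wmat_def by (intro sum.cong refl) (auto simp: if_distrib[of "\<lambda>x. _ * x"] cong: if_cong)

sublocale W: bounded_psd_matrix wmat "1 / \<mu> 0"
proof
  show "wmat m n = wmat n m" for m n by (simp add: wmat_def)
  show "0 \<le> (\<Sum>m<N. \<Sum>n<N. w m * w n * wmat m n)" for N w
    unfolding sum_wmat by (intro sum_nonneg) (simp add: \<mu>_gt_0')
  show "(\<Sum>m<N. \<Sum>n<N. w m * w n * wmat m n) \<le> 1 / \<mu> 0 * (\<Sum>m<N. (w m)\<^sup>2)" for N w
    unfolding sum_wmat sum_distrib_left
  proof (rule sum_mono)
    fix m
    have "1 / \<mu> m \<le> 1 / \<mu> 0" using \<mu>_mono[of 0 m] \<mu>_pos by (intro frac_le) auto
    from mult_right_mono[OF this, of "(w m)\<^sup>2"]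
    show "w m * w m / \<mu> m \<le> 1 / \<mu> 0 * (w m)\<^sup>2" by (simp add: power2_eq_square)
  qed
qed

abbreviation g :: "ell2 \<Rightarrow> ell2 \<Rightarrow> real" where "g \<equiv> W.form"

lemma g_weighted_sums: "(\<lambda>m. coord x m * coord y m / \<mu> m) sums g x y"
  using W.form_tendsto[of x y] unfolding sums_def section_form_def sum_wmat .

lemma g_self_pos:
  assumes "x \<noteq> 0"
  shows "g x x > 0"
proof -
  obtain m where m: "coord x m \<noteq> 0" using assms ell2_eqI[of x 0] by (auto simp: coord_simps)
  have sm: "summable (\<lambda>m. coord x m * coord x m / \<mu> m)" using g_weighted_sums sums_summable by blast
  have "0 < (\<Sum>m. coord x m * coord x m / \<mu> m)"
    using m \<mu>_gt_0[of m] by (intro suminf_pos2[OF sm, of m]) (auto simp: \<mu>_gt_0' zero_less_mult_iff linorder_neq_iff)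
  then show ?thesis using sums_unique[OF g_weighted_sums[of x x]] by simp
qed

text \<open>With \<open>g_le_norm\<close> this is the Rayleigh quotient of the unperturbed problem:
  at most \<open>\<mu> n\<close> on the span of the first n + 1 coordinates, at least
  \<open>\<mu> n\<close> where the first n coordinates vanish.\<close>

lemma norm_le_g:
  assumes "\<And>m. m > n \<Longrightarrow> coord x m = 0"
  shows "(norm x)\<^sup>2 \<le> \<mu> n * g x x"
proof (rule sums_le)
  show "(\<lambda>m. (coord x m)\<^sup>2) sums (norm x)\<^sup>2" by (rule norm_ell2_sums)
  show "(\<lambda>m. \<mu> n * (coord x m * coord x m / \<mu> m)) sums (\<mu> n * g x x)"
    by (intro sums_mult g_weighted_sums)
  show "(coord x m)\<^sup>2 \<le> \<mu> n * (coord x m * coord x m / \<mu> m)" for m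
  proof (cases "m \<le> n")
    case True
    have "(coord x m)\<^sup>2 * \<mu> m \<le> (coord x m)\<^sup>2 * \<mu> n" using \<mu>_mono[OF True] by (intro mult_left_mono) auto
    then show ?thesis using \<mu>_gt_0[of m] by (simp add: field_simps power2_eq_square)
  next
    case False
    then show ?thesis using assms[of m] by simp
  qed
qed

lemma g_le_norm:
  assumes "\<And>m. m < n \<Longrightarrow> coord x m = 0"
  shows "\<mu> n * g x x \<le> (norm x)\<^sup>2"
proof (rule sums_le)
  show "(\<lambda>m. (coord x m)\<^sup>2) sums (norm x)\<^sup>2" by (rule norm_ell2_sums)
  show "(\<lambda>m. \<mu> n * (coord x m * coord x m / \<mu> m)) sums (\<mu> n * g x x)"
    by (intro sums_mult g_weighted_sums)
  show "\<mu> n * (coord x m * coord x m / \<mu> m) \<le> (coord x m)\<^sup>2" for m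
  proof (cases "n \<le> m")
    case True
    have "(coord x m)\<^sup>2 * \<mu> n \<le> (coord x m)\<^sup>2 * \<mu> m" using \<mu>_mono[OF True] by (intro mult_left_mono) auto
    then show ?thesis using \<mu>_gt_0[of m] by (simp add: field_simps power2_eq_square)
  next
    case False
    then show ?thesis using assms[of m] by simp
  qed
qed

lemma g_compact:
  fixes X :: "nat \<Rightarrow> ell2"
  assumes "\<And>k. norm (X k) \<le> R"
  shows "\<exists>r::nat \<Rightarrow> nat. strict_mono r \<and>
      (\<forall>e>0. \<exists>K. \<forall>k\<ge>K. \<forall>l\<ge>K. g (X (r k) - X (r l)) (X (r k) - X (r l)) < e)"
proof -
  obtain r c where r: "strict_mono (r :: nat \<Rightarrow> nat)" and c: "\<And>n. (\<lambda>k. coord (X (r k)) n) \<longlonglongrightarrow> c n"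
    using bounded_ell2_coordwise_subseq[of X R] assms by blast
  have "\<exists>K. \<forall>k\<ge>K. \<forall>l\<ge>K. g (X (r k) - X (r l)) (X (r k) - X (r l)) < e" if "e > 0" for e
  proof -
    \<comment> \<open>Differences have norm at most 2 R, so the tail contributes at most 4 R^2 /
      \<open>\<mu> N\<close>, which this choice makes at most e/2. The head has finitely many
      convergent coordinates.\<close>
    obtain N where N: "\<mu> N > 8 * R\<^sup>2 / e" using \<mu>_top
      by (metis (no_types, lifting) filterlim_at_top_dense eventually_sequentially order_refl)
    have split: "g d d \<le> 1 / \<mu> 0 * (\<Sum>m<N. (coord d m)\<^sup>2) + 1 / \<mu> N * (norm d)\<^sup>2" for d
    proof -
      have "d = trunc2 N d + (d - trunc2 N d)" by simp
      moreover have "g (trunc2 N d) (d - trunc2 N d) = 0"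
      proof -
        have "(\<lambda>m. coord (trunc2 N d) m * coord (d - trunc2 N d) m / \<mu> m) = (\<lambda>_. 0)"
          by (auto simp: coord_trunc2 coord_diff)
        then show ?thesis using g_weighted_sums[of "trunc2 N d" "d - trunc2 N d"] sums_unique2[OF _ sums_zero] by metis
      qed
      ultimately have "g d d = g (trunc2 N d) (trunc2 N d) + g (d - trunc2 N d) (d - trunc2 N d)"
        using W.form_sym[of "trunc2 N d" "d - trunc2 N d"]
        by (metis (no_types, lifting) W.form_bounded_bilinear add.right_neutral add.left_neutral
            bounded_bilinear.add_left bounded_bilinear.add_right)
      moreover have "\<mu> 0 * g (trunc2 N d) (trunc2 N d) \<le> (norm (trunc2 N d))\<^sup>2" by (rule g_le_norm) simp
      then have "g (trunc2 N d) (trunc2 N d) \<le> 1 / \<mu> 0 * (\<Sum>m<N. (coord d m)\<^sup>2)"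
        using \<mu>_pos by (simp add: norm_trunc2 field_simps)
      moreover have "\<mu> N * g (d - trunc2 N d) (d - trunc2 N d) \<le> (norm (d - trunc2 N d))\<^sup>2"
        by (rule g_le_norm) (simp add: coord_diff coord_trunc2)
      then have "\<mu> N * g (d - trunc2 N d) (d - trunc2 N d) \<le> (norm d)\<^sup>2"
        unfolding norm_diff_trunc2 using sum_nonneg[of "{..<N}" "\<lambda>n. (coord d n)\<^sup>2"] by simp
      then have "g (d - trunc2 N d) (d - trunc2 N d) \<le> 1 / \<mu> N * (norm d)\<^sup>2"
        using \<mu>_gt_0[of N] by (simp add: field_simps)
      ultimately show ?thesis by linarith
    qed
    have "Cauchy (\<lambda>k. coord (X (r k)) m)" for m using c[of m] by (rule LIMSEQ_imp_Cauchy)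
    \<comment> \<open>Squared, summed over N coordinates and divided by \<open>\<mu> 0\<close>, this
      stays below e/2; N + 1 keeps the bound positive for N = 0.\<close>
    then have "\<exists>K. \<forall>k\<ge>K. \<forall>l\<ge>K. \<bar>coord (X (r k)) m - coord (X (r l)) m\<bar> < sqrt (e * \<mu> 0 / (2 * (real N + 1)))" for m
      using \<open>e > 0\<close> \<mu>_pos unfolding Cauchy_def dist_real_def by simp
    then obtain K where K: "\<And>m k l. k \<ge> K m \<Longrightarrow> l \<ge> K m \<Longrightarrow> \<bar>coord (X (r k)) m - coord (X (r l)) m\<bar> < sqrt (e * \<mu> 0 / (2 * (real N + 1)))"
      by metis
    define L where "L = (\<Sum>m<N. K m)"
    have KL: "K m \<le> L" if "m < N" for m unfolding L_def using that by (intro member_le_sum) auto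
    have "g (X (r k) - X (r l)) (X (r k) - X (r l)) < e" if kl: "k \<ge> L" "l \<ge> L" for k l
    proof -
      define d where "d = X (r k) - X (r l)"
      have "(\<Sum>m<N. (coord d m)\<^sup>2) \<le> (\<Sum>m<N. e * \<mu> 0 / (2 * (real N + 1)))"
      proof (rule sum_mono)
        fix m assume "m \<in> {..<N}"
        then have "\<bar>coord d m\<bar> < sqrt (e * \<mu> 0 / (2 * (real N + 1)))"
          using K[of m k l] KL[of m] kl by (simp add: d_def coord_diff)
        then have "\<bar>coord d m\<bar>\<^sup>2 \<le> (sqrt (e * \<mu> 0 / (2 * (real N + 1))))\<^sup>2" by (intro power_mono) auto
        then show "(coord d m)\<^sup>2 \<le> e * \<mu> 0 / (2 * (real N + 1))" using \<open>e > 0\<close> \<mu>_pos by simp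
      qed
      then have "1 / \<mu> 0 * (\<Sum>m<N. (coord d m)\<^sup>2) \<le> 1 / \<mu> 0 * (real N * (e * \<mu> 0 / (2 * (real N + 1))))"
        using \<mu>_pos by (intro mult_left_mono) auto
      also have "\<dots> = (e / 2) * (real N / (real N + 1))" using \<mu>_pos by (simp add: field_simps)
      also have "\<dots> < (e / 2) * 1" using \<open>e > 0\<close> by (intro mult_strict_left_mono) auto
      finally have 1: "1 / \<mu> 0 * (\<Sum>m<N. (coord d m)\<^sup>2) < e / 2" by simp
      have "norm d \<le> 2 * R" using assms[of "r k"] assms[of "r l"] norm_triangle_ineq4[of "X (r k)" "X (r l)"]
        by (simp add: d_def)
      then have "(norm d)\<^sup>2 \<le> (2 * R)\<^sup>2" by (intro power_mono) auto
      then have "1 / \<mu> N * (norm d)\<^sup>2 \<le> 1 / \<mu> N * (4 * R\<^sup>2)"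
        using \<mu>_gt_0[of N] by (intro mult_left_mono) (auto simp: power_mult_distrib)
      also have "\<dots> \<le> e / 2" using N \<open>e > 0\<close> \<mu>_gt_0[of N] by (simp add: field_simps)
      finally have "g d d < e" using split[of d] 1 by linarith
      then show ?thesis by (simp only: d_def)
    qed
    then show ?thesis by blast
  qed
  with r show ?thesis by blast
qed

text \<open>Used twice: it supplies \<open>inf_dim\<close> for the successive minimisation, and the
  trial vector for the upper eigenvalue bound.\<close>

lemma unit_combination:
  obtains x where "x \<noteq> 0" "\<And>m. m > n \<Longrightarrow> coord x m = 0" "\<And>i. i < n \<Longrightarrow> g x (e i) = 0"
proof -
  obtain c where c: "\<exists>j\<le>n. c j \<noteq> 0" "\<And>i. i < n \<Longrightarrow> (\<Sum>j\<le>n. g (unit2 j) (e i) * c j) = 0"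
    using underdetermined_system[of n "\<lambda>i j. g (unit2 j) (e i)"] by blast
  define x where "x = (\<Sum>j\<le>n. c j *\<^sub>R unit2 j)"
  have cx: "coord x m = (if m \<le> n then c m else 0)" for m
    by (simp add: x_def coord_sum coord_simps coord_unit2 if_distrib[of "\<lambda>x. _ * x"] cong: if_cong)
  show ?thesis
  proof (rule that)
    show "x \<noteq> 0" using c(1) cx by (metis coord_zero)
    show "coord x m = 0" if "m > n" for m using that by (simp add: cx)
    show "g x (e i) = 0" if "i < n" for i
      using c(2)[OF that] by (simp add: x_def bounded_bilinear.sum_left[OF W.form_bounded_bilinear]
          bounded_bilinear.scaleR_left[OF W.form_bounded_bilinear] mult.commute)
  qed
qed

end

section \<open>Relatively bounded perturbations of a diagonal form\<close>

text \<open>The sesquilinear extension of the real form \<open>s\<close> to the complexification,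
  evaluated at x + i y and x' + i y'.\<close>

definition cform :: "(ell2 \<Rightarrow> ell2 \<Rightarrow> real) \<Rightarrow> ell2 \<Rightarrow> ell2 \<Rightarrow> ell2 \<Rightarrow> ell2 \<Rightarrow> complex" where
  "cform s x y x' y' = Complex (s x x' + s y y') (s y x' - s x y')"

text \<open>The abstract setting: \<open>A\<close> is diagonal in \<open>h\<close> with entries
  \<open>\<mu>\<close>, seen through its matrix against the basis, and \<open>w\<close> multiplies
  by x^(-u). \<open>V_sum\<close> puts finite sums into the future core, \<open>V_diff\<close> lets
  \<open>w_bound\<close> be applied to truncation errors, and \<open>w_bound\<close> makes the
  perturbation a bounded form on \<open>ell2\<close>.\<close>

locale perturbed_form = L2_basis M h + weights \<mu>
  for M :: "'a measure" and h :: "nat \<Rightarrow> 'a \<Rightarrow> complex" and \<mu> :: "nat \<Rightarrow> real" +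
  fixes w :: "'a \<Rightarrow> real" and V :: "('a \<Rightarrow> complex) set" and A :: "('a \<Rightarrow> complex) \<Rightarrow> 'a \<Rightarrow> complex"
    and b :: "nat \<Rightarrow> nat \<Rightarrow> real" and \<xi> K :: real
  assumes V_L2: "\<phi> \<in> V \<Longrightarrow> \<phi> \<in> L2 M" "\<phi> \<in> V \<Longrightarrow> A \<phi> \<in> L2 M" "\<phi> \<in> V \<Longrightarrow> (\<lambda>x. w x *\<^sub>R \<phi> x) \<in> L2 M"
    and A_sym: "\<phi> \<in> V \<Longrightarrow> L2_inner M (A \<phi>) (h n) = complex_of_real (\<mu> n) * L2_inner M \<phi> (h n)"
    and V_sum: "(\<lambda>x. \<Sum>n<N. c n * h n x) \<in> V"
    and V_diff: "\<phi> \<in> V \<Longrightarrow> \<psi> \<in> V \<Longrightarrow> (\<lambda>x. \<phi> x - \<psi> x) \<in> V"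
    and w_basis: "L2_inner M (\<lambda>x. w x *\<^sub>R h m x) (\<lambda>x. w x *\<^sub>R h n x) = complex_of_real (b m n)"
    and w_bound: "\<phi> \<in> V \<Longrightarrow> (L2_norm M (\<lambda>x. w x *\<^sub>R \<phi> x))\<^sup>2 \<le> K * Re (L2_inner M (A \<phi>) \<phi>)"
    and \<xi>_pos: "\<xi> > 0"
begin

abbreviation wm :: "('a \<Rightarrow> complex) \<Rightarrow> 'a \<Rightarrow> complex" where
  "wm \<phi> \<equiv> \<lambda>x. w x *\<^sub>R \<phi> x"

lemma h_in_V: "h n \<in> V"
proof -
  have "(\<lambda>x. \<Sum>m<Suc n. (if m = n then 1 else 0) * h m x) \<in> V" by (rule V_sum)
  moreover have "(\<Sum>m<Suc n. (if m = n then 1 else 0) * h m x) = h n x" for x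
    by (simp add: if_distrib[of "\<lambda>y. y * _"] cong: if_cong)
  ultimately show ?thesis by simp
qed

lemma wm_sum: "wm (\<lambda>x. \<Sum>n\<in>I. c n * h n x) = (\<lambda>x. \<Sum>n\<in>I. c n * wm (h n) x)"
  by (auto simp: scaleR_sum_right fun_eq_iff)

lemma wm_sum_inner:
  "L2_inner M (wm (\<lambda>x. \<Sum>m<N. c m * h m x)) (wm (\<lambda>x. \<Sum>n<N. d n * h n x)) =
    (\<Sum>m<N. \<Sum>n<N. c m * cnj (d n) * complex_of_real (b m n))"
proof -
  have L: "wm (h n) \<in> L2 M" for n by (rule V_L2[OF h_in_V])
  then have L2: "(\<lambda>x. \<Sum>n<N. d n * wm (h n) x) \<in> L2 M" by (intro L2_sum L2_scale)
  show ?thesis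
    unfolding wm_sum L2_inner_sum_left[OF L L2] L2_inner_sum_right[OF L L] w_basis
    by (simp add: sum_distrib_left mult.assoc)
qed

lemma A_inner_sums:
  assumes "\<phi> \<in> V" "\<psi> \<in> L2 M"
  shows "(\<lambda>m. complex_of_real (\<mu> m) * (co \<phi> m * cnj (co \<psi> m))) sums L2_inner M (A \<phi>) \<psi>"
  using Parseval[OF V_L2(2)[OF assms(1)] assms(2)] by (simp add: A_sym[OF assms(1)] mult.assoc)

lemma A_energy_sums:
  assumes "\<phi> \<in> V"
  shows "(\<lambda>m. \<mu> m * (cmod (co \<phi> m))\<^sup>2) sums Re (L2_inner M (A \<phi>) \<phi>)"
proof -
  have "(\<lambda>m. Re (complex_of_real (\<mu> m) * (co \<phi> m * cnj (co \<phi> m)))) = (\<lambda>m. \<mu> m * (cmod (co \<phi> m))\<^sup>2)"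
    by (simp add: complex_norm_square[symmetric] del: of_real_power)
  with sums_Re[OF A_inner_sums[OF assms V_L2(1)[OF assms]]] show ?thesis by simp
qed

definition rmat :: "nat \<Rightarrow> nat \<Rightarrow> real" where
  "rmat m n = b m n / (sqrt (\<mu> m) * sqrt (\<mu> n))"

text \<open>The function with finitely many coordinates \<open>c\<close> in the normalisation that
  turns the unperturbed form into a sum of squares.\<close>

definition rsum :: "nat \<Rightarrow> (nat \<Rightarrow> real) \<Rightarrow> 'a \<Rightarrow> complex" where
  "rsum N c = (\<lambda>x. \<Sum>m<N. complex_of_real (c m / sqrt (\<mu> m)) * h m x)"

lemma rsum_V: "rsum N c \<in> V"
  unfolding rsum_def by (rule V_sum)

lemma rsum_values:
  "Re (L2_inner M (A (rsum N c)) (rsum N c)) = (\<Sum>m<N. (c m)\<^sup>2)"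
  "(L2_norm M (rsum N c))\<^sup>2 = (\<Sum>m<N. c m * c m / \<mu> m)"
  "(L2_norm M (wm (rsum N c)))\<^sup>2 = (\<Sum>m<N. \<Sum>n<N. c m * c n * rmat m n)"
proof -
  have co: "co (rsum N c) m = (if m < N then complex_of_real (c m / sqrt (\<mu> m)) else 0)" for m
    unfolding rsum_def by (subst co_sum) simp_all
  have "(\<lambda>m. \<mu> m * (cmod (co (rsum N c) m))\<^sup>2) sums (\<Sum>m<N. \<mu> m * (cmod (co (rsum N c) m))\<^sup>2)"
    by (rule sums_finite) (auto simp: co)
  also have "(\<Sum>m<N. \<mu> m * (cmod (co (rsum N c) m))\<^sup>2) = (\<Sum>m<N. (c m)\<^sup>2)"
    using \<mu>_gt_0' by (intro sum.cong) (auto simp: co norm_divide power_divide)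
  finally show "Re (L2_inner M (A (rsum N c)) (rsum N c)) = (\<Sum>m<N. (c m)\<^sup>2)"
    using A_energy_sums[OF rsum_V] sums_unique2 by blast
  show "(L2_norm M (rsum N c))\<^sup>2 = (\<Sum>m<N. c m * c m / \<mu> m)"
    unfolding rsum_def norm_sum[OF finite_lessThan]
    using \<mu>_gt_0' by (intro sum.cong) (auto simp: norm_divide power_divide power2_eq_square)
  show "(L2_norm M (wm (rsum N c)))\<^sup>2 = (\<Sum>m<N. \<Sum>n<N. c m * c n * rmat m n)"
    unfolding L2_norm_sq rsum_def wm_sum_inner Re_sum
    by (intro sum.cong refl) (simp add: rmat_def)
qed

lemma b_sym: "b m n = b n m"
proof -
  have "complex_of_real (b m n) = cnj (complex_of_real (b n m))"
    by (simp only: w_basis[symmetric] L2_inner_commute[symmetric])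
  then show ?thesis by simp
qed

sublocale R: bounded_psd_matrix rmat K
proof
  show "rmat m n = rmat n m" for m n by (simp add: rmat_def b_sym[of m n] mult.commute)
  show "0 \<le> (\<Sum>m<N. \<Sum>n<N. c m * c n * rmat m n)" for N c
    unfolding rsum_values(3)[symmetric] by simp
  show "(\<Sum>m<N. \<Sum>n<N. c m * c n * rmat m n) \<le> K * (\<Sum>m<N. (c m)\<^sup>2)" for N c
    unfolding rsum_values(3)[symmetric] rsum_values(1)[symmetric] by (rule w_bound[OF rsum_V])
qed

abbreviation \<beta> :: "ell2 \<Rightarrow> ell2 \<Rightarrow> real" where "\<beta> \<equiv> R.form"

text \<open>The transfer principle: an inequality between the three quadratic forms, known for
  functions in \<open>V\<close>, is applied to the finite sums \<open>rsum\<close> and passes to all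
  of \<open>ell2\<close> by continuity. Positivity of \<open>\<beta>\<close> and both eigenvalue
  bounds are instances.\<close>

lemma form_inequality:
  assumes "\<And>\<phi>. \<phi> \<in> V \<Longrightarrow> 0 \<le> p * Re (L2_inner M (A \<phi>) \<phi>) + q * (L2_norm M \<phi>)\<^sup>2 + r * (L2_norm M (wm \<phi>))\<^sup>2"
  shows "0 \<le> p * (norm x)\<^sup>2 + q * g x x + r * \<beta> x x"
proof (rule LIMSEQ_le_const)
  show "(\<lambda>N. p * (\<Sum>m<N. (coord x m)\<^sup>2) + q * section_form wmat N x x + r * section_form rmat N x x)
      \<longlonglongrightarrow> p * (norm x)\<^sup>2 + q * g x x + r * \<beta> x x"
    using norm_ell2_sums[of x] unfolding sums_def by (intro tendsto_intros W.form_tendsto R.form_tendsto)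
  have "0 \<le> p * (\<Sum>m<N. (coord x m)\<^sup>2) + q * section_form wmat N x x + r * section_form rmat N x x" for N
    using assms[OF rsum_V[of N "coord x"]] unfolding rsum_values section_form_def sum_wmat .
  then show "\<exists>N0. \<forall>N\<ge>N0. 0 \<le> p * (\<Sum>m<N. (coord x m)\<^sup>2) + q * section_form wmat N x x + r * section_form rmat N x x"
    by blast
qed

definition tt :: "ell2 \<Rightarrow> ell2 \<Rightarrow> real" where "tt x y = inner x y + \<xi> * \<beta> x y"

lemma tt_bounded_bilinear: "bounded_bilinear tt"
proof
  interpret B: bounded_bilinear \<beta> by (rule R.form_bounded_bilinear)
  fix x x' y y' :: ell2 and r :: real
  show "tt (x + x') y = tt x y + tt x' y" "tt x (y + y') = tt x y + tt x y'"
    "tt (r *\<^sub>R x) y = r *\<^sub>R tt x y" "tt x (r *\<^sub>R y) = r *\<^sub>R tt x y"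
    by (simp_all add: tt_def B.add_left B.add_right B.scaleR_left B.scaleR_right inner_add_left inner_add_right algebra_simps)
  obtain C where C: "\<And>x y. norm (\<beta> x y) \<le> norm x * norm y * C" using B.bounded by blast
  have "norm (tt x y) \<le> norm x * norm y * (1 + \<xi> * C)" for x y
  proof -
    have "\<bar>tt x y\<bar> \<le> \<bar>inner x y\<bar> + \<xi> * \<bar>\<beta> x y\<bar>"
      unfolding tt_def using \<xi>_pos by (metis abs_mult abs_of_pos abs_triangle_ineq)
    also have "\<dots> \<le> norm x * norm y + \<xi> * (norm x * norm y * C)"
      using C[of x y] \<xi>_pos Cauchy_Schwarz_ineq2[of x y] by (intro add_mono mult_left_mono) auto
    finally show ?thesis by (simp add: algebra_simps)
  qed
  then show "\<exists>K. \<forall>x y. norm (tt x y) \<le> norm x * norm y * K" by blast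
qed

sublocale F: form_pair tt g
proof (rule form_pair.intro)
  show "bounded_bilinear tt" by (rule tt_bounded_bilinear)
  show "bounded_bilinear g" by (rule W.form_bounded_bilinear)
  show "tt x y = tt y x" for x y by (simp add: tt_def inner_commute R.form_sym)
  show "g x y = g y x" for x y by (rule W.form_sym)
  have "0 \<le> \<beta> x x" for x using form_inequality[of 0 0 1 x] by simp
  then show "x \<bullet> x \<le> tt x x" for x using \<xi>_pos by (simp add: tt_def)
  show "x \<noteq> 0 \<Longrightarrow> g x x > 0" for x by (rule g_self_pos)
  show "(\<And>k. norm (X k) \<le> B) \<Longrightarrow> \<exists>r::nat \<Rightarrow> nat. strict_mono r \<and>
      (\<forall>e>0. \<exists>K. \<forall>k\<ge>K. \<forall>l\<ge>K. g (X (r k) - X (r l)) (X (r k) - X (r l)) < e)" for X B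
    by (rule g_compact)
  show "\<exists>w. w \<noteq> 0 \<and> (\<forall>i<n::nat. g w (e i) = 0)" for n e
    using unit_combination[of n e] by metis
qed

text \<open>The factor \<open>sqrt (\<mu> m)\<close> makes the unperturbed form the inner product of \<open>ell2\<close>; real and
  imaginary parts are kept apart because all matrix entries are real.\<close>

definition rep :: "ell2 \<Rightarrow> ell2 \<Rightarrow> ('a \<Rightarrow> complex) \<Rightarrow> bool" where
  "rep x y f \<longleftrightarrow> f \<in> L2 M \<and> (\<forall>m. co f m = Complex (coord x m) (coord y m) / complex_of_real (sqrt (\<mu> m)))"

lemma rep_L2: "rep x y f \<Longrightarrow> f \<in> L2 M"
  by (simp add: rep_def)

lemma rep_diff: "rep x y f \<Longrightarrow> rep x' y' f' \<Longrightarrow> rep (x - x') (y - y') (\<lambda>t. f t - f' t)"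
  by (auto simp: rep_def L2_diff L2_inner_diff_left basis_L2 coord_simps complex_diff diff_divide_distrib[symmetric])

lemma rep_sum:
  "(\<And>i. i \<in> I \<Longrightarrow> rep (x i) (y i) (f i)) \<Longrightarrow>
    rep (\<Sum>i\<in>I. c i *\<^sub>R x i) (\<Sum>i\<in>I. c i *\<^sub>R y i) (\<lambda>t. \<Sum>i\<in>I. complex_of_real (c i) * f i t)"
  by (auto simp: rep_def L2_sum L2_scale L2_inner_sum_left basis_L2 coord_sum coord_simps complex_eq_iff
      Re_divide_of_real Im_divide_of_real sum_divide_distrib intro!: sum.cong)

lemma rep_exists:
  obtains f where "rep x y f"
proof -
  have "summable (\<lambda>m. (cmod (Complex (coord x m) (coord y m) / complex_of_real (sqrt (\<mu> m))))\<^sup>2)"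
  proof (rule summable_comparison_test')
    show "summable (\<lambda>m. 1 / \<mu> 0 * ((coord x m)\<^sup>2 + (coord y m)\<^sup>2))"
      by (intro summable_mult summable_add coord_summable)
    show "norm ((cmod (Complex (coord x m) (coord y m) / complex_of_real (sqrt (\<mu> m))))\<^sup>2)
        \<le> 1 / \<mu> 0 * ((coord x m)\<^sup>2 + (coord y m)\<^sup>2)" for m
    proof -
      have "1 / \<mu> m \<le> 1 / \<mu> 0" using \<mu>_mono[of 0 m] \<mu>_pos by (intro frac_le) auto
      from mult_right_mono[OF this, of "(coord x m)\<^sup>2 + (coord y m)\<^sup>2"]
      show ?thesis using \<mu>_gt_0'[of m] by (simp add: norm_divide power_divide cmod_power2)
    qed
  qed
  then obtain f where "f \<in> L2 M" "\<And>m. co f m = Complex (coord x m) (coord y m) / complex_of_real (sqrt (\<mu> m))"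
    by (rule Riesz_Fischer) blast
  then have "rep x y f" unfolding rep_def by blast
  then show ?thesis by (rule that)
qed

lemma rep_inner:
  assumes "rep x y f" "rep x' y' f'"
  shows "L2_inner M f f' = cform g x y x' y'"
proof -
  have P: "(\<lambda>m. co f m * cnj (co f' m)) sums L2_inner M f f'"
    using assms by (intro Parseval) (auto simp: rep_def)
  have c: "co f m * cnj (co f' m) = Complex ((coord x m * coord x' m / \<mu> m) + (coord y m * coord y' m / \<mu> m))
      ((coord y m * coord x' m / \<mu> m) - (coord x m * coord y' m / \<mu> m))" for m
  proof -
    have "complex_of_real (sqrt (\<mu> m)) * complex_of_real (sqrt (\<mu> m)) = complex_of_real (\<mu> m)"
      using \<mu>_gt_0'[of m] by (simp flip: of_real_mult)
    then have "co f m * cnj (co f' m) = Complex (coord x m) (coord y m) * cnj (Complex (coord x' m) (coord y' m)) / complex_of_real (\<mu> m)"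
      using assms by (simp add: rep_def)
    then show ?thesis by (simp add: complex_eq_iff add_divide_distrib diff_divide_distrib Re_divide_of_real Im_divide_of_real algebra_simps)
  qed
  show ?thesis
    unfolding cform_def
  proof (rule complex_eqI)
    show "Re (L2_inner M f f') = Re (Complex (g x x' + g y y') (g y x' - g x y'))"
      using sums_unique2[OF sums_Re[OF P, unfolded c complex.sel] sums_add[OF g_weighted_sums g_weighted_sums]] by simp
    show "Im (L2_inner M f f') = Im (Complex (g x x' + g y y') (g y x' - g x y'))"
      using sums_unique2[OF sums_Im[OF P, unfolded c complex.sel] sums_diff[OF g_weighted_sums g_weighted_sums]] by simp
  qed
qed

lemma rep_norm: "rep x y f \<Longrightarrow> (L2_norm M f)\<^sup>2 = g x x + g y y"
  unfolding L2_norm_sq by (simp add: rep_inner cform_def)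

lemma rep_unit: "rep (sqrt (\<mu> m) *\<^sub>R unit2 m) 0 (h m)"
  using \<mu>_gt_0'[of m] by (auto simp: rep_def basis_L2 ortho coord_simps coord_unit2 complex_eq_iff Re_divide_of_real Im_divide_of_real)

lemma rep_trunc:
  assumes "rep x y f"
  shows "rep (trunc2 N x) (trunc2 N y) (\<lambda>t. \<Sum>m<N. co f m * h m t)"
  using assms by (auto simp: rep_def sum_L2 co_sum coord_trunc2 complex_eq_iff)

text \<open>Finiteness of the energy is square summability of the coordinates, so \<open>V\<close>
  lies in the form domain.\<close>

lemma V_rep:
  assumes "\<phi> \<in> V"
  obtains x y where "rep x y \<phi>"
proof -
  have sm: "summable (\<lambda>m. \<mu> m * (cmod (co \<phi> m))\<^sup>2)" using A_energy_sums[OF assms] sums_summable by blast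
  have le: "norm ((sqrt (\<mu> m) * Re (co \<phi> m))\<^sup>2) \<le> \<mu> m * (cmod (co \<phi> m))\<^sup>2"
    "norm ((sqrt (\<mu> m) * Im (co \<phi> m))\<^sup>2) \<le> \<mu> m * (cmod (co \<phi> m))\<^sup>2" for m
    using \<mu>_gt_0'[of m] by (simp_all add: power_mult_distrib cmod_power2 mult_left_mono)
  define x where "x = Abs_ell2 (\<lambda>m. sqrt (\<mu> m) * Re (co \<phi> m))"
  define y where "y = Abs_ell2 (\<lambda>m. sqrt (\<mu> m) * Im (co \<phi> m))"
  have "coord x m = sqrt (\<mu> m) * Re (co \<phi> m)" "coord y m = sqrt (\<mu> m) * Im (co \<phi> m)" for m
    unfolding x_def y_def
    using summable_comparison_test'[OF sm le(1)] summable_comparison_test'[OF sm le(2)] by (simp_all add: coord_Abs)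
  then have "rep x y \<phi>"
    using V_L2(1)[OF assms] \<mu>_gt_0' by (auto simp: rep_def complex_eq_iff Re_divide_of_real Im_divide_of_real)
  then show ?thesis using that by blast
qed

lemma cform_cong_tendsto:
  assumes "bounded_bilinear s"
  shows "(\<lambda>N. cform s (trunc2 N x) (trunc2 N y) (trunc2 N x') (trunc2 N y')) \<longlonglongrightarrow> cform s x y x' y'"
  unfolding cform_def
  by (intro tendsto_Complex tendsto_add tendsto_diff bounded_bilinear.tendsto[OF assms] trunc2_tendsto)

lemma A_inner_cform:
  assumes "\<phi> \<in> V" "rep x y \<phi>" "rep x' y' \<psi>"
  shows "L2_inner M (A \<phi>) \<psi> = cform inner x y x' y'"
proof -
  have P: "(\<lambda>m. complex_of_real (\<mu> m) * (co \<phi> m * cnj (co \<psi> m))) sums L2_inner M (A \<phi>) \<psi>"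
    using assms by (intro A_inner_sums) (auto simp: rep_def)
  have c: "complex_of_real (\<mu> m) * (co \<phi> m * cnj (co \<psi> m)) =
      Complex (coord x m * coord x' m + coord y m * coord y' m) (coord y m * coord x' m - coord x m * coord y' m)" for m
  proof -
    have "complex_of_real (sqrt (\<mu> m)) * complex_of_real (sqrt (\<mu> m)) = complex_of_real (\<mu> m)"
      using \<mu>_gt_0'[of m] by (simp flip: of_real_mult)
    then have "complex_of_real (\<mu> m) * (co \<phi> m * cnj (co \<psi> m)) = Complex (coord x m) (coord y m) * cnj (Complex (coord x' m) (coord y' m))"
      using assms(2,3) \<mu>_gt_0'[of m] by (simp add: rep_def)
    then show ?thesis by (simp add: complex_eq_iff algebra_simps)
  qed
  show ?thesis
    unfolding cform_def
  proof (rule complex_eqI)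
    show "Re (L2_inner M (A \<phi>) \<psi>) = Re (Complex (x \<bullet> x' + y \<bullet> y') (y \<bullet> x' - x \<bullet> y'))"
      using sums_unique2[OF sums_Re[OF P, unfolded c complex.sel] sums_add[OF inner_ell2_sums inner_ell2_sums]] by simp
    show "Im (L2_inner M (A \<phi>) \<psi>) = Im (Complex (x \<bullet> x' + y \<bullet> y') (y \<bullet> x' - x \<bullet> y'))"
      using sums_unique2[OF sums_Im[OF P, unfolded c complex.sel] sums_diff[OF inner_ell2_sums inner_ell2_sums]] by simp
  qed
qed

text \<open>\<open>w_bound\<close> is applied to the truncation error, which is in \<open>V\<close>
  and whose energy is the squared \<open>ell2\<close> norm of the tails of its coordinates.\<close>

lemma w_trunc_tendsto:
  assumes "\<phi> \<in> V"
  shows "(\<lambda>N. L2_norm M (\<lambda>t. wm (\<lambda>t. \<Sum>m<N. co \<phi> m * h m t) t - wm \<phi> t)) \<longlonglongrightarrow> 0"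
proof -
  obtain x y where r: "rep x y \<phi>" using V_rep[OF assms] by blast
  have bound: "(L2_norm M (\<lambda>t. wm (\<lambda>t. \<Sum>m<N. co \<phi> m * h m t) t - wm \<phi> t))\<^sup>2
      \<le> K * ((norm (trunc2 N x - x))\<^sup>2 + (norm (trunc2 N y - y))\<^sup>2)" for N
  proof -
    let ?d = "\<lambda>t. (\<Sum>m<N. co \<phi> m * h m t) - \<phi> t"
    have "?d \<in> V" by (rule V_diff[OF V_sum assms])
    moreover have "rep (trunc2 N x - x) (trunc2 N y - y) ?d" by (rule rep_diff[OF rep_trunc[OF r] r])
    ultimately have "Re (L2_inner M (A ?d) ?d) = (norm (trunc2 N x - x))\<^sup>2 + (norm (trunc2 N y - y))\<^sup>2"
      by (simp add: A_inner_cform cform_def power2_norm_eq_inner)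
    with w_bound[OF \<open>?d \<in> V\<close>] show ?thesis by (simp add: scaleR_diff_right)
  qed
  have "(\<lambda>N. K * ((norm (trunc2 N x - x))\<^sup>2 + (norm (trunc2 N y - y))\<^sup>2)) \<longlonglongrightarrow> K * ((norm (x - x))\<^sup>2 + (norm (y - y))\<^sup>2)"
    by (intro tendsto_intros trunc2_tendsto)
  then have z: "(\<lambda>N. sqrt (K * ((norm (trunc2 N x - x))\<^sup>2 + (norm (trunc2 N y - y))\<^sup>2))) \<longlonglongrightarrow> 0"
    using tendsto_real_sqrt by force
  show ?thesis
    by (rule tendsto_sandwich[OF _ _ tendsto_const z]) (use bound real_le_rsqrt in auto)
qed

text \<open>For truncated expansions this is an identity between finite matrix sums; both sides then
  pass to the limit, the left one by \<open>w_trunc_tendsto\<close> and the right one by boundedness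
  of \<open>\<beta>\<close>.\<close>

lemma w_inner_cform:
  assumes "\<phi> \<in> V" "\<psi> \<in> V" "rep x y \<phi>" "rep x' y' \<psi>"
  shows "L2_inner M (wm \<phi>) (wm \<psi>) = cform \<beta> x y x' y'"
proof -
  let ?t = "\<lambda>f N t. \<Sum>m<N. co f m * h m t"
  have LV: "wm (?t f N) \<in> L2 M" for f N by (rule V_L2(3)[OF V_sum])
  have eq: "L2_inner M (wm (?t \<phi> N)) (wm (?t \<psi> N)) = cform \<beta> (trunc2 N x) (trunc2 N y) (trunc2 N x') (trunc2 N y')" for N
  proof -
    have "L2_inner M (wm (?t \<phi> N)) (wm (?t \<psi> N)) = (\<Sum>m<N. \<Sum>n<N.
        Complex (coord x m * coord x' n * rmat m n + coord y m * coord y' n * rmat m n)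
                (coord y m * coord x' n * rmat m n - coord x m * coord y' n * rmat m n))"
      unfolding wm_sum_inner
    proof (intro sum.cong refl)
      fix m n
      have "co \<phi> m * cnj (co \<psi> n) * complex_of_real (b m n) =
          Complex (coord x m) (coord y m) * cnj (Complex (coord x' n) (coord y' n)) * complex_of_real (rmat m n)"
        using assms(3,4) by (simp add: rep_def rmat_def)
      then show "co \<phi> m * cnj (co \<psi> n) * complex_of_real (b m n) =
          Complex (coord x m * coord x' n * rmat m n + coord y m * coord y' n * rmat m n)
                (coord y m * coord x' n * rmat m n - coord x m * coord y' n * rmat m n)"
        by (simp add: complex_eq_iff algebra_simps)
    qed
    also have "\<dots> = cform \<beta> (trunc2 N x) (trunc2 N y) (trunc2 N x') (trunc2 N y')"
      by (simp add: cform_def R.form_trunc section_form_def complex_eq_iff Re_sum Im_sum sum.distrib sum_subtractf)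
    finally show ?thesis .
  qed
  \<comment> \<open>The two arguments go to the limit one at a time: first the right one, with the
    norm of the left one bounded by the convergent \<open>C N\<close>, then the left one.\<close>
  have "(\<lambda>N. L2_inner M (wm (?t \<phi> N)) (wm (?t \<psi> N)) - L2_inner M (wm (?t \<phi> N)) (wm \<psi>)) \<longlonglongrightarrow> 0"
  proof (rule Lim_null_comparison)
    define C where "C N = L2_norm M (\<lambda>t. wm (?t \<phi> N) t - wm \<phi> t) + L2_norm M (wm \<phi>)" for N
    have "(\<lambda>N. C N * L2_norm M (\<lambda>t. wm (?t \<psi> N) t - wm \<psi> t)) \<longlonglongrightarrow> (0 + L2_norm M (wm \<phi>)) * 0"
      unfolding C_def by (intro tendsto_intros w_trunc_tendsto assms)
    then show "(\<lambda>N. C N * L2_norm M (\<lambda>t. wm (?t \<psi> N) t - wm \<psi> t)) \<longlonglongrightarrow> 0" by simp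
    have "norm (L2_inner M (wm (?t \<phi> N)) (wm (?t \<psi> N)) - L2_inner M (wm (?t \<phi> N)) (wm \<psi>))
        \<le> C N * L2_norm M (\<lambda>t. wm (?t \<psi> N) t - wm \<psi> t)" for N
    proof -
      have D: "(\<lambda>t. wm (?t f N) t - wm f t) \<in> L2 M" if "f \<in> V" for f by (intro L2_diff LV V_L2(3) that)
      have "L2_inner M (wm (?t \<phi> N)) (wm (?t \<psi> N)) - L2_inner M (wm (?t \<phi> N)) (wm \<psi>)
          = L2_inner M (wm (?t \<phi> N)) (\<lambda>t. wm (?t \<psi> N) t - wm \<psi> t)"
        by (rule L2_inner_diff_right[symmetric]) (intro LV V_L2(3) assms)+
      also have "norm \<dots> \<le> L2_norm M (wm (?t \<phi> N)) * L2_norm M (\<lambda>t. wm (?t \<psi> N) t - wm \<psi> t)"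
        by (intro L2_Cauchy_Schwarz LV D assms)
      also have "L2_norm M (wm (?t \<phi> N)) \<le> C N"
      proof -
        have "(\<lambda>t. (-1) * wm \<phi> t) \<in> L2 M" by (intro L2_scale V_L2(3) assms)
        from L2_norm_triangle[OF D[OF assms(1)] this]
        have "L2_norm M (wm (?t \<phi> N)) \<le> L2_norm M (\<lambda>t. wm (?t \<phi> N) t - wm \<phi> t) + L2_norm M (\<lambda>t. (-1) * wm \<phi> t)"
          by simp
        moreover have "L2_norm M (\<lambda>t. (-1) * wm \<phi> t) = L2_norm M (wm \<phi>)" by (simp add: L2_norm_def)
        ultimately show ?thesis by (simp add: C_def)
      qed
      finally show ?thesis by (simp add: mult_right_mono)
    qed
    then show "\<forall>\<^sub>F N in sequentially. norm (L2_inner M (wm (?t \<phi> N)) (wm (?t \<psi> N)) - L2_inner M (wm (?t \<phi> N)) (wm \<psi>))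
        \<le> C N * L2_norm M (\<lambda>t. wm (?t \<psi> N) t - wm \<psi> t)" by simp
  qed
  moreover have "(\<lambda>N. L2_inner M (wm (?t \<phi> N)) (wm \<psi>)) \<longlonglongrightarrow> L2_inner M (wm \<phi>) (wm \<psi>)"
    by (intro L2_inner_tendsto LV V_L2(3) w_trunc_tendsto assms)
  ultimately have "(\<lambda>N. L2_inner M (wm (?t \<phi> N)) (wm (?t \<psi> N))) \<longlonglongrightarrow> L2_inner M (wm \<phi>) (wm \<psi>)"
    using tendsto_add by fastforce
  then show ?thesis
    unfolding eq using cform_cong_tendsto[OF R.form_bounded_bilinear] LIMSEQ_unique by blast
qed

lemma total_form_cform:
  assumes "\<phi> \<in> V" "\<psi> \<in> V" "rep x y \<phi>" "rep x' y' \<psi>"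
  shows "L2_inner M (A \<phi>) \<psi> + complex_of_real \<xi> * L2_inner M (wm \<phi>) (wm \<psi>) = cform tt x y x' y'"
  unfolding A_inner_cform[OF assms(1,3,4)] w_inner_cform[OF assms]
  by (simp add: cform_def tt_def complex_eq_iff algebra_simps)

end

section \<open>The operator and its square root, built from the eigenvectors\<close>

locale perturbed_form_eigen = perturbed_form M h \<mu> w V A b \<xi> K + E: form_pair_eigenbasis tt g e l
  for M :: "'a measure" and h :: "nat \<Rightarrow> 'a \<Rightarrow> complex" and \<mu> :: "nat \<Rightarrow> real" and w V A b \<xi> K e l
begin

text \<open>A trial vector in the span of \<open>e 0\<close>, ..., \<open>e n\<close> with its first
  n coordinates zero has form value at most \<open>l n\<close> times its \<open>g\<close> value,
  while its squared norm is at least \<open>\<mu> n\<close> times that. The condition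
  \<open>\<xi> * \<alpha> \<le> 1\<close> keeps the factor in front of the norm nonnegative.\<close>

lemma eigenvalue_lower:
  assumes bd: "\<And>\<phi>. \<phi> \<in> V \<Longrightarrow> \<gamma> * (L2_norm M \<phi>)\<^sup>2 - \<alpha> * Re (L2_inner M (A \<phi>) \<phi>) \<le> (L2_norm M (wm \<phi>))\<^sup>2"
    and \<alpha>: "\<xi> * \<alpha> \<le> 1"
  shows "(1 - \<xi> * \<alpha>) * \<mu> n + \<xi> * \<gamma> \<le> l n"
proof -
  obtain c where c: "\<exists>j\<le>n. c j \<noteq> 0" "\<And>i. i < n \<Longrightarrow> (\<Sum>j\<le>n. coord (e j) i * c j) = 0"
    using underdetermined_system[of n "\<lambda>i j. coord (e j) i"] by blast
  define x where "x = (\<Sum>j\<le>n. c j *\<^sub>R e j)"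
  have gx: "g x (e i) = (if i \<le> n then c i else 0)" for i
    unfolding x_def using E.g_sum_left[of "{..n}" c i] by simp
  have "x \<noteq> 0" using c(1) gx by (metis F.g_simps(7))
  then have gpos: "g x x > 0" by (rule g_self_pos)
  have low: "coord x i = 0" if "i < n" for i
    using c(2)[OF that] by (simp add: x_def coord_sum coord_simps mult.commute)
  have "tt x x = (\<Sum>j\<le>n. l j * (c j)\<^sup>2)" unfolding x_def by (rule E.t_sum) simp
  also have "\<dots> \<le> (\<Sum>j\<le>n. l n * (c j)\<^sup>2)" by (intro sum_mono mult_right_mono E.l_mono) auto
  also have "\<dots> = l n * (\<Sum>j\<le>n. (c j)\<^sup>2)" by (simp add: sum_distrib_left)
  also have "(\<Sum>j\<le>n. (c j)\<^sup>2) = g x x"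
  proof -
    have "g x x = (\<Sum>j\<le>n. c j * g x (e j))"
      by (subst (2) x_def) (simp add: F.g_simps)
    also have "\<dots> = (\<Sum>j\<le>n. (c j)\<^sup>2)" by (intro sum.cong) (auto simp: gx power2_eq_square)
    finally show ?thesis by simp
  qed
  finally have up: "tt x x \<le> l n * g x x" .
  have "0 \<le> \<alpha> * (norm x)\<^sup>2 + (- \<gamma>) * g x x + 1 * \<beta> x x"
    by (rule form_inequality) (use bd in \<open>simp add: algebra_simps\<close>)
  then have "\<xi> * (\<gamma> * g x x - \<alpha> * (norm x)\<^sup>2) \<le> \<xi> * \<beta> x x" using \<xi>_pos by (intro mult_left_mono) auto
  then have "(1 - \<xi> * \<alpha>) * (norm x)\<^sup>2 + \<xi> * \<gamma> * g x x \<le> tt x x"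
    by (simp add: tt_def power2_norm_eq_inner algebra_simps)
  moreover have "(1 - \<xi> * \<alpha>) * (\<mu> n * g x x) \<le> (1 - \<xi> * \<alpha>) * (norm x)\<^sup>2"
    using \<alpha> by (intro mult_left_mono g_le_norm low) auto
  ultimately have "((1 - \<xi> * \<alpha>) * \<mu> n + \<xi> * \<gamma>) * g x x \<le> l n * g x x" using up by (simp add: algebra_simps)
  then show ?thesis using gpos by simp
qed

text \<open>The roles are exchanged: the trial vector is in the span of the first n + 1 coordinate
  vectors and \<open>g\<close>-orthogonal to the first n eigenvectors, hence admissible in the
  minimisation defining \<open>l n\<close>.\<close>

lemma eigenvalue_upper:
  assumes bd: "\<And>\<phi>. \<phi> \<in> V \<Longrightarrow> (L2_norm M (wm \<phi>))\<^sup>2 \<le> \<alpha> * Re (L2_inner M (A \<phi>) \<phi>) + \<gamma> * (L2_norm M \<phi>)\<^sup>2"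
    and \<alpha>: "\<alpha> \<ge> 0"
  shows "l n \<le> (1 + \<xi> * \<alpha>) * \<mu> n + \<xi> * \<gamma>"
proof -
  obtain x where x: "x \<noteq> 0" "\<And>m. m > n \<Longrightarrow> coord x m = 0" "\<And>i. i < n \<Longrightarrow> g x (e i) = 0"
    using unit_combination[of n e] by blast
  have "l n * g x x \<le> tt x x" by (rule E.min) (rule x(3))
  moreover have "0 \<le> \<alpha> * (norm x)\<^sup>2 + \<gamma> * g x x + (- 1) * \<beta> x x"
    by (rule form_inequality) (use bd in \<open>simp add: algebra_simps\<close>)
  then have "\<xi> * \<beta> x x \<le> \<xi> * (\<alpha> * (norm x)\<^sup>2 + \<gamma> * g x x)" using \<xi>_pos by (intro mult_left_mono) auto
  then have "tt x x \<le> (1 + \<xi> * \<alpha>) * (norm x)\<^sup>2 + \<xi> * \<gamma> * g x x"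
    by (simp add: tt_def power2_norm_eq_inner algebra_simps)
  moreover have "(1 + \<xi> * \<alpha>) * (norm x)\<^sup>2 \<le> (1 + \<xi> * \<alpha>) * (\<mu> n * g x x)"
    using \<alpha> \<xi>_pos x(2) by (intro mult_left_mono norm_le_g) auto
  ultimately have "l n * g x x \<le> ((1 + \<xi> * \<alpha>) * \<mu> n + \<xi> * \<gamma>) * g x x" by (simp add: algebra_simps)
  then show ?thesis using g_self_pos[OF x(1)] by simp
qed

lemma l_top: "filterlim l at_top sequentially"
proof (rule filterlim_at_top_mono[OF \<mu>_top])
  have "\<mu> n \<le> l n" for n using eigenvalue_lower[of 0 0 n] by simp
  then show "\<forall>\<^sub>F n in sequentially. \<mu> n \<le> l n" by simp
qed

definition eps :: "nat \<Rightarrow> 'a \<Rightarrow> complex" where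
  "eps n = (SOME f. rep (e n) 0 f)"

lemma eps_rep: "rep (e n) 0 (eps n)"
proof -
  obtain f where "rep (e n) 0 f" by (rule rep_exists)
  then show ?thesis unfolding eps_def by (rule someI[of "rep (e n) 0"])
qed

lemma inner_eps:
  assumes "rep x y f"
  shows "L2_inner M f (eps n) = Complex (g x (e n)) (g y (e n))"
  unfolding rep_inner[OF assms eps_rep] by (simp add: cform_def F.g_simps)

sublocale X: L2_basis M eps
proof
  show "eps n \<in> L2 M" for n using eps_rep rep_L2 by blast
  show "L2_inner M (eps m) (eps n) = (if m = n then 1 else 0)" for m n
    unfolding inner_eps[OF eps_rep] by (simp add: E.orth F.g_simps complex_eq_iff)
  fix f assume f: "f \<in> L2 M" and z: "\<And>n. L2_inner M f (eps n) = 0"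
  show "AE x in M. f x = 0"
  proof (rule complete[OF f])
    fix m
    define x where "x = sqrt (\<mu> m) *\<^sub>R unit2 m"
    \<comment> \<open>\<open>x\<close> holds the coordinates of \<open>h m\<close>. Its expansion
      along \<open>e\<close> converges in \<open>ell2\<close>, so \<open>h m\<close> is an L2 limit
      of combinations of the \<open>eps n\<close>, and a function orthogonal to all of these is
      orthogonal to \<open>h m\<close>.\<close>
    define r where "r N = (\<lambda>t. h m t - (\<Sum>n<N. complex_of_real (g x (e n)) * eps n t))" for N
    have L: "(\<lambda>t. \<Sum>n<N. complex_of_real (g x (e n)) * eps n t) \<in> L2 M" for N
      by (intro L2_sum L2_scale rep_L2[OF eps_rep])
    have "rep (x - E.partial x N) (0 - (\<Sum>n<N. g x (e n) *\<^sub>R 0)) (r N)" for N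
      unfolding r_def E.partial_def x_def by (intro rep_diff rep_unit rep_sum eps_rep)
    from rep_norm[OF this] have nr2: "(L2_norm M (r N))\<^sup>2 = g (x - E.partial x N) (x - E.partial x N)" for N
      by (simp add: F.g_simps(7))
    have nr: "L2_norm M (r N) = sqrt (g (x - E.partial x N) (x - E.partial x N))" for N
      unfolding nr2[symmetric] by simp
    have "(\<lambda>N. sqrt (g (x - E.partial x N) (x - E.partial x N))) \<longlonglongrightarrow> sqrt (g (x - x) (x - x))"
      by (intro tendsto_real_sqrt bounded_bilinear.tendsto[OF F.g_bil] tendsto_diff tendsto_const E.partial_tendsto l_top)
    then have "(\<lambda>N. L2_norm M (r N)) \<longlonglongrightarrow> 0" by (simp add: nr F.g_simps)
    then have lim: "(\<lambda>N. L2_norm M f * L2_norm M (r N)) \<longlonglongrightarrow> L2_norm M f * 0" by (intro tendsto_intros)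
    have "cmod (L2_inner M f (h m)) \<le> L2_norm M f * L2_norm M (r N)" for N
    proof -
      have "L2_inner M f (r N) = L2_inner M f (h m) - L2_inner M f (\<lambda>t. \<Sum>n<N. complex_of_real (g x (e n)) * eps n t)"
        unfolding r_def by (rule L2_inner_diff_right[OF basis_L2 L f])
      also have "L2_inner M f (\<lambda>t. \<Sum>n<N. complex_of_real (g x (e n)) * eps n t) = 0"
        by (subst L2_inner_sum_right) (auto intro: rep_L2[OF eps_rep] f simp: z)
      finally show ?thesis
        using L2_Cauchy_Schwarz[OF f, of "r N"] L2_diff[OF basis_L2 L] by (simp add: r_def)
    qed
    then have "cmod (L2_inner M f (h m)) \<le> L2_norm M f * 0"
      by (intro LIMSEQ_le_const[OF lim]) blast
    then show "L2_inner M f (h m) = 0" by simp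
  qed
qed

abbreviation "P \<equiv> diag_op M eps l"
abbreviation "R \<equiv> diag_op M eps (\<lambda>n. sqrt (l n))"

lemma tt_pair_sums:
  "(\<lambda>n. l n * (g x (e n) * g x' (e n) + g y (e n) * g y' (e n))) sums (tt x x' + tt y y')"
  using sums_add[OF E.t_sums[OF l_top, of x x'] E.t_sums[OF l_top, of y y']] by (simp add: algebra_simps)

text \<open>In Parseval's sum the two factors \<open>sqrt (l n)\<close> combine to
  \<open>l n\<close>, and the result is the expansion of \<open>tt\<close> in
  \<open>E.t_sums\<close>.\<close>

lemma R_inner:
  assumes "rep x y f" "rep x' y' f'" "(f, k) \<in> R" "(f', k') \<in> R"
  shows "L2_inner M k k' = cform tt x y x' y'"
proof -
  note d = X.diag_opD[OF assms(3)] X.diag_opD[OF assms(4)]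
  have P: "(\<lambda>n. L2_inner M k (eps n) * cnj (L2_inner M k' (eps n))) sums L2_inner M k k'"
    by (intro X.Parseval d)
  have c: "L2_inner M k (eps n) * cnj (L2_inner M k' (eps n)) =
      Complex (l n * (g x (e n) * g x' (e n)) + l n * (g y (e n) * g y' (e n)))
              (l n * (g y (e n) * g x' (e n)) - l n * (g x (e n) * g y' (e n)))" for n
  proof -
    have "complex_of_real (sqrt (l n)) * complex_of_real (sqrt (l n)) = complex_of_real (l n)"
      using E.l_nonneg[of n] by (simp flip: of_real_mult)
    then have "L2_inner M k (eps n) * cnj (L2_inner M k' (eps n)) =
        complex_of_real (l n) * (L2_inner M f (eps n) * cnj (L2_inner M f' (eps n)))"
      unfolding d(3) d(6) by (simp add: algebra_simps)
    then show ?thesis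
      unfolding inner_eps[OF assms(1)] inner_eps[OF assms(2)] by (simp add: complex_eq_iff algebra_simps)
  qed
  show ?thesis
    unfolding cform_def
  proof (rule complex_eqI)
    show "Re (L2_inner M k k') = Re (Complex (tt x x' + tt y y') (tt y x' - tt x y'))"
      using sums_unique2[OF sums_Re[OF P, unfolded c complex.sel] sums_add[OF E.t_sums[OF l_top] E.t_sums[OF l_top]]] by simp
    show "Im (L2_inner M k k') = Im (Complex (tt x x' + tt y y') (tt y x' - tt x y'))"
      using sums_unique2[OF sums_Im[OF P, unfolded c complex.sel] sums_diff[OF E.t_sums[OF l_top] E.t_sums[OF l_top]]] by simp
  qed
qed

lemma rep_in_domain:
  assumes "rep x y f"
  obtains k where "(f, k) \<in> R"
proof (rule X.diag_op_image[OF rep_L2[OF assms]])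
  have "(sqrt (l n))\<^sup>2 * (cmod (L2_inner M f (eps n)))\<^sup>2 = l n * (g x (e n) * g x (e n) + g y (e n) * g y (e n))" for n
    using E.l_nonneg[of n] by (simp add: inner_eps[OF assms] cmod_power2) (simp add: power2_eq_square)
  then show "summable (\<lambda>n. (sqrt (l n))\<^sup>2 * (cmod (L2_inner M f (eps n)))\<^sup>2)"
    using sums_summable[OF tt_pair_sums[of x x y y]] by simp
qed (use that in blast)

text \<open>Square integrability of the image \<open>k\<close> is summability of \<open>l n\<close>
  times the squared coefficients of \<open>f\<close>, exactly what
  \<open>convergent_expansion\<close> asks for. With \<open>rep_in_domain\<close>, the domain of the
  square root is the form domain.\<close>

lemma domain_rep:
  assumes "(f, k) \<in> R"
  obtains x y where "rep x y f"
proof -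
  note d = X.diag_opD[OF assms]
  define F where "F n = L2_inner M f (eps n)" for n
  have sm: "summable (\<lambda>n. (cmod (L2_inner M k (eps n)))\<^sup>2)" by (rule X.co_summable[OF d(2)])
  have k: "(cmod (L2_inner M k (eps n)))\<^sup>2 = l n * (cmod (F n))\<^sup>2" for n
    using E.l_nonneg[of n] by (simp add: d(3) F_def norm_mult power_mult_distrib)
  have "norm (l n * (Re (F n))\<^sup>2) \<le> (cmod (L2_inner M k (eps n)))\<^sup>2" "norm (l n * (Im (F n))\<^sup>2) \<le> (cmod (L2_inner M k (eps n)))\<^sup>2" for n
    using E.l_nonneg[of n] unfolding k by (simp_all add: cmod_power2 mult_left_mono)
  from this[THEN summable_comparison_test'[OF sm]]
  have "summable (\<lambda>n. l n * (Re (F n))\<^sup>2)" "summable (\<lambda>n. l n * (Im (F n))\<^sup>2)"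
    by auto
  from this[THEN E.convergent_expansion]
  obtain x y where x: "(\<lambda>N. \<Sum>n<N. Re (F n) *\<^sub>R e n) \<longlonglongrightarrow> x" and y: "(\<lambda>N. \<Sum>n<N. Im (F n) *\<^sub>R e n) \<longlonglongrightarrow> y"
    by (auto simp: convergent_def)
  have lim: "g z (e n) = c n" if "(\<lambda>N. \<Sum>n<N. c n *\<^sub>R e n) \<longlonglongrightarrow> z" for c z n
  proof (rule LIMSEQ_unique)
    show "(\<lambda>N. g (\<Sum>n<N. c n *\<^sub>R e n) (e n)) \<longlonglongrightarrow> g z (e n)"
      by (intro bounded_bilinear.tendsto[OF F.g_bil] that tendsto_const)
    show "(\<lambda>N. g (\<Sum>n<N. c n *\<^sub>R e n) (e n)) \<longlonglongrightarrow> c n"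
      by (rule tendsto_eventually, rule eventually_sequentiallyI[of "Suc n"]) (simp add: E.g_sum_left)
  qed
  obtain f' where f': "rep x y f'" by (rule rep_exists)
  have ae: "AE t in M. f' t = f t"
  proof (rule X.co_eqI[OF rep_L2[OF f'] d(1)])
    show "L2_inner M f' (eps n) = L2_inner M f (eps n)" for n
      unfolding inner_eps[OF f'] lim[OF x] lim[OF y] by (simp add: F_def)
  qed
  have "L2_inner M f' (h m) = L2_inner M f (h m)" for m
    by (rule L2_inner_cong_AE[OF ae rep_L2[OF f'] d(1) basis_L2])
  then have "rep x y f" using f' d(1) by (simp add: rep_def)
  then show ?thesis by (rule that)
qed

text \<open>Truncated Laguerre-type expansions lie in \<open>V\<close>. In coordinates they converge
  in \<open>ell2\<close>, where the squared errors of vector and image are the continuous forms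
  \<open>g\<close> and \<open>tt\<close>.\<close>

lemma V_core: "is_core M V R"
  unfolding is_core_def
proof (intro conjI subsetI)
  fix \<phi> assume "\<phi> \<in> V"
  then obtain x y where "rep x y \<phi>" by (rule V_rep)
  then show "\<phi> \<in> Domain R" by (rule rep_in_domain) blast
next
  have "\<exists>(f', k')\<in>R. f' \<in> V \<and> L2_norm M (\<lambda>t. f t - f' t) < d \<and> L2_norm M (\<lambda>t. k t - k' t) < d"
    if fk: "(f, k) \<in> R" and d: "d > 0" for f k d
  proof -
    obtain x y where r: "rep x y f" using fk by (rule domain_rep)
    define v where "v N = (\<lambda>t. \<Sum>m<N. co f m * h m t)" for N
    have rv: "rep (trunc2 N x) (trunc2 N y) (v N)" for N unfolding v_def by (rule rep_trunc[OF r])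
    have lim: "(\<lambda>N. s (x - trunc2 N x) (x - trunc2 N x) + s (y - trunc2 N y) (y - trunc2 N y)) \<longlonglongrightarrow> 0"
      if "bounded_bilinear s" for s :: "ell2 \<Rightarrow> ell2 \<Rightarrow> real"
    proof -
      have "(\<lambda>N. s (x - trunc2 N x) (x - trunc2 N x) + s (y - trunc2 N y) (y - trunc2 N y))
          \<longlonglongrightarrow> s (x - x) (x - x) + s (y - y) (y - y)"
        by (intro tendsto_add bounded_bilinear.tendsto[OF that] tendsto_diff tendsto_const trunc2_tendsto)
      then show ?thesis by (simp add: bounded_bilinear.zero_left[OF that])
    qed
    have "\<forall>\<^sub>F N in sequentially. g (x - trunc2 N x) (x - trunc2 N x) + g (y - trunc2 N y) (y - trunc2 N y) < d\<^sup>2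
        \<and> tt (x - trunc2 N x) (x - trunc2 N x) + tt (y - trunc2 N y) (y - trunc2 N y) < d\<^sup>2"
      using d by (intro eventually_conj order_tendstoD(2)[OF lim] F.g_bil F.t_bil) auto
    then obtain N where N: "g (x - trunc2 N x) (x - trunc2 N x) + g (y - trunc2 N y) (y - trunc2 N y) < d\<^sup>2"
      "tt (x - trunc2 N x) (x - trunc2 N x) + tt (y - trunc2 N y) (y - trunc2 N y) < d\<^sup>2"
      by (auto simp: eventually_sequentially)
    obtain k' where k': "(v N, k') \<in> R" using rv by (rule rep_in_domain)
    have rd: "rep (x - trunc2 N x) (y - trunc2 N y) (\<lambda>t. f t - v N t)" by (rule rep_diff[OF r rv])
    have dd: "((\<lambda>t. f t - v N t), (\<lambda>t. k t - k' t)) \<in> R"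
    proof -
      have "((\<lambda>t. 1 * f t + (- 1) * v N t), (\<lambda>t. 1 * k t + (- 1) * k' t)) \<in> R"
        using X.diag_op_L2_operator[of "\<lambda>n. sqrt (l n)"] fk k' unfolding L2_operator_def by blast
      then show ?thesis by simp
    qed
    have "(L2_norm M (\<lambda>t. f t - v N t))\<^sup>2 < d\<^sup>2" using N(1) by (simp add: rep_norm[OF rd])
    then have "L2_norm M (\<lambda>t. f t - v N t) < d" using d by (simp add: power_less_imp_less_base)
    moreover have "(L2_norm M (\<lambda>t. k t - k' t))\<^sup>2 < d\<^sup>2"
      using N(2) by (simp add: L2_norm_sq R_inner[OF rd rd dd dd] cform_def)
    then have "L2_norm M (\<lambda>t. k t - k' t) < d" using d by (simp add: power_less_imp_less_base)
    moreover have "v N \<in> V" unfolding v_def by (rule V_sum)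
    ultimately show ?thesis using k' by blast
  qed
  then show "\<forall>(f, k)\<in>R. \<forall>d>0. \<exists>(f', k')\<in>R. f' \<in> V \<and> L2_norm M (\<lambda>t. f t - f' t) < d \<and> L2_norm M (\<lambda>t. k t - k' t) < d"
    by blast
qed

lemma R_form:
  assumes "\<phi> \<in> V" "\<psi> \<in> V" "(\<phi>, k) \<in> R" "(\<psi>, k') \<in> R"
  shows "L2_inner M k k' = L2_inner M (A \<phi>) \<psi> + complex_of_real \<xi> * L2_inner M (wm \<phi>) (wm \<psi>)"
proof -
  obtain x y where 1: "rep x y \<phi>" using assms(1) by (rule V_rep)
  obtain x' y' where 2: "rep x' y' \<psi>" using assms(2) by (rule V_rep)
  show ?thesis unfolding R_inner[OF 1 2 assms(3,4)] total_form_cform[OF assms(1,2) 1 2] ..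
qed

end

text \<open>The eigenvalue bounds are quantified over all comparison constants because the lower
  estimate takes a new pair \<open>\<alpha>\<close>, \<open>\<gamma>\<close> for each eigenvalue and
  the upper one a new pair for each \<epsilon>, with the same operator and eigenvalues.\<close>

theorem (in perturbed_form) perturbed_operator_exists:
  "\<exists>P R lam. positive_self_adjoint M P \<and> is_square_root M R P \<and> is_core M V R \<and>
    (\<forall>\<phi>\<in>V. \<forall>\<psi>\<in>V. \<forall>k k'. (\<phi>, k) \<in> R \<longrightarrow> (\<psi>, k') \<in> R \<longrightarrow>
       L2_inner M k k' = L2_inner M (A \<phi>) \<psi> + complex_of_real \<xi> * L2_inner M (wm \<phi>) (wm \<psi>)) \<and>
    discrete_spectrum M P \<and> lists_eigenvalues M P lam \<and>
    (\<forall>\<alpha> \<gamma> k. \<xi> * \<alpha> \<le> 1 \<longrightarrow>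
      (\<forall>\<phi>\<in>V. \<gamma> * (L2_norm M \<phi>)\<^sup>2 - \<alpha> * Re (L2_inner M (A \<phi>) \<phi>) \<le> (L2_norm M (wm \<phi>))\<^sup>2) \<longrightarrow>
      (1 - \<xi> * \<alpha>) * \<mu> (k div 2) + \<xi> * \<gamma> \<le> lam k) \<and>
    (\<forall>\<alpha> \<gamma> k. 0 \<le> \<alpha> \<longrightarrow>
      (\<forall>\<phi>\<in>V. (L2_norm M (wm \<phi>))\<^sup>2 \<le> \<alpha> * Re (L2_inner M (A \<phi>) \<phi>) + \<gamma> * (L2_norm M \<phi>)\<^sup>2) \<longrightarrow>
      lam k \<le> (1 + \<xi> * \<alpha>) * \<mu> (k div 2) + \<xi> * \<gamma>)"
proof -
  obtain e :: "nat \<Rightarrow> ell2" where "(\<forall>i j. g (e i) (e j) = (if i = j then 1 else 0)) \<and>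
    (\<forall>n z. tt (e n) z = tt (e n) (e n) * g (e n) z) \<and>
    (\<forall>n w. (\<forall>i<n. g w (e i) = 0) \<longrightarrow> tt (e n) (e n) * g w w \<le> tt w w)"
    using F.eigenvectors_exist by (rule exE) (rule that)
  then have e: "g (e i) (e j) = (if i = j then 1 else 0)" "tt (e n) z = tt (e n) (e n) * g (e n) z"
    "(\<And>i. i < n \<Longrightarrow> g w (e i) = 0) \<Longrightarrow> tt (e n) (e n) * g w w \<le> tt w w" for i j n z w
    by blast+
  interpret perturbed_form_eigen M h \<mu> w V A b \<xi> K e "\<lambda>n. tt (e n) (e n)"
    by unfold_locales (rule e; assumption)+
  let ?l = "\<lambda>n. tt (e n) (e n)"
  show ?thesis
    by (intro exI[of _ P] exI[of _ R] exI[of _ "\<lambda>k. ?l (k div 2)"] conjI ballI allI impI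
        X.diag_op_positive X.diag_op_square_root V_core X.diag_op_discrete X.diag_op_lists_eigenvalues
        l_top E.l_nonneg E.l_mono R_form eigenvalue_lower eigenvalue_upper) auto
qed

section \<open>Functions on the half-line\<close>

lemma space_half_line [simp]: "space (half_line_measure c) = {0<..}"
  by (simp add: half_line_measure_def space_restrict_space)

lemma measurable_half_line:
  "f \<in> borel_measurable (half_line_measure c) \<longleftrightarrow> f \<in> borel_measurable (restrict_space borel {0<..})"
proof -
  have "sets (half_line_measure c) = sets (restrict_space borel {0<..})"
    unfolding half_line_measure_def sets_density by (rule sets_restrict_space_cong) simp
  then show ?thesis by (rule arg_cong2[OF _ refl, of _ _ "\<lambda>M N. f \<in> M", OF measurable_cong_sets]) simp
qed

lemma powr_measurable_restrict: "(\<lambda>x::real. x powr p) \<in> borel_measurable (restrict_space lborel {0<..})"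
  by (rule measurable_restrict_space1) measurable

lemma integrable_half_line:
  fixes f :: "real \<Rightarrow> 'a::{banach, second_countable_topology}"
  assumes "f \<in> borel_measurable (half_line_measure c)"
  shows "integrable (half_line_measure c) f \<longleftrightarrow> set_integrable lborel {0<..} (\<lambda>x. (x powr (2 * c)) *\<^sub>R f x)"
proof -
  have m: "f \<in> borel_measurable (restrict_space lborel {0<..})"
    using assms unfolding half_line_measure_def by simp
  have "integrable (half_line_measure c) f \<longleftrightarrow> integrable (restrict_space lborel {0<..}) (\<lambda>x. (x powr (2 * c)) *\<^sub>R f x)"
    unfolding half_line_measure_def by (intro integrable_density m powr_measurable_restrict) auto
  also have "\<dots> \<longleftrightarrow> set_integrable lborel {0<..} (\<lambda>x. (x powr (2 * c)) *\<^sub>R f x)"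
    by (simp add: integrable_restrict_space set_integrable_def)
  finally show ?thesis .
qed

lemma integral_half_line:
  fixes f :: "real \<Rightarrow> 'a::{banach, second_countable_topology}"
  assumes "f \<in> borel_measurable (half_line_measure c)"
  shows "integral\<^sup>L (half_line_measure c) f = (LINT x:{0<..}|lborel. (x powr (2 * c)) *\<^sub>R f x)"
proof -
  have m: "f \<in> borel_measurable (restrict_space lborel {0<..})"
    using assms unfolding half_line_measure_def by simp
  have "integral\<^sup>L (half_line_measure c) f = integral\<^sup>L (restrict_space lborel {0<..}) (\<lambda>x. (x powr (2 * c)) *\<^sub>R f x)"
    unfolding half_line_measure_def by (intro integral_density m powr_measurable_restrict) auto
  also have "\<dots> = (LINT x:{0<..}|lborel. (x powr (2 * c)) *\<^sub>R f x)"
    by (simp add: integral_restrict_space set_lebesgue_integral_def)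
  finally show ?thesis .
qed

lemma AE_half_line: "(AE x in half_line_measure c. Q x) \<longleftrightarrow> (AE x in lborel. x > 0 \<longrightarrow> Q x)"
proof -
  have "(AE x in half_line_measure c. Q x) \<longleftrightarrow> (AE x in restrict_space lborel {0<..}. 0 < ennreal (x powr (2 * c)) \<longrightarrow> Q x)"
    unfolding half_line_measure_def
    by (rule AE_density) (use powr_measurable_restrict in measurable)
  also have "\<dots> \<longleftrightarrow> (AE x in lborel. x \<in> {0<..} \<longrightarrow> 0 < ennreal (x powr (2 * c)) \<longrightarrow> Q x)"
    by (rule AE_restrict_space_iff) simp
  also have "\<dots> \<longleftrightarrow> (AE x in lborel. x > 0 \<longrightarrow> Q x)" by (intro AE_cong) auto
  finally show ?thesis .
qed

lemma L2_half_line_cong: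
  assumes "\<And>x. x > 0 \<Longrightarrow> f x = g x"
  shows "f \<in> L2 (half_line_measure c) \<longleftrightarrow> g \<in> L2 (half_line_measure c)"
proof -
  have "f \<in> borel_measurable (half_line_measure c) \<longleftrightarrow> g \<in> borel_measurable (half_line_measure c)"
    by (rule measurable_cong) (simp add: assms)
  moreover have "integrable (half_line_measure c) (\<lambda>x. (cmod (f x))\<^sup>2) \<longleftrightarrow> integrable (half_line_measure c) (\<lambda>x. (cmod (g x))\<^sup>2)"
    by (rule Bochner_Integration.integrable_cong) (simp_all add: assms)
  ultimately show ?thesis by (simp add: L2_def)
qed

lemma L2_inner_half_line_cong:
  assumes "\<And>x. x > 0 \<Longrightarrow> f x = f' x" "\<And>x. x > 0 \<Longrightarrow> g x = g' x"
  shows "L2_inner (half_line_measure c) f g = L2_inner (half_line_measure c) f' g'"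
  unfolding L2_inner_def by (rule Bochner_Integration.integral_cong) (simp_all add: assms)

lemma L2_norm_half_line_cong:
  assumes "\<And>x. x > 0 \<Longrightarrow> f x = f' x"
  shows "L2_norm (half_line_measure c) f = L2_norm (half_line_measure c) f'"
proof -
  have "(\<integral>x. (cmod (f x))\<^sup>2 \<partial>half_line_measure c) = (\<integral>x. (cmod (f' x))\<^sup>2 \<partial>half_line_measure c)"
    by (rule Bochner_Integration.integral_cong) (simp_all add: assms)
  then show ?thesis by (simp add: L2_norm_def)
qed

text \<open>A class closed under sums and under bilinear products, where the exponents add.
  Membership with q > -1 gives integrability and with q > 0 a vanishing limit at 0, so convergence
  and boundary terms reduce to arithmetic of exponents.\<close>

definition decays :: "real \<Rightarrow> (real \<Rightarrow> 'a::real_normed_vector) \<Rightarrow> bool" where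
  "decays q f \<longleftrightarrow> continuous_on {0<..} f \<and> (\<exists>C. \<forall>x. 0 < x \<and> x \<le> 1 \<longrightarrow> norm (f x) \<le> C * x powr q) \<and>
     (\<forall>m::nat. \<exists>C. \<forall>x\<ge>1. x ^ m * norm (f x) \<le> C)"

lemma decays_continuous: "decays q f \<Longrightarrow> continuous_on {0<..} f"
  by (simp add: decays_def)

lemma decays_measurable:
  fixes f :: "real \<Rightarrow> 'a::{real_normed_vector, second_countable_topology}"
  shows "decays q f \<Longrightarrow> f \<in> borel_measurable (half_line_measure c)"
  unfolding measurable_half_line by (rule borel_measurable_continuous_on_restrict) (rule decays_continuous)

lemma decays_cong:
  assumes "\<And>x. x > 0 \<Longrightarrow> f x = g x"
  shows "decays q f \<longleftrightarrow> decays q g"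
proof -
  have "continuous_on {0<..} f \<longleftrightarrow> continuous_on {0<..} g" by (rule continuous_on_cong) (simp_all add: assms)
  moreover have "x \<ge> 1 \<Longrightarrow> f x = g x" for x using assms[of x] by simp
  ultimately show ?thesis using assms unfolding decays_def by (metis (no_types, lifting))
qed

lemma decays_add:
  assumes "decays q f" "decays q g"
  shows "decays q (\<lambda>x. f x + g x)"
proof -
  obtain C C' where C: "\<And>x. 0 < x \<Longrightarrow> x \<le> 1 \<Longrightarrow> norm (f x) \<le> C * x powr q" "\<And>x. 0 < x \<Longrightarrow> x \<le> 1 \<Longrightarrow> norm (g x) \<le> C' * x powr q"
    using assms unfolding decays_def by blast
  have "norm (f x + g x) \<le> (C + C') * x powr q" if "0 < x" "x \<le> 1" for x
    using C[OF that] norm_triangle_ineq[of "f x" "g x"] by (simp add: distrib_right)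
  moreover have "\<exists>C. \<forall>x\<ge>1. x ^ m * norm (f x + g x) \<le> C" for m
  proof -
    obtain D D' where D: "\<And>x. x \<ge> 1 \<Longrightarrow> x ^ m * norm (f x) \<le> D" "\<And>x. x \<ge> 1 \<Longrightarrow> x ^ m * norm (g x) \<le> D'"
      using assms unfolding decays_def by blast
    have "x ^ m * norm (f x + g x) \<le> D + D'" if "x \<ge> 1" for x
    proof -
      have "x ^ m * norm (f x + g x) \<le> x ^ m * (norm (f x) + norm (g x))"
        using that by (intro mult_left_mono norm_triangle_ineq) auto
      then show ?thesis using D[OF that] by (simp add: distrib_left)
    qed
    then show ?thesis by blast
  qed
  ultimately show ?thesis using assms unfolding decays_def by (blast intro: continuous_on_add)
qed

lemma decays_bilinear:
  assumes "bounded_bilinear b" "decays q f" "decays r g"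
  shows "decays (q + r) (\<lambda>x. b (f x) (g x))"
proof -
  obtain B where B: "B > 0" "\<And>x y. norm (b x y) \<le> norm x * norm y * B"
    using bounded_bilinear.pos_bounded[OF assms(1)] by blast
  obtain C C' where C: "\<And>x. 0 < x \<Longrightarrow> x \<le> 1 \<Longrightarrow> norm (f x) \<le> C * x powr q" "\<And>x. 0 < x \<Longrightarrow> x \<le> 1 \<Longrightarrow> norm (g x) \<le> C' * x powr r"
    using assms unfolding decays_def by blast
  have "norm (b (f x) (g x)) \<le> (C * C' * B) * x powr (q + r)" if "0 < x" "x \<le> 1" for x
  proof -
    have "norm (f x) * norm (g x) \<le> (C * x powr q) * (C' * x powr r)"
      using C[OF that] order_trans[OF norm_ge_zero C(1)[OF that]] by (intro mult_mono) auto
    then have "norm (f x) * norm (g x) * B \<le> (C * x powr q) * (C' * x powr r) * B"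
      using B(1) by (intro mult_right_mono) auto
    then show ?thesis using B(2)[of "f x" "g x"] by (simp add: powr_add algebra_simps)
  qed
  moreover have "\<exists>C. \<forall>x\<ge>1. x ^ m * norm (b (f x) (g x)) \<le> C" for m
  proof -
    obtain D D' where D: "\<And>x. x \<ge> 1 \<Longrightarrow> x ^ m * norm (f x) \<le> D" "\<And>x. x \<ge> 1 \<Longrightarrow> x ^ 0 * norm (g x) \<le> D'"
      using assms unfolding decays_def by meson
    have "x ^ m * norm (b (f x) (g x)) \<le> D * D' * B" if "x \<ge> 1" for x
    proof -
      have "x ^ m * norm (b (f x) (g x)) \<le> x ^ m * (norm (f x) * norm (g x) * B)"
        using that B by (intro mult_left_mono) auto
      also have "\<dots> = (x ^ m * norm (f x)) * norm (g x) * B" by simp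
      also have "\<dots> \<le> D * D' * B"
        using D[OF that] that B(1) by (intro mult_right_mono mult_mono) (auto intro: order_trans[OF _ D(1)[OF that]])
      finally show ?thesis .
    qed
    then show ?thesis by blast
  qed
  moreover have "continuous_on {0<..} (\<lambda>x. b (f x) (g x))"
    using assms by (intro bounded_bilinear.continuous_on[OF assms(1)] decays_continuous)
  ultimately show ?thesis unfolding decays_def by blast
qed

lemmas decays_mult = decays_bilinear[OF bounded_bilinear_mult]

lemma powr_le_power_ceil:
  fixes x p :: real
  assumes "x \<ge> 1"
  shows "x powr p \<le> x ^ nat \<lceil>p\<rceil>"
proof -
  have "x powr p \<le> x powr (real (nat \<lceil>p\<rceil>))" using assms by (intro powr_mono) linarith+
  then show ?thesis using assms by (simp add: powr_realpow)
qed

lemma decays_powr_scaleR: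
  assumes "decays q f"
  shows "decays (p + q) (\<lambda>x. (x powr p) *\<^sub>R f x)"
proof -
  obtain C where C: "\<And>x. 0 < x \<Longrightarrow> x \<le> 1 \<Longrightarrow> norm (f x) \<le> C * x powr q"
    using assms unfolding decays_def by blast
  have "norm ((x powr p) *\<^sub>R f x) \<le> C * x powr (p + q)" if "0 < x" "x \<le> 1" for x
    using mult_left_mono[OF C[OF that], of "x powr p"] by (simp add: powr_add algebra_simps)
  moreover have "\<exists>C. \<forall>x\<ge>1. x ^ m * norm ((x powr p) *\<^sub>R f x) \<le> C" for m
  proof -
    obtain D where D: "\<And>x. x \<ge> 1 \<Longrightarrow> x ^ (m + nat \<lceil>p\<rceil>) * norm (f x) \<le> D"
      using assms unfolding decays_def by meson
    have "x ^ m * norm ((x powr p) *\<^sub>R f x) \<le> D" if "x \<ge> 1" for x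
    proof -
      have "x ^ m * norm ((x powr p) *\<^sub>R f x) = x ^ m * norm (f x) * x powr p" by simp
      also have "\<dots> \<le> x ^ m * norm (f x) * x ^ nat \<lceil>p\<rceil>"
        using that by (intro mult_left_mono powr_le_power_ceil) auto
      also have "\<dots> \<le> D" using D[OF that] by (simp add: power_add algebra_simps)
      finally show ?thesis .
    qed
    then show ?thesis by blast
  qed
  moreover have "continuous_on {0<..} (\<lambda>x. (x powr p) *\<^sub>R f x)"
    by (intro continuous_intros decays_continuous[OF assms]) auto
  ultimately show ?thesis unfolding decays_def by blast
qed

lemma decays_norm: "decays q f \<Longrightarrow> decays q (\<lambda>x. norm (f x))"
  unfolding decays_def by (auto intro: continuous_on_norm)

lemma decays_scale:
  fixes f :: "real \<Rightarrow> 'a::real_normed_vector"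
  assumes "decays q f"
  shows "decays q (\<lambda>x. c *\<^sub>R f x)"
proof -
  obtain C where C: "\<And>x. 0 < x \<Longrightarrow> x \<le> 1 \<Longrightarrow> norm (f x) \<le> C * x powr q"
    using assms unfolding decays_def by blast
  have "norm (c *\<^sub>R f x) \<le> (\<bar>c\<bar> * C) * x powr q" if "0 < x" "x \<le> 1" for x
    using mult_left_mono[OF C[OF that], of "\<bar>c\<bar>"] by simp
  moreover have "\<exists>C. \<forall>x\<ge>1. x ^ m * norm (c *\<^sub>R f x) \<le> C" for m
  proof -
    obtain D where D: "\<And>x. x \<ge> 1 \<Longrightarrow> x ^ m * norm (f x) \<le> D" using assms unfolding decays_def by meson
    have "x ^ m * norm (c *\<^sub>R f x) \<le> \<bar>c\<bar> * D" if "x \<ge> 1" for x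
      using mult_left_mono[OF D[OF that], of "\<bar>c\<bar>"] by (simp add: mult.left_commute)
    then show ?thesis by blast
  qed
  ultimately show ?thesis using assms unfolding decays_def by (auto intro: continuous_on_scaleR continuous_on_const)
qed

lemma decays_weaken: "decays q f \<Longrightarrow> r \<le> q \<Longrightarrow> decays r f"
proof -
  assume f: "decays q f" and r: "r \<le> q"
  obtain C where C: "\<And>x. 0 < x \<Longrightarrow> x \<le> 1 \<Longrightarrow> norm (f x) \<le> C * x powr q"
    using f unfolding decays_def by blast
  have "norm (f x) \<le> \<bar>C\<bar> * x powr r" if "0 < x" "x \<le> 1" for x
  proof -
    have "C * x powr q \<le> \<bar>C\<bar> * x powr r"
      using that r powr_mono'[of r q x] by (intro mult_mono) auto
    then show ?thesis using C[OF that] by linarith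
  qed
  then show ?thesis using f unfolding decays_def by blast
qed

lemma decays_integrable:
  fixes f :: "real \<Rightarrow> 'a::euclidean_space"
  assumes f: "decays q f" and q: "q > -1"
  shows "set_integrable lborel {0<..} f"
proof -
  obtain C where C: "\<And>x. 0 < x \<Longrightarrow> x \<le> 1 \<Longrightarrow> norm (f x) \<le> C * x powr q"
    using f unfolding decays_def by blast
  obtain D where D: "\<And>x. x \<ge> 1 \<Longrightarrow> x ^ 2 * norm (f x) \<le> D" using f unfolding decays_def by meson
  have cont: "continuous_on A f" if "A \<subseteq> {0<..}" for A
    using continuous_on_subset[OF decays_continuous[OF f] that] .
  have meas: "set_borel_measurable lborel A f" if "A \<subseteq> {0<..}" "A \<in> sets borel" for A
    unfolding set_borel_measurable_def measurable_lborel2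
    using borel_measurable_continuous_on_indicator[OF that(2) cont[OF that(1)]] by simp
  have "(\<lambda>x. C * x powr q) absolutely_integrable_on {0<..1}"
    by (intro set_integrable_mult_right nonnegative_absolutely_integrable_1 integrable_on_powr_from_0' q) auto
  then have "set_integrable lebesgue {0<..1} (\<lambda>x. C * x powr q)" .
  then have "set_integrable lborel {0<..1} (\<lambda>x. C * x powr q)"
    unfolding set_integrable_def by (subst (asm) integrable_completion) auto
  then have 1: "set_integrable lborel {0<..1} f"
  proof (rule set_integrable_bound)
    show "AE x in lborel. x \<in> {0<..1} \<longrightarrow> norm (f x) \<le> norm (C * x powr q)"
    proof (intro AE_I2 impI)
      fix x :: real assume "x \<in> {0<..1}"
      then have "norm (f x) \<le> C * x powr q" using C by simp
      then show "norm (f x) \<le> norm (C * x powr q)" unfolding real_norm_def by linarith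
    qed
  qed (rule meas, auto)
  have "((\<lambda>x. x powr -2) has_integral - (1 powr (- 2 + 1)) / (- 2 + 1)) {1::real..}"
    by (rule has_integral_powr_to_inf) auto
  then have "(\<lambda>x. x powr -2) integrable_on {1::real..}" by blast
  then have "(\<lambda>x. D * x powr -2) absolutely_integrable_on {1..}"
    by (intro set_integrable_mult_right nonnegative_absolutely_integrable_1) auto
  then have "set_integrable lborel {1..} (\<lambda>x. D * x powr -2)"
    unfolding set_integrable_def by (subst (asm) integrable_completion) auto
  then have 2: "set_integrable lborel {1..} f"
  proof (rule set_integrable_bound)
    have nb: "norm (f x) \<le> D * x powr -2" if "x \<ge> 1" for x
    proof -
      have "x powr -2 = 1 / x\<^sup>2" using that by (simp add: powr_neg_numeral)
      moreover have "norm (f x) \<le> D / x\<^sup>2" using D[OF that] that by (simp add: pos_le_divide_eq mult.commute)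
      ultimately show ?thesis by simp
    qed
    then show "AE x in lborel. x \<in> {1..} \<longrightarrow> norm (f x) \<le> norm (D * x powr -2)"
    proof (intro AE_I2 impI)
      fix x :: real assume "x \<in> {1..}"
      then have "norm (f x) \<le> D * x powr -2" using nb by simp
      then show "norm (f x) \<le> norm (D * x powr -2)" unfolding real_norm_def by linarith
    qed
  qed (rule meas, auto)
  have "set_integrable lborel ({0<..1} \<union> {1..}) f" using 1 2 by (rule set_integrable_Un) auto
  moreover have "{0<..1} \<union> {1..} = {0::real<..}" by auto
  ultimately show ?thesis by simp
qed

lemma decays_at_right_0:
  assumes "decays q f" "q > 0"
  shows "(f \<longlongrightarrow> 0) (at_right (0::real))"
proof -
  obtain C where C: "\<And>x. 0 < x \<Longrightarrow> x \<le> 1 \<Longrightarrow> norm (f x) \<le> C * x powr q"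
    using assms unfolding decays_def by blast
  have id: "((\<lambda>x::real. x) \<longlongrightarrow> 0) (at_right 0)" by (rule tendsto_ident_at)
  have pos: "\<forall>\<^sub>F x in at_right (0::real). 0 < x \<and> x \<le> 1"
    unfolding eventually_at_right_field by (intro exI[of _ 1]) auto
  show ?thesis
  proof (rule Lim_null_comparison)
    show "\<forall>\<^sub>F x in at_right 0. norm (f x) \<le> C * x powr q" using pos by eventually_elim (use C in auto)
    have "((\<lambda>x::real. x powr q) \<longlongrightarrow> 0) (at_right 0)"
      by (rule tendsto_zero_powrI[OF id tendsto_const]) (use assms(2) pos in \<open>auto elim: eventually_mono\<close>)
    then show "((\<lambda>x. C * x powr q) \<longlongrightarrow> 0) (at_right 0)" by (rule tendsto_mult_right_zero)
  qed
qed

lemma decays_at_top: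
  assumes "decays q f"
  shows "(f \<longlongrightarrow> 0) at_top"
proof -
  obtain D where D: "\<And>x. x \<ge> 1 \<Longrightarrow> x ^ 1 * norm (f x) \<le> D" using assms unfolding decays_def by meson
  show ?thesis
  proof (rule Lim_null_comparison)
    show "\<forall>\<^sub>F x in at_top. norm (f x) \<le> D / x"
      using eventually_ge_at_top[of "1::real"] by eventually_elim (use D in \<open>auto simp: field_simps\<close>)
    show "((\<lambda>x. D / x) \<longlongrightarrow> 0) at_top" by (rule tendsto_divide_0[OF tendsto_const filterlim_at_top_imp_at_infinity[OF filterlim_ident]])
  qed
qed

text \<open>The only form in which integration by parts is used: the exponent of \<open>G\<close>
  removes the boundary term at 0, rapid decay the one at infinity.\<close>

lemma integral_derivative_zero:
  fixes G G' :: "real \<Rightarrow> 'a::euclidean_space"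
  assumes G: "decays q G" "q > 0" and G': "decays r G'" "r > -1"
    and der: "\<And>x. x > 0 \<Longrightarrow> (G has_vector_derivative G' x) (at x)"
  shows "(LINT x:{0<..}|lborel. G' x) = 0"
proof -
  have ein: "einterval 0 \<infinity> = {0::real<..}" by (auto simp: einterval_def)
  have "(LBINT x=0..\<infinity>. G' x) = 0 - 0"
  proof (rule interval_integral_FTC_integrable)
    show "(G has_vector_derivative G' x) (at x)" if "0 < ereal x" for x using der that by simp
    show "isCont G' x" if "0 < ereal x" for x
      using decays_continuous[OF G'(1)] that by (simp add: continuous_on_eq_continuous_at)
    show "set_integrable lborel (einterval 0 \<infinity>) G'" unfolding ein by (rule decays_integrable[OF G'])
    show "((G \<circ> real_of_ereal) \<longlongrightarrow> 0) (at_right 0)"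
      using decays_at_right_0[OF G] by (simp add: ereal_tendsto_simps zero_ereal_def)
    show "((G \<circ> real_of_ereal) \<longlongrightarrow> 0) (at_left \<infinity>)"
      using decays_at_top[OF G(1)] by (simp add: ereal_tendsto_simps)
  qed simp
  then show ?thesis by (simp add: interval_lebesgue_integral_def ein zero_ereal_def)
qed

lemma decays_L2:
  fixes f :: "real \<Rightarrow> complex"
  assumes f: "decays q f" and q: "2 * q + 2 * c > -1"
  shows "f \<in> L2 (half_line_measure c)"
proof (rule L2_I)
  show "f \<in> borel_measurable (half_line_measure c)" by (rule decays_measurable[OF f])
  have n2: "decays (q + q) (\<lambda>x. (cmod (f x))\<^sup>2)"
    unfolding power2_eq_square by (intro decays_mult decays_norm f)
  have "set_integrable lborel {0<..} (\<lambda>x. (x powr (2 * c)) *\<^sub>R (cmod (f x))\<^sup>2)"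
    by (rule decays_integrable[OF decays_powr_scaleR[OF n2]]) (use q in simp)
  then show "integrable (half_line_measure c) (\<lambda>x. (cmod (f x))\<^sup>2)"
    by (subst integrable_half_line) (auto intro: decays_measurable[OF n2])
qed

section \<open>Gaussian moments determine a function\<close>

lemma exp_partial_sum_le: "\<bar>\<Sum>j<J. x ^ j / fact j\<bar> \<le> exp \<bar>x :: real\<bar>"
proof -
  have s: "(\<lambda>j. \<bar>x\<bar> ^ j / fact j) sums exp \<bar>x\<bar>"
    using exp_converges[of "\<bar>x\<bar>"] by (simp add: divide_inverse mult.commute)
  have "\<bar>\<Sum>j<J. x ^ j / fact j\<bar> \<le> (\<Sum>j<J. \<bar>x ^ j / fact j\<bar>)" by (rule sum_abs)
  also have "\<dots> = (\<Sum>j<J. \<bar>x\<bar> ^ j / fact j)" by (simp add: power_abs)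
  also have "\<dots> \<le> exp \<bar>x\<bar>"
    using sum_le_suminf[OF sums_summable[OF s], of "{..<J}"] sums_unique[OF s] by simp
  finally show ?thesis .
qed

text \<open>Integrability is required for every t > 0 because the argument varies the width of the
  Gaussian. Even powers are those that occur in the Laguerre functions.\<close>

locale gaussian_integrable =
  fixes F :: "real \<Rightarrow> complex"
  assumes int: "t > 0 \<Longrightarrow> integrable lborel (\<lambda>x. (x ^ (2 * k) * exp (- t * x\<^sup>2)) *\<^sub>R F x)"
begin

definition moment :: "real \<Rightarrow> nat \<Rightarrow> complex" where
  "moment t k = (\<integral>x. (x ^ (2 * k) * exp (- t * x\<^sup>2)) *\<^sub>R F x \<partial>lborel)"

text \<open>Expanding \<open>exp ((t0 - t) x\<^sup>2)\<close> into its power series is allowed as long as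
  \<open>\<bar>t0 - t\<bar> < t0\<close>, because the partial sums are then dominated.\<close>

lemma moment_shift:
  assumes zero: "\<And>k. moment t0 k = 0" and t: "0 < t" "t < 2 * t0"
  shows "moment t k = 0"
proof -
  define z where "z = t0 - t"
  have z: "\<bar>z\<bar> < t0" using t by (auto simp: z_def)
  have t0: "t0 > 0" using t by linarith
  define f where "f J x = (x ^ (2 * k) * exp (- t0 * x\<^sup>2) * (\<Sum>j<J. (z * x\<^sup>2) ^ j / fact j)) *\<^sub>R F x" for J x
  have f_eq: "f J x = (\<Sum>j<J. (z ^ j / fact j) *\<^sub>R ((x ^ (2 * (k + j)) * exp (- t0 * x\<^sup>2)) *\<^sub>R F x))" for J x
    unfolding f_def sum_distrib_left scaleR_sum_left
    by (intro sum.cong refl) (simp add: power_mult_distrib power_add power_mult[symmetric] distrib_left)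
  have fi: "integrable lborel (f J)" for J
    unfolding f_eq[abs_def] by (intro Bochner_Integration.integrable_sum integrable_scaleR_right int t0)
  have f0: "integral\<^sup>L lborel (f J) = 0" for J
  proof -
    let ?h = "\<lambda>j x. (z ^ j / fact j) *\<^sub>R ((x ^ (2 * (k + j)) * exp (- t0 * x\<^sup>2)) *\<^sub>R F x)"
    have "integral\<^sup>L lborel (f J) = (\<Sum>j<J. integral\<^sup>L lborel (?h j))"
      unfolding f_eq[abs_def]
      by (rule Bochner_Integration.integral_sum) (intro integrable_scaleR_right int t0)
    also have "\<dots> = (\<Sum>j<J. (z ^ j / fact j) *\<^sub>R moment t0 (k + j))"
      by (simp only: moment_def integral_scaleR_right)
    finally have "integral\<^sup>L lborel (f J) = (\<Sum>j<J. (z ^ j / fact j) *\<^sub>R moment t0 (k + j))" .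
    then show ?thesis by (simp add: zero)
  qed
  have "(\<lambda>J. integral\<^sup>L lborel (f J)) \<longlonglongrightarrow> moment t k"
    unfolding moment_def
  proof (rule integral_dominated_convergence)
    show "integrable lborel (\<lambda>x. norm ((x ^ (2 * k) * exp (- (t0 - \<bar>z\<bar>) * x\<^sup>2)) *\<^sub>R F x))"
      by (intro integrable_norm int) (use z in simp)
    show "(\<lambda>x. (x ^ (2 * k) * exp (- t * x\<^sup>2)) *\<^sub>R F x) \<in> borel_measurable lborel"
      using int[OF t(1)] by (rule borel_measurable_integrable)
    show "f J \<in> borel_measurable lborel" for J using fi by (rule borel_measurable_integrable)
    show "AE x in lborel. (\<lambda>J. f J x) \<longlonglongrightarrow> (x ^ (2 * k) * exp (- t * x\<^sup>2)) *\<^sub>R F x"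
    proof (rule AE_I2)
      fix x :: real
      have "(\<lambda>J. \<Sum>j<J. (z * x\<^sup>2) ^ j / fact j) \<longlonglongrightarrow> exp (z * x\<^sup>2)"
        using exp_converges[of "z * x\<^sup>2"] unfolding sums_def by (simp add: divide_inverse mult.commute)
      then have "(\<lambda>J. f J x) \<longlonglongrightarrow> (x ^ (2 * k) * exp (- t0 * x\<^sup>2) * exp (z * x\<^sup>2)) *\<^sub>R F x"
        unfolding f_def by (intro tendsto_intros)
      also have "x ^ (2 * k) * exp (- t0 * x\<^sup>2) * exp (z * x\<^sup>2) = x ^ (2 * k) * exp (- t * x\<^sup>2)"
        by (simp add: z_def algebra_simps flip: exp_add)
      finally show "(\<lambda>J. f J x) \<longlonglongrightarrow> (x ^ (2 * k) * exp (- t * x\<^sup>2)) *\<^sub>R F x" .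
    qed
    show "AE x in lborel. norm (f J x) \<le> norm ((x ^ (2 * k) * exp (- (t0 - \<bar>z\<bar>) * x\<^sup>2)) *\<^sub>R F x)" for J
    proof (rule AE_I2)
      fix x :: real
      have "\<bar>\<Sum>j<J. (z * x\<^sup>2) ^ j / fact j\<bar> \<le> exp (\<bar>z\<bar> * x\<^sup>2)"
        using exp_partial_sum_le[where x = "z * x\<^sup>2"] by (simp add: abs_mult)
      then have "\<bar>x ^ (2 * k)\<bar> * exp (- t0 * x\<^sup>2) * \<bar>\<Sum>j<J. (z * x\<^sup>2) ^ j / fact j\<bar> * norm (F x)
          \<le> \<bar>x ^ (2 * k)\<bar> * exp (- t0 * x\<^sup>2) * exp (\<bar>z\<bar> * x\<^sup>2) * norm (F x)"
        by (intro mult_left_mono mult_right_mono) auto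
      also have "\<dots> = \<bar>x ^ (2 * k)\<bar> * (exp (- t0 * x\<^sup>2) * exp (\<bar>z\<bar> * x\<^sup>2)) * norm (F x)"
        by (simp only: mult.assoc)
      also have "exp (- t0 * x\<^sup>2) * exp (\<bar>z\<bar> * x\<^sup>2) = exp (- (t0 - \<bar>z\<bar>) * x\<^sup>2)"
        by (simp add: algebra_simps flip: exp_add)
      finally show "norm (f J x) \<le> norm ((x ^ (2 * k) * exp (- (t0 - \<bar>z\<bar>) * x\<^sup>2)) *\<^sub>R F x)"
        by (simp only: f_def norm_scaleR abs_mult abs_exp_cancel)
    qed
  qed
  then show ?thesis by (simp add: f0 LIMSEQ_const_iff)
qed

text \<open>One shift reaches every width parameter below 2 \<open>t0\<close>. Iterating with the
  factor 3/2 makes the starting value as large as desired, and a last shift comes down to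
  \<open>t\<close>.\<close>

lemma moment_all:
  assumes zero: "\<And>k. moment t0 k = 0" and t0: "t0 > 0" and t: "t > 0"
  shows "moment t k = 0"
proof -
  have *: "moment (t0 * (3 / 2) ^ i) k = 0" for i k
  proof (induction i arbitrary: k)
    case (Suc i)
    show ?case by (rule moment_shift[OF Suc]) (use t0 in auto)
  qed (simp add: zero)
  obtain i where "t / t0 < (3 / 2) ^ i" using real_arch_pow[of "3 / 2" "t / t0"] by auto
  then have "t < (3 / 2) ^ i * t0" using t0 by (simp only: pos_divide_less_eq)
  moreover have "0 < (3 / 2) ^ i * t0" using t0 by simp
  ultimately have "t < 2 * ((3 / 2) ^ i * t0)" by linarith
  then have "t < 2 * (t0 * (3 / 2) ^ i)" by (simp only: mult.commute[of t0])
  then show ?thesis by (rule moment_shift[OF * t])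
qed

text \<open>At t = n + 1 and k = 0 the moments are integrals of the n-th powers of v = exp(-x^2)
  against an integrable function. Hence all polynomials in v integrate to 0, and by the Weierstrass
  theorem all continuous functions of v.\<close>

lemma gaussian_test:
  assumes zero: "\<And>k. moment t0 k = 0" and t0: "t0 > 0" and q: "continuous_on {0..1} q"
  shows "(\<integral>x. q (exp (- x\<^sup>2)) *\<^sub>R (exp (- x\<^sup>2) *\<^sub>R F x) \<partial>lborel) = 0"
proof -
  define G where "G x = exp (- x\<^sup>2) *\<^sub>R F x" for x
  have G: "integrable lborel G" using int[of 1 0] by (simp add: G_def[abs_def])
  have y: "exp (- x\<^sup>2) \<in> {0..1}" for x :: real by simp
  have pw: "(exp (- x\<^sup>2) ^ n) *\<^sub>R G x = (x ^ (2 * 0) * exp (- real (Suc n) * x\<^sup>2)) *\<^sub>R F x" for n x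
    by (simp add: G_def algebra_simps flip: exp_of_nat_mult exp_add)
  have pi: "integrable lborel (\<lambda>x. (exp (- x\<^sup>2) ^ n) *\<^sub>R G x)" for n
    unfolding pw by (rule int) simp
  have p0: "(\<integral>x. (exp (- x\<^sup>2) ^ n) *\<^sub>R G x \<partial>lborel) = 0" for n
    unfolding pw using moment_all[OF zero t0, of "real (Suc n)" 0] by (simp add: moment_def)
  have qi: "integrable lborel (\<lambda>x. r (exp (- x\<^sup>2)) *\<^sub>R G x)" if r: "continuous_on {0..1} r" for r :: "real \<Rightarrow> real"
  proof -
    obtain B where B: "\<forall>v\<in>{0..1}. norm (r v) \<le> B"
      using compact_imp_bounded[OF compact_continuous_image[OF r compact_Icc]] by (auto simp: bounded_iff)
    have "continuous_on UNIV (\<lambda>x::real. r (exp (- x\<^sup>2)))"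
      by (rule continuous_on_compose2[OF r]) (auto intro!: continuous_intros)
    then have [measurable]: "(\<lambda>x. r (exp (- x\<^sup>2))) \<in> borel_measurable borel" by (rule borel_measurable_continuous_onI)
    show ?thesis
    proof (rule Bochner_Integration.integrable_bound)
      show "integrable lborel (\<lambda>x. B *\<^sub>R G x)" by (rule integrable_scaleR_right[OF G])
      show "(\<lambda>x. r (exp (- x\<^sup>2)) *\<^sub>R G x) \<in> borel_measurable lborel"
        using borel_measurable_integrable[OF G] by measurable
      show "AE x in lborel. norm (r (exp (- x\<^sup>2)) *\<^sub>R G x) \<le> norm (B *\<^sub>R G x)"
      proof (rule AE_I2)
        fix x :: real
        have "\<bar>r (exp (- x\<^sup>2))\<bar> \<le> \<bar>B\<bar>" using bspec[OF B y[of x]] by simp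
        then show "norm (r (exp (- x\<^sup>2)) *\<^sub>R G x) \<le> norm (B *\<^sub>R G x)" by (simp add: mult_right_mono)
      qed
    qed
  qed
  define I where "I = (\<integral>x. norm (G x) \<partial>lborel)"
  have I: "I \<ge> 0" by (simp add: I_def)
  have bound: "norm (\<integral>x. q (exp (- x\<^sup>2)) *\<^sub>R G x \<partial>lborel) \<le> e * I" if e: "e > 0" for e
  proof -
    obtain p where p: "real_polynomial_function p" "\<And>v. v \<in> {0..1} \<Longrightarrow> \<bar>q v - p v\<bar> < e"
      using Stone_Weierstrass_real_polynomial_function[OF compact_Icc q e] by blast
    obtain a n where a: "p = (\<lambda>v. \<Sum>i\<le>n. a i * v ^ i)" using p(1) real_polynomial_function_iff_sum by blast
    have pc: "continuous_on {0..1} p" unfolding a by (intro continuous_intros)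
    have "(\<integral>x. p (exp (- x\<^sup>2)) *\<^sub>R G x \<partial>lborel) = (\<integral>x. (\<Sum>i\<le>n. a i *\<^sub>R ((exp (- x\<^sup>2) ^ i) *\<^sub>R G x)) \<partial>lborel)"
      unfolding a by (simp add: scaleR_sum_left)
    also have "\<dots> = (\<Sum>i\<le>n. \<integral>x. a i *\<^sub>R ((exp (- x\<^sup>2) ^ i) *\<^sub>R G x) \<partial>lborel)"
      by (rule Bochner_Integration.integral_sum) (intro integrable_scaleR_right pi)
    also have "\<dots> = 0" by (simp only: integral_scaleR_right p0) simp
    finally have "(\<integral>x. q (exp (- x\<^sup>2)) *\<^sub>R G x \<partial>lborel) = (\<integral>x. (q (exp (- x\<^sup>2)) *\<^sub>R G x - p (exp (- x\<^sup>2)) *\<^sub>R G x) \<partial>lborel)"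
      using qi[OF q] qi[OF pc] by simp
    also have "norm \<dots> \<le> (\<integral>x. e * norm (G x) \<partial>lborel)"
    proof (rule Bochner_Integration.integral_norm_bound_integral)
      show "integrable lborel (\<lambda>x. q (exp (- x\<^sup>2)) *\<^sub>R G x - p (exp (- x\<^sup>2)) *\<^sub>R G x)"
        using qi[OF q] qi[OF pc] by simp
      show "integrable lborel (\<lambda>x. e * norm (G x))" using G by simp
      fix x :: real
      have "\<bar>q (exp (- x\<^sup>2)) - p (exp (- x\<^sup>2))\<bar> \<le> e" using p(2)[OF y[of x]] by simp
      then have "norm ((q (exp (- x\<^sup>2)) - p (exp (- x\<^sup>2))) *\<^sub>R G x) \<le> e * norm (G x)" by (simp add: mult_right_mono)
      then show "norm (q (exp (- x\<^sup>2)) *\<^sub>R G x - p (exp (- x\<^sup>2)) *\<^sub>R G x) \<le> e * norm (G x)"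
        by (simp add: scaleR_diff_left)
    qed
    also have "\<dots> = e * I" by (simp add: I_def)
    finally show ?thesis .
  qed
  have "norm (\<integral>x. q (exp (- x\<^sup>2)) *\<^sub>R G x \<partial>lborel) \<le> 0"
  proof (rule field_le_epsilon)
    fix d :: real assume "d > 0"
    have "d / (I + 1) * I \<le> d" using I \<open>d > 0\<close> by (simp add: field_simps)
    then show "norm (\<integral>x. q (exp (- x\<^sup>2)) *\<^sub>R G x \<partial>lborel) \<le> 0 + d"
      using bound[of "d / (I + 1)"] I \<open>d > 0\<close> by simp
  qed
  then show ?thesis by (simp add: G_def)
qed

theorem moments_determine:
  assumes zero: "\<And>k. moment t0 k = 0" and t0: "t0 > 0" and half: "\<And>x. x \<le> 0 \<Longrightarrow> F x = 0"
  shows "AE x in lborel. F x = 0"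
proof -
  define G where "G x = exp (- x\<^sup>2) *\<^sub>R F x" for x
  have G: "integrable lborel G" using int[of 1 0] by (simp add: G_def[abs_def])
  have [measurable]: "G \<in> borel_measurable borel" using borel_measurable_integrable[OF G] by simp
  have ray: "set_lebesgue_integral lborel {a<..} G = 0" for a
  proof -
    \<comment> \<open>For x > 0 the condition x > a becomes exp(-x^2) < c. For negative a it always
      holds, and 2 exceeds every value of the Gaussian.\<close>
    define c where "c = (if a < 0 then 2 else exp (- a\<^sup>2))"
    \<comment> \<open>Continuous ramps that increase to the indicator of v < c. As exp(-x^2) does
      not separate x from -x, the hypothesis \<open>half\<close> takes care of the negative
      axis.\<close>
    define q where "q m v = min 1 (max 0 (real m * (c - v)))" for m v
    have "(\<lambda>m. \<integral>x. q m (exp (- x\<^sup>2)) *\<^sub>R G x \<partial>lborel) \<longlonglongrightarrow> (\<integral>x. indicator {a<..} x *\<^sub>R G x \<partial>lborel)"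
    proof (rule integral_dominated_convergence)
      show "integrable lborel (\<lambda>x. norm (G x))" using G by simp
      show "(\<lambda>x. indicator {a<..} x *\<^sub>R G x) \<in> borel_measurable lborel" by measurable
      show "(\<lambda>x. q m (exp (- x\<^sup>2)) *\<^sub>R G x) \<in> borel_measurable lborel" for m unfolding q_def by measurable
      show "AE x in lborel. norm (q m (exp (- x\<^sup>2)) *\<^sub>R G x) \<le> norm (G x)" for m
      proof (rule AE_I2)
        fix x :: real
        have "\<bar>q m (exp (- x\<^sup>2))\<bar> \<le> 1" by (simp add: q_def)
        from mult_right_mono[OF this norm_ge_zero[of "G x"]]
        show "norm (q m (exp (- x\<^sup>2)) *\<^sub>R G x) \<le> norm (G x)" by simp
      qed
      show "AE x in lborel. (\<lambda>m. q m (exp (- x\<^sup>2)) *\<^sub>R G x) \<longlonglongrightarrow> indicator {a<..} x *\<^sub>R G x"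
      proof (rule AE_I2)
        fix x :: real
        consider "x \<le> 0" | "x > 0" "x > a" | "x > 0" "x \<le> a" by linarith
        then show "(\<lambda>m. q m (exp (- x\<^sup>2)) *\<^sub>R G x) \<longlonglongrightarrow> indicator {a<..} x *\<^sub>R G x"
        proof cases
          case 1
          then show ?thesis using half by (simp add: G_def)
        next
          case 2
          have "exp (- x\<^sup>2) < c"
          proof (cases "a < 0")
            case True
            have "exp (- x\<^sup>2) < 2" by (rule le_less_trans[of _ 1]) auto
            then show ?thesis using True by (simp add: c_def)
          next
            case False
            then show ?thesis using 2 by (simp add: c_def power_strict_mono)
          qed
          then obtain m0 where m0: "1 / (c - exp (- x\<^sup>2)) < real m0" using reals_Archimedean2 by blast
          have "q m (exp (- x\<^sup>2)) = 1" if "m \<ge> m0" for m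
          proof -
            have "1 / (c - exp (- x\<^sup>2)) < real m" using m0 that by linarith
            then have "1 \<le> real m * (c - exp (- x\<^sup>2))" using \<open>exp (- x\<^sup>2) < c\<close> by (simp add: field_simps)
            then show ?thesis by (simp add: q_def)
          qed
          then have "\<forall>\<^sub>F m in sequentially. q m (exp (- x\<^sup>2)) *\<^sub>R G x = indicator {a<..} x *\<^sub>R G x"
            using 2 by (intro eventually_sequentiallyI[of m0]) simp
          then show ?thesis by (rule tendsto_eventually)
        next
          case 3
          then have "c \<le> exp (- x\<^sup>2)" by (simp add: c_def power_mono)
          then have "q m (exp (- x\<^sup>2)) = 0" for m using mult_nonneg_nonpos[of "real m" "c - exp (- x\<^sup>2)"] by (simp add: q_def)
          then show ?thesis using 3 by simp
        qed
      qed
    qed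
    moreover have "(\<integral>x. q m (exp (- x\<^sup>2)) *\<^sub>R G x \<partial>lborel) = 0" for m
      unfolding G_def by (rule gaussian_test[OF zero t0]) (auto simp: q_def intro!: continuous_intros)
    ultimately show ?thesis by (simp add: set_lebesgue_integral_def LIMSEQ_const_iff)
  qed
  have total: "integral\<^sup>L lborel G = 0"
  proof -
    have "integral\<^sup>L lborel G = set_lebesgue_integral lborel {-1<..} G"
      unfolding set_lebesgue_integral_def
    proof (intro Bochner_Integration.integral_cong refl)
      show "G x = indicat_real {-1<..} x *\<^sub>R G x" for x
        using half[of x] by (cases "x \<le> 0") (auto simp: G_def)
    qed
    then show ?thesis by (simp add: ray)
  qed
  \<comment> \<open>The rays are closed under intersection and generate the Borel sets; complements
    are handled by \<open>total\<close>.\<close>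
  have all: "set_lebesgue_integral lborel A G = 0" if "A \<in> sets lborel" for A
  proof -
    have setI: "set_integrable lborel B G" if "B \<in> sets lborel" for B
      unfolding set_integrable_def by (intro integrable_mult_indicator that G)
    have "{a<..} \<inter> {b<..} = {max a b<..}" for a b :: real by auto
    then have "Int_stable (range (\<lambda>a::real. {a<..}))" by (auto simp: Int_stable_def)
    moreover have "range (\<lambda>a::real. {a<..}) \<subseteq> Pow UNIV" by simp
    moreover have "A \<in> sigma_sets UNIV (range (\<lambda>a::real. {a<..}))" using that by (simp add: borel_Ioi)
    ultimately show ?thesis
    proof (induction rule: sigma_sets_induct_disjoint)
      case (basic A)
      then show ?case using ray by auto
    next
      case empty
      show ?case by (simp add: set_lebesgue_integral_def)
    next
      case (compl A)
      then have A: "A \<in> sets lborel" by (simp add: borel_Ioi)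
      have "set_lebesgue_integral lborel (A \<union> (UNIV - A)) G = set_lebesgue_integral lborel A G + set_lebesgue_integral lborel (UNIV - A) G"
        using A by (intro set_integral_Un setI) auto
      moreover have "A \<union> (UNIV - A) = UNIV" by auto
      ultimately show ?case using compl total by (simp add: set_lebesgue_integral_def)
    next
      case (union A)
      then have A: "A i \<in> sets lborel" for i by (auto simp: borel_Ioi)
      have "set_lebesgue_integral lborel (\<Union>i. A i) G = (\<Sum>i. set_lebesgue_integral lborel (A i) G)"
        using union(1) A by (intro lebesgue_integral_countable_add setI) (auto simp: disjoint_family_on_def)
      then show ?case using union by simp
    qed
  qed
  have "AE x in lborel. G x = 0" by (rule sigma_finite_measure.density_zero[OF sigma_finite_lborel G all])
  then show ?thesis by (simp add: G_def)
qed

end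

section \<open>Even Schwartz functions\<close>

lemma schwartz_has_vderiv: "f \<in> schwartz \<Longrightarrow> (f has_vector_derivative vderiv f x) (at x)"
proof -
  assume "f \<in> schwartz"
  then have "(vderiv ^^ 0) f differentiable at x" unfolding schwartz_def by blast
  then show ?thesis by (simp add: vderiv_def vector_derivative_works)
qed

lemma vderiv_eqI: "(f has_vector_derivative f') (at x) \<Longrightarrow> vderiv f x = f'"
  by (simp add: vderiv_def vector_derivative_at)

lemma schwartz_vderiv: "f \<in> schwartz \<Longrightarrow> vderiv f \<in> schwartz"
proof -
  assume f: "f \<in> schwartz"
  have "(vderiv ^^ n) (vderiv f) = (vderiv ^^ Suc n) f" for n by (simp add: funpow_swap1)
  with f show ?thesis unfolding schwartz_def by (simp del: funpow.simps)
qed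

lemma schwartz_continuous: "f \<in> schwartz \<Longrightarrow> continuous_on A f"
  by (meson continuous_at_imp_continuous_on has_vector_derivative_continuous schwartz_has_vderiv)

lemma schwartz_rapid:
  assumes "f \<in> schwartz"
  obtains C where "\<And>x. \<bar>x\<bar> ^ m * norm (f x) \<le> C"
proof -
  have "bounded (range (\<lambda>x. x ^ m *\<^sub>R (vderiv ^^ 0) f x))" using assms unfolding schwartz_def by blast
  then obtain C where "\<And>x. norm (x ^ m *\<^sub>R f x) \<le> C" by (auto simp: bounded_iff)
  then have "\<bar>x\<bar> ^ m * norm (f x) \<le> C" for x by (simp add: power_abs)
  then show ?thesis by (rule that)
qed

lemma schwartz_decays: "f \<in> schwartz \<Longrightarrow> decays 0 f"
  unfolding decays_def
proof (intro conjI allI)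
  assume f: "f \<in> schwartz"
  show "continuous_on {0<..} f" by (rule schwartz_continuous[OF f])
  obtain C where "\<And>x. \<bar>x\<bar> ^ 0 * norm (f x) \<le> C" by (rule schwartz_rapid[OF f, of 0]) blast
  then show "\<exists>C. \<forall>x. 0 < x \<and> x \<le> 1 \<longrightarrow> norm (f x) \<le> C * x powr 0" by (intro exI[of _ C]) simp
  fix m :: nat
  obtain C where "\<And>x. \<bar>x\<bar> ^ m * norm (f x) \<le> C" by (rule schwartz_rapid[OF f, of m]) blast
  then show "\<exists>C. \<forall>x\<ge>1. x ^ m * norm (f x) \<le> C" by (intro exI[of _ C]) (metis abs_of_nonneg order_trans zero_le_one)
qed

text \<open>The derivative of an even function vanishes at 0, and the second derivative is bounded,
  so the mean value inequality gives order x at 0. This keeps the singular term f'/x bounded and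
  makes the boundary term of \<open>inner_energy\<close> vanish.\<close>

lemma even_vderiv_decays:
  assumes f: "f \<in> schwartz" and ev: "\<And>x. f (- x) = f x"
  shows "decays 1 (vderiv f)"
proof -
  have f': "vderiv f \<in> schwartz" by (rule schwartz_vderiv[OF f])
  have "vderiv f 0 = - vderiv f 0"
  proof -
    have "((\<lambda>x. f (- x)) has_vector_derivative - vderiv f 0) (at 0)"
      using vector_diff_chain_at[of "\<lambda>x. - x" "-1" 0 f "vderiv f 0"] schwartz_has_vderiv[OF f, of 0]
        has_vector_derivative_minus[OF has_vector_derivative_id, of "at (0::real)"]
      by (simp add: o_def)
    then have "(f has_vector_derivative - vderiv f 0) (at 0)" by (simp add: ev)
    then show ?thesis by (rule vderiv_eqI)
  qed
  then have zero: "vderiv f 0 = 0" by simp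
  obtain C where C: "\<And>x. \<bar>x\<bar> ^ 0 * norm (vderiv (vderiv f) x) \<le> C" by (rule schwartz_rapid[OF schwartz_vderiv[OF f'], of 0]) blast
  have "norm (vderiv f x) \<le> C * x powr 1" if x: "0 < x" for x
  proof -
    have "norm (vderiv f x - vderiv f 0) \<le> C * norm (x - 0)"
    proof (rule differentiable_bound[OF convex_UNIV])
      show "(vderiv f has_derivative (\<lambda>h. h *\<^sub>R vderiv (vderiv f) y)) (at y within UNIV)" for y
        using schwartz_has_vderiv[OF f', of y] by (simp add: has_vector_derivative_def)
      show "onorm (\<lambda>h. h *\<^sub>R vderiv (vderiv f) y) \<le> C" for y
      proof (rule onorm_le)
        show "norm (h *\<^sub>R vderiv (vderiv f) y) \<le> C * norm h" for h
          using mult_right_mono[OF C[of y], of "norm h"] by (simp add: mult.commute)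
      qed
    qed auto
    then show ?thesis using x by (simp add: zero)
  qed
  then show ?thesis using schwartz_decays[OF f'] unfolding decays_def by blast
qed

lemma vderiv_iter_linear:
  assumes "f \<in> schwartz" "g \<in> schwartz"
  shows "(vderiv ^^ n) (\<lambda>x. c * f x + d * g x) = (\<lambda>x. c * (vderiv ^^ n) f x + d * (vderiv ^^ n) g x)"
proof (induction n)
  case (Suc n)
  have it: "(vderiv ^^ n) u \<in> schwartz" if "u \<in> schwartz" for u
    by (induction n) (auto intro: that schwartz_vderiv)
  have "vderiv (\<lambda>x. c * (vderiv ^^ n) f x + d * (vderiv ^^ n) g x) x
      = c * vderiv ((vderiv ^^ n) f) x + d * vderiv ((vderiv ^^ n) g) x" for x
    by (intro vderiv_eqI derivative_intros schwartz_has_vderiv it assms)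
  then show ?case by (simp add: Suc)
qed simp

lemma schwartz_linear:
  assumes f: "f \<in> schwartz" and g: "g \<in> schwartz"
  shows "(\<lambda>x. c * f x + d * g x) \<in> schwartz"
  unfolding schwartz_def mem_Collect_eq vderiv_iter_linear[OF f g]
proof (intro allI conjI)
  fix n x
  show "(\<lambda>x. c * (vderiv ^^ n) f x + d * (vderiv ^^ n) g x) differentiable at x"
    using f g unfolding schwartz_def by (intro derivative_intros) auto
  fix m
  have b: "bounded (range (\<lambda>x. x ^ m *\<^sub>R (vderiv ^^ n) u x))" if "u \<in> schwartz" for u
    using that unfolding schwartz_def by blast
  obtain A B where A: "\<And>x. norm (x ^ m *\<^sub>R (vderiv ^^ n) f x) \<le> A" and B: "\<And>x. norm (x ^ m *\<^sub>R (vderiv ^^ n) g x) \<le> B"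
    using b[OF f] b[OF g] by (auto simp: bounded_iff)
  have "norm (x ^ m *\<^sub>R (c * (vderiv ^^ n) f x + d * (vderiv ^^ n) g x)) \<le> norm c * A + norm d * B" for x
  proof -
    have "x ^ m *\<^sub>R (c * (vderiv ^^ n) f x + d * (vderiv ^^ n) g x)
        = c * (x ^ m *\<^sub>R (vderiv ^^ n) f x) + d * (x ^ m *\<^sub>R (vderiv ^^ n) g x)"
      by (simp add: scaleR_add_right)
    also have "norm \<dots> \<le> norm c * norm (x ^ m *\<^sub>R (vderiv ^^ n) f x) + norm d * norm (x ^ m *\<^sub>R (vderiv ^^ n) g x)"
      by (rule order_trans[OF norm_triangle_ineq]) (simp add: norm_mult)
    also have "\<dots> \<le> norm c * A + norm d * B" by (intro add_mono mult_left_mono A B) auto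
    finally show ?thesis .
  qed
  then show "bounded (range (\<lambda>x. x ^ m *\<^sub>R (c * (vderiv ^^ n) f x + d * (vderiv ^^ n) g x)))"
    by (auto simp: bounded_iff)
qed

section \<open>Polynomials times Gaussians\<close>

definition gauss_poly :: "real \<Rightarrow> real poly \<Rightarrow> real \<Rightarrow> complex" where
  "gauss_poly s p x = complex_of_real (poly p x * exp (- s * x\<^sup>2 / 2))"

lemma power_fact_le_exp:
  fixes x :: real
  assumes "x \<ge> 0"
  shows "x ^ k / fact k \<le> exp x"
proof -
  have s: "(\<lambda>j. x ^ j / fact j) sums exp x"
    using exp_converges[of x] by (simp add: divide_inverse mult.commute)
  have "(\<Sum>j\<in>{k}. x ^ j / fact j) \<le> (\<Sum>j. x ^ j / fact j)"
    by (rule sum_le_suminf[OF sums_summable[OF s]]) (use assms in auto)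
  also have "\<dots> = exp x" by (rule sums_unique[OF s, symmetric])
  finally show ?thesis by simp
qed

text \<open>Induction on the polynomial with the exponent \<open>k\<close> free: splitting off the
  constant coefficient leaves a pure power, and raises \<open>k\<close> by one in the rest.\<close>

lemma gauss_poly_bounded:
  fixes s :: real and p :: "real poly"
  assumes s: "s > 0"
  shows "\<exists>C. \<forall>x. \<bar>x ^ k * poly p x * exp (- s * x\<^sup>2 / 2)\<bar> \<le> C"
proof (induction p arbitrary: k)
  case 0
  show ?case by (rule exI[of _ 0]) simp
next
  case (pCons a p)
  obtain C where C: "\<And>x. \<bar>x ^ Suc k * poly p x * exp (- s * x\<^sup>2 / 2)\<bar> \<le> C" using pCons.IH by blast
  \<comment> \<open>From y^k / k! \<le> exp y at y = s x^2 / 2, after |x|^k has been bounded by 1 +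
    x^(2k).\<close>
  define D where "D = 1 + fact k / (s / 2) ^ k"
  have D: "\<bar>x\<bar> ^ k * exp (- s * x\<^sup>2 / 2) \<le> D" for x
  proof -
    have "(s * x\<^sup>2 / 2) ^ k / fact k \<le> exp (s * x\<^sup>2 / 2)" using s by (intro power_fact_le_exp) simp
    moreover have "(s * x\<^sup>2 / 2) ^ k = (x\<^sup>2) ^ k * (s / 2) ^ k"
      by (simp add: mult.commute flip: power_mult_distrib)
    moreover have "(s / 2) ^ k > 0" using s by simp
    ultimately have "(x\<^sup>2) ^ k * (s / 2) ^ k \<le> exp (s * x\<^sup>2 / 2) * fact k"
      by (simp only: pos_divide_le_eq[OF fact_gt_zero])
    with \<open>(s / 2) ^ k > 0\<close> have "(x\<^sup>2) ^ k \<le> (exp (s * x\<^sup>2 / 2) * fact k) / (s / 2) ^ k"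
      by (simp only: pos_le_divide_eq)
    then have "(x\<^sup>2) ^ k \<le> fact k / (s / 2) ^ k * exp (s * x\<^sup>2 / 2)"
      by (simp only: times_divide_eq_left mult.commute)
    then have "(x\<^sup>2) ^ k * exp (- s * x\<^sup>2 / 2) \<le> fact k / (s / 2) ^ k * exp (s * x\<^sup>2 / 2) * exp (- s * x\<^sup>2 / 2)"
      by (intro mult_right_mono) auto
    then have 1: "(x\<^sup>2) ^ k * exp (- s * x\<^sup>2 / 2) \<le> fact k / (s / 2) ^ k"
      by (simp add: mult.assoc flip: exp_add)
    have "\<bar>x\<bar> ^ k \<le> 1 + (x\<^sup>2) ^ k"
    proof -
      have "0 \<le> (\<bar>x\<bar> ^ k - 1)\<^sup>2" by simp
      then have "2 * \<bar>x\<bar> ^ k \<le> 1 + (\<bar>x\<bar> ^ k)\<^sup>2" by (simp add: power2_diff)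
      also have "(\<bar>x\<bar> ^ k)\<^sup>2 = (x\<^sup>2) ^ k" by (metis power2_abs power_mult mult.commute)
      finally show ?thesis using zero_le_power[of "\<bar>x\<bar>" k] by linarith
    qed
    then have "\<bar>x\<bar> ^ k * exp (- s * x\<^sup>2 / 2) \<le> (1 + (x\<^sup>2) ^ k) * exp (- s * x\<^sup>2 / 2)"
      by (intro mult_right_mono) auto
    moreover have "exp (- s * x\<^sup>2 / 2) \<le> 1" using s by simp
    ultimately show ?thesis using 1 unfolding D_def distrib_right by linarith
  qed
  have "\<bar>x ^ k * poly (pCons a p) x * exp (- s * x\<^sup>2 / 2)\<bar> \<le> \<bar>a\<bar> * D + C" for x
  proof -
    have "x ^ k * poly (pCons a p) x * exp (- s * x\<^sup>2 / 2)
        = a * (x ^ k * exp (- s * x\<^sup>2 / 2)) + x ^ Suc k * poly p x * exp (- s * x\<^sup>2 / 2)"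
      by (simp add: algebra_simps)
    also have "\<bar>\<dots>\<bar> \<le> \<bar>a * (x ^ k * exp (- s * x\<^sup>2 / 2))\<bar> + \<bar>x ^ Suc k * poly p x * exp (- s * x\<^sup>2 / 2)\<bar>"
      by (rule abs_triangle_ineq)
    also have "\<bar>a * (x ^ k * exp (- s * x\<^sup>2 / 2))\<bar> = \<bar>a\<bar> * (\<bar>x\<bar> ^ k * exp (- s * x\<^sup>2 / 2))"
      by (simp add: abs_mult power_abs)
    also have "\<dots> \<le> \<bar>a\<bar> * D" by (intro mult_left_mono D) auto
    finally show ?thesis using C[of x] by linarith
  qed
  then show ?case by blast
qed

lemma gauss_poly_has_vderiv:
  "(gauss_poly s p has_vector_derivative gauss_poly s (pderiv p - smult s (pCons 0 p)) x) (at x)"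
proof -
  have "((\<lambda>x. poly p x * exp (- s * x\<^sup>2 / 2)) has_real_derivative
      (poly (pderiv p) x * exp (- s * x\<^sup>2 / 2) + (exp (- s * x\<^sup>2 / 2) * (- s * (2 * x) / 2)) * poly p x)) (at x)"
    by (intro DERIV_mult poly_DERIV) (auto intro!: derivative_eq_intros)
  also have "poly (pderiv p) x * exp (- s * x\<^sup>2 / 2) + (exp (- s * x\<^sup>2 / 2) * (- s * (2 * x) / 2)) * poly p x
      = poly (pderiv p - smult s (pCons 0 p)) x * exp (- s * x\<^sup>2 / 2)"
    by (simp add: algebra_simps)
  finally show ?thesis unfolding gauss_poly_def[abs_def] by (rule has_vector_derivative_of_real)
qed

lemma vderiv_gauss_poly: "vderiv (gauss_poly s p) = gauss_poly s (pderiv p - smult s (pCons 0 p))"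
  by (rule ext) (intro vderiv_eqI gauss_poly_has_vderiv)

text \<open>Derivatives stay in the class, so a single growth bound covers all orders.\<close>

lemma gauss_poly_schwartz:
  assumes s: "s > 0"
  shows "gauss_poly s p \<in> schwartz"
proof -
  have it: "\<exists>q. (vderiv ^^ n) (gauss_poly s p) = gauss_poly s q" for n
  proof (induction n)
    case (Suc n)
    then obtain q where "(vderiv ^^ n) (gauss_poly s p) = gauss_poly s q" by blast
    then have "(vderiv ^^ Suc n) (gauss_poly s p) = vderiv (gauss_poly s q)" by simp
    then show ?case unfolding vderiv_gauss_poly by blast
  qed auto
  show ?thesis
    unfolding schwartz_def mem_Collect_eq
  proof (intro allI conjI)
    fix n x
    obtain q where q: "(vderiv ^^ n) (gauss_poly s p) = gauss_poly s q" using it by blast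
    show "(vderiv ^^ n) (gauss_poly s p) differentiable at x"
      unfolding q using gauss_poly_has_vderiv differentiableI_vector by blast
    fix m
    obtain C where "\<And>x. \<bar>x ^ m * poly q x * exp (- s * x\<^sup>2 / 2)\<bar> \<le> C" using gauss_poly_bounded[OF s] by blast
    then have "norm (x ^ m *\<^sub>R gauss_poly s q x) \<le> C" for x
      by (simp add: gauss_poly_def norm_mult abs_mult mult.assoc)
    then show "bounded (range (\<lambda>x. x ^ m *\<^sub>R (vderiv ^^ n) (gauss_poly s p) x))"
      unfolding q by (auto simp: bounded_iff)
  qed
qed

section \<open>Hardy-type inequalities\<close>

lemma decays_cnj: "decays q f \<Longrightarrow> decays q (\<lambda>x. cnj (f x))"
  unfolding decays_def by (auto intro: continuous_on_cnj)

lemma decays_Re: "decays q f \<Longrightarrow> decays q (\<lambda>x. Re (f x))"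
proof -
  assume f: "decays q f"
  have "(\<exists>C. \<forall>x. 0 < x \<and> x \<le> 1 \<longrightarrow> norm (Re (f x)) \<le> C * x powr q)"
    using f unfolding decays_def by (metis abs_Re_le_cmod order_trans real_norm_def)
  moreover have "\<exists>C. \<forall>x\<ge>1. x ^ m * norm (Re (f x)) \<le> C" for m
  proof -
    obtain C where C: "\<And>x. x \<ge> 1 \<Longrightarrow> x ^ m * norm (f x) \<le> C" using f unfolding decays_def by blast
    have "x ^ m * norm (Re (f x)) \<le> C" if "x \<ge> 1" for x
    proof -
      have "x ^ m * norm (Re (f x)) \<le> x ^ m * norm (f x)"
        using that abs_Re_le_cmod[of "f x"] by (intro mult_left_mono) auto
      then show ?thesis using C[OF that] by linarith
    qed
    then show ?thesis by blast
  qed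
  ultimately show ?thesis using f unfolding decays_def by (auto intro: continuous_on_Re)
qed

definition schwartz_even :: "(real \<Rightarrow> complex) set" where
  "schwartz_even = {f \<in> schwartz. \<forall>x. f (- x) = f x}"

lemma schwartz_evenD:
  assumes "f \<in> schwartz_even"
  shows "f \<in> schwartz" "decays 0 f" "decays 1 (vderiv f)" "decays 0 (vderiv (vderiv f))"
    "(f has_vector_derivative vderiv f x) (at x)"
    "(vderiv f has_vector_derivative vderiv (vderiv f) x) (at x)"
  using assms by (auto simp: schwartz_even_def intro!: schwartz_decays even_vderiv_decays schwartz_has_vderiv schwartz_vderiv)

lemma decays_mult_cnj: "decays q f \<Longrightarrow> decays r g \<Longrightarrow> decays (q + r) (\<lambda>x. f x * cnj (g x))"
  by (intro decays_mult decays_cnj)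

lemma decays_norm_sq: "decays q f \<Longrightarrow> decays (q + q) (\<lambda>x. (norm (f x))\<^sup>2)"
  unfolding power2_eq_square by (intro decays_mult decays_norm)

lemma weighted_integrable:
  fixes f :: "real \<Rightarrow> complex"
  assumes "decays q f" "p + 2 * q > -1"
  shows "set_integrable lborel {0<..} (\<lambda>x. x powr p * (norm (f x))\<^sup>2)"
  using decays_integrable[OF decays_powr_scaleR[OF decays_norm_sq[OF assms(1)], of p]] assms(2) by simp

text \<open>With \<phi> = x^a f every quadratic form of the problem is such an integral: exponent
  2\<sigma> for the squared norm, 2\<sigma>-2u for the perturbation, and 2\<sigma> on f' together
  with 2\<sigma>+2 on f for the energy.\<close>

definition wint :: "real \<Rightarrow> (real \<Rightarrow> complex) \<Rightarrow> real" where
  "wint p f = (LINT x:{0<..}|lborel. x powr p * (norm (f x))\<^sup>2)"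

lemma wint_nonneg: "wint p f \<ge> 0"
  unfolding wint_def set_lebesgue_integral_def by (intro integral_nonneg_AE) (simp add: indicator_def)

text \<open>For 0 < u < 1 the exponent 2-4u is strictly between -2u and 2, so small multiples of the
  outer powers dominate near 0 and near infinity, and a constant covers the interval
  between.\<close>

lemma powr_split:
  assumes u: "0 < u" "u < 1" and d: "\<delta> > 0"
  obtains C where "C > 0" "\<And>y. y > 0 \<Longrightarrow> y powr (2 - 4 * u) \<le> \<delta> * y powr (- 2 * u) + \<delta> * y\<^sup>2 + (C :: real)"
proof -
  \<comment> \<open>The crossing points: y^(2-2u) equals \<delta> at \<open>r\<close>, and y^(-4u)
    equals \<delta> at \<open>R\<close>.\<close>
  define r where "r = \<delta> powr (1 / (2 - 2 * u))"
  define R where "R = (1 / \<delta>) powr (1 / (4 * u))"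
  have rR: "r > 0" "R > 0" using d by (auto simp: r_def R_def)
  define C where "C = r powr (2 - 4 * u) + R powr (2 - 4 * u)"
  have C: "C > 0" using rR by (simp add: C_def add_pos_pos)
  have "y powr (2 - 4 * u) \<le> \<delta> * y powr (- 2 * u) + \<delta> * y\<^sup>2 + C" if y: "y > 0" for y
  proof -
    have nn: "\<delta> * y powr (- 2 * u) \<ge> 0" "\<delta> * y\<^sup>2 \<ge> 0" using d by auto
    consider "y \<le> r" | "y \<ge> R" | "r \<le> y" "y \<le> R" by linarith
    then show ?thesis
    proof cases
      case 1
      have "y powr (2 - 2 * u) \<le> r powr (2 - 2 * u)" using 1 y u by (intro powr_mono2) auto
      also have "\<dots> = \<delta>" using d u by (simp add: r_def powr_powr)
      finally have "y powr (2 - 2 * u) * y powr (- 2 * u) \<le> \<delta> * y powr (- 2 * u)" by (intro mult_right_mono) auto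
      moreover have "y powr (2 - 2 * u) * y powr (- 2 * u) = y powr (2 - 4 * u)" by (simp flip: powr_add)
      ultimately show ?thesis using nn C by linarith
    next
      case 2
      have "1 / \<delta> = R powr (4 * u)" using d u by (simp add: R_def powr_powr)
      also have "\<dots> \<le> y powr (4 * u)" using 2 rR u by (intro powr_mono2) auto
      finally have "y powr (- (4 * u)) \<le> \<delta>"
        using d y by (simp add: powr_minus field_simps)
      then have "y\<^sup>2 * y powr (- (4 * u)) \<le> \<delta> * y\<^sup>2" by (metis mult.commute mult_left_mono zero_le_power2)
      moreover have "y powr (2 - 4 * u) = y\<^sup>2 * y powr (- (4 * u))"
        using y powr_add[of y 2 "- (4 * u)"] by (simp add: powr_numeral)
      ultimately show ?thesis using nn C by linarith
    next
      case 3
      have "y powr (2 - 4 * u) \<le> C"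
      proof (cases "2 - 4 * u \<ge> 0")
        case True
        then have "y powr (2 - 4 * u) \<le> R powr (2 - 4 * u)" using 3 y by (intro powr_mono2) auto
        then show ?thesis by (simp add: C_def add_increasing)
      next
        case False
        then have "y powr (2 - 4 * u) \<le> r powr (2 - 4 * u)" using 3 y rR by (intro powr_mono2') auto
        then show ?thesis by (simp add: C_def add_increasing2)
      qed
      then show ?thesis using nn by linarith
    qed
  qed
  with C show ?thesis using that by blast
qed

text \<open>The derivative of x^\<kappa> |f|^2 integrates to 0 since \<kappa> > 0. One of its terms
  is \<kappa> x^(2\<sigma>-2u) |f|^2; the other is at most 2 x^\<kappa> |f| |f'|, which a weighted
  arithmetic-geometric mean inequality and \<open>split\<close> bound.\<close>

lemma hardy_integrated:
  assumes f: "f \<in> schwartz_even" and kap: "\<kappa> = 2 * \<sigma> - 2 * u + 1" "\<kappa> > 0" and eta: "\<eta> > 0" and u: "u > 0" "u < 1"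
    and split: "\<And>x. x > 0 \<Longrightarrow> x powr (2 - 4 * u) \<le> A * x powr (- 2 * u) + B * x\<^sup>2 + C"
  shows "\<kappa> * wint (2 * \<sigma> - 2 * u) f \<le> \<eta> * wint (2 * \<sigma>) (vderiv f)
    + 1 / \<eta> * (A * wint (2 * \<sigma> - 2 * u) f + B * wint (2 * \<sigma> + 2) f + C * wint (2 * \<sigma>) f)"
proof -
  note d = schwartz_evenD[OF f]
  define G where "G x = (x powr \<kappa>) *\<^sub>R (f x * cnj (f x))" for x
  define H where "H x = vderiv f x * cnj (f x) + f x * cnj (vderiv f x)" for x
  define G' where "G' x = (x powr \<kappa>) *\<^sub>R H x + (\<kappa> * x powr (\<kappa> - 1)) *\<^sub>R (f x * cnj (f x))" for x
  have der: "(G has_vector_derivative G' x) (at x)" if "x > 0" for x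
  proof -
    have "((\<lambda>x. f x * cnj (f x)) has_vector_derivative (f x * cnj (vderiv f x) + vderiv f x * cnj (f x))) (at x)"
      by (intro has_vector_derivative_mult has_vector_derivative_cnj d)
    then have "((\<lambda>x. f x * cnj (f x)) has_vector_derivative H x) (at x)" by (simp add: H_def add.commute)
    from has_vector_derivative_scaleR[OF has_real_derivative_powr[OF that] this]
    show ?thesis unfolding G_def[abs_def] G'_def .
  qed
  have dG: "decays \<kappa> G"
    unfolding G_def[abs_def] using decays_powr_scaleR[OF decays_mult_cnj[OF d(2) d(2)], of \<kappa>] by simp
  have dH: "decays 1 H"
    unfolding H_def[abs_def] using decays_add[OF decays_mult_cnj[OF d(3) d(2)] ] decays_mult_cnj[OF d(2) d(3)] by simp
  have dG': "decays (\<kappa> - 1) G'"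
    unfolding G'_def[abs_def]
  proof (rule decays_add)
    show "decays (\<kappa> - 1) (\<lambda>x. (x powr \<kappa>) *\<^sub>R H x)"
      by (rule decays_weaken[OF decays_powr_scaleR[OF dH]]) simp
    have "decays (\<kappa> - 1) (\<lambda>x. \<kappa> *\<^sub>R ((x powr (\<kappa> - 1)) *\<^sub>R (f x * cnj (f x))))"
      using decays_scale[OF decays_powr_scaleR[OF decays_mult_cnj[OF d(2) d(2)], of "\<kappa> - 1"]] by simp
    then show "decays (\<kappa> - 1) (\<lambda>x. (\<kappa> * x powr (\<kappa> - 1)) *\<^sub>R (f x * cnj (f x)))" by simp
  qed
  have derR: "((\<lambda>x. Re (G x)) has_vector_derivative Re (G' x)) (at x)" if "x > 0" for x
    by (rule bounded_linear.has_vector_derivative[OF bounded_linear_Re der[OF that]])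
  have zero: "(LINT x:{0<..}|lborel. Re (G' x)) = 0"
    by (rule integral_derivative_zero[OF decays_Re[OF dG] kap(2) decays_Re[OF dG'] _ derR]) (use kap in auto)
  have iG': "set_integrable lborel {0<..} (\<lambda>x. Re (G' x))"
    by (rule decays_integrable[OF decays_Re[OF dG']]) (use kap in auto)
  have i: "set_integrable lborel {0<..} (\<lambda>x. x powr (2 * \<sigma> - 2 * u) * (norm (f x))\<^sup>2)"
    "set_integrable lborel {0<..} (\<lambda>x. x powr (2 * \<sigma>) * (norm (f x))\<^sup>2)"
    "set_integrable lborel {0<..} (\<lambda>x. x powr (2 * \<sigma> + 2) * (norm (f x))\<^sup>2)"
    "set_integrable lborel {0<..} (\<lambda>x. x powr (2 * \<sigma>) * (norm (vderiv f x))\<^sup>2)"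
    using kap u by (auto intro!: weighted_integrable[OF d(2)] weighted_integrable[OF d(3)])
  have pt: "\<kappa> * (x powr (2 * \<sigma> - 2 * u) * (norm (f x))\<^sup>2) - Re (G' x)
      \<le> \<eta> * (x powr (2 * \<sigma>) * (norm (vderiv f x))\<^sup>2)
        + 1 / \<eta> * (A * (x powr (2 * \<sigma> - 2 * u) * (norm (f x))\<^sup>2) + B * (x powr (2 * \<sigma> + 2) * (norm (f x))\<^sup>2)
          + C * (x powr (2 * \<sigma>) * (norm (f x))\<^sup>2))" if x: "x > 0" for x
  proof -
    define N where "N = norm (f x)"
    define D where "D = norm (vderiv f x)"
    have reff: "Re (f x * cnj (f x)) = N\<^sup>2" unfolding N_def by (simp add: complex_norm_square[symmetric] del: of_real_power)
    have reH: "Re (H x) \<ge> - (2 * (D * N))"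
    proof -
      have "Re (H x) = 2 * Re (vderiv f x * cnj (f x))" by (simp add: H_def)
      moreover have "\<bar>Re (vderiv f x * cnj (f x))\<bar> \<le> D * N"
        using abs_Re_le_cmod[of "vderiv f x * cnj (f x)"] by (simp add: D_def N_def norm_mult)
      ultimately show ?thesis by linarith
    qed
    have "\<kappa> - 1 = 2 * \<sigma> - 2 * u" using kap by simp
    then have "Re (G' x) = x powr \<kappa> * Re (H x) + \<kappa> * (x powr (2 * \<sigma> - 2 * u) * N\<^sup>2)"
      unfolding G'_def by (simp only: plus_complex.sel scaleR_complex.sel reff mult.assoc)
    moreover have "x powr \<kappa> * - (2 * (D * N)) \<le> x powr \<kappa> * Re (H x)" by (intro mult_left_mono reH) simp
    ultimately have 1: "\<kappa> * (x powr (2 * \<sigma> - 2 * u) * N\<^sup>2) - Re (G' x) \<le> 2 * x powr \<kappa> * D * N"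
      by (simp add: algebra_simps)
    \<comment> \<open>The product of \<open>p\<close> and \<open>q\<close> is the cross term. The
      weight x^\<sigma> is put with f' to produce the energy, which leaves |f|^2 with exponent
      2\<sigma>+2-4u.\<close>
    define p where "p = sqrt \<eta> * x powr \<sigma> * D"
    define q where "q = x powr (\<kappa> - \<sigma>) * N / sqrt \<eta>"
    have "x powr \<sigma> * x powr (\<kappa> - \<sigma>) = x powr \<kappa>" by (simp flip: powr_add)
    then have pq: "p * q = x powr \<kappa> * D * N" unfolding p_def q_def using eta by simp
    have "0 \<le> (p - q)\<^sup>2" by simp
    then have "2 * (p * q) \<le> p\<^sup>2 + q\<^sup>2" by (simp add: power2_diff)
    moreover have "p\<^sup>2 = \<eta> * (x powr (2 * \<sigma>) * D\<^sup>2)"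
      unfolding p_def using eta x by (simp add: power_mult_distrib powr_power mult.commute)
    moreover have "q\<^sup>2 = 1 / \<eta> * (x powr (2 * \<sigma>) * x powr (2 - 4 * u) * N\<^sup>2)"
    proof -
      have "(x powr (\<kappa> - \<sigma>))\<^sup>2 = x powr (2 * (\<kappa> - \<sigma>))" using x by (simp add: powr_power mult.commute)
      also have "2 * (\<kappa> - \<sigma>) = 2 * \<sigma> + (2 - 4 * u)" using kap by simp
      also have "x powr (2 * \<sigma> + (2 - 4 * u)) = x powr (2 * \<sigma>) * x powr (2 - 4 * u)" by (rule powr_add)
      finally show ?thesis unfolding q_def using eta by (simp add: power_mult_distrib power_divide)
    qed
    moreover have "x powr (2 * \<sigma>) * x powr (2 - 4 * u) * N\<^sup>2
        \<le> A * (x powr (2 * \<sigma> - 2 * u) * N\<^sup>2) + B * (x powr (2 * \<sigma> + 2) * N\<^sup>2) + C * (x powr (2 * \<sigma>) * N\<^sup>2)"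
    proof -
      have "x powr (2 * \<sigma>) * x powr (2 - 4 * u) * N\<^sup>2 \<le> x powr (2 * \<sigma>) * (A * x powr (- 2 * u) + B * x\<^sup>2 + C) * N\<^sup>2"
        using split[OF x] by (intro mult_right_mono mult_left_mono) auto
      moreover have "x powr (2 * \<sigma>) * x powr (- 2 * u) = x powr (2 * \<sigma> - 2 * u)" by (simp flip: powr_add)
      moreover have "x powr (2 * \<sigma>) * x\<^sup>2 = x powr (2 * \<sigma> + 2)" using x by (simp add: powr_add powr_numeral)
      ultimately show ?thesis by (simp add: algebra_simps)
    qed
    then have "1 / \<eta> * (x powr (2 * \<sigma>) * x powr (2 - 4 * u) * N\<^sup>2)
        \<le> 1 / \<eta> * (A * (x powr (2 * \<sigma> - 2 * u) * N\<^sup>2) + B * (x powr (2 * \<sigma> + 2) * N\<^sup>2) + C * (x powr (2 * \<sigma>) * N\<^sup>2))"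
      using eta by (intro mult_left_mono) auto
    ultimately show ?thesis using 1 pq unfolding N_def[symmetric] D_def[symmetric] by linarith
  qed
  have "(LINT x:{0<..}|lborel. \<kappa> * (x powr (2 * \<sigma> - 2 * u) * (norm (f x))\<^sup>2) - Re (G' x))
    \<le> (LINT x:{0<..}|lborel. \<eta> * (x powr (2 * \<sigma>) * (norm (vderiv f x))\<^sup>2)
        + 1 / \<eta> * (A * (x powr (2 * \<sigma> - 2 * u) * (norm (f x))\<^sup>2) + B * (x powr (2 * \<sigma> + 2) * (norm (f x))\<^sup>2)
          + C * (x powr (2 * \<sigma>) * (norm (f x))\<^sup>2)))"
    by (rule set_integral_mono, intro set_integral_diff(1) set_integrable_mult_right i iG',
        intro set_integral_add(1) set_integrable_mult_right i, rule pt, simp)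
  then show ?thesis
    by (simp add: set_integral_add set_integral_diff set_integrable_mult_right i iG' zero wint_def del: times_divide_eq_left)
qed

text \<open>The constants come from \<open>powr_split\<close> alone and hence depend on \<epsilon>,
  \<sigma>, u; the parameter s enters through the scaling y = sqrt(s) x.\<close>

lemma hardy_inequality:
  fixes \<epsilon> \<sigma> u :: real
  assumes u: "0 < u" "u < 1" and sig: "\<sigma> > u - 1 / 2" and eps: "\<epsilon> > 0"
  obtains C where "C > 0" "\<And>s f. s > 0 \<Longrightarrow> f \<in> schwartz_even \<Longrightarrow>
    wint (2 * \<sigma> - 2 * u) f \<le> \<epsilon> * s powr (u - 1) * (wint (2 * \<sigma>) (vderiv f) + s\<^sup>2 * wint (2 * \<sigma> + 2) f)
      + C * s powr u * wint (2 * \<sigma>) f"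
proof -
  define \<kappa> where "\<kappa> = 2 * \<sigma> - 2 * u + 1"
  have kap: "\<kappa> > 0" using sig by (simp add: \<kappa>_def)
  \<comment> \<open>The last step divides by \<kappa>/2, which turns \<open>\<eta>\<close> into
    \<open>\<epsilon>\<close>.\<close>
  define \<eta> where "\<eta> = \<epsilon> * \<kappa> / 2"
  have eta: "\<eta> > 0" using eps kap by (simp add: \<eta>_def)
  \<comment> \<open>The first bound lets half of the left side absorb the term with x^(-2u), the
    second makes the coefficient of the x^2 term at most \<open>\<eta>\<close>.\<close>
  define \<delta> where "\<delta> = min (\<eta> * \<kappa> / 2) (\<eta>\<^sup>2)"
  have del: "\<delta> > 0" using eta kap by (simp add: \<delta>_def)
  have del2: "\<delta> / \<eta> \<le> \<kappa> / 2" "\<delta> / \<eta> \<le> \<eta>"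
    using eta by (auto simp: \<delta>_def pos_divide_le_eq power2_eq_square algebra_simps min_le_iff_disj)
  obtain C0 where C0: "C0 > 0" "\<And>y. y > 0 \<Longrightarrow> y powr (2 - 4 * u) \<le> \<delta> * y powr (- 2 * u) + \<delta> * y\<^sup>2 + C0"
    using powr_split[OF u del] by blast
  define C where "C = 2 * C0 / (\<kappa> * \<eta>)"
  have "C > 0" using C0 kap eta by (simp add: C_def)
  moreover have "wint (2 * \<sigma> - 2 * u) f \<le> \<epsilon> * s powr (u - 1) * (wint (2 * \<sigma>) (vderiv f) + s\<^sup>2 * wint (2 * \<sigma> + 2) f)
      + C * s powr u * wint (2 * \<sigma>) f" if s: "s > 0" and f: "f \<in> schwartz_even" for s f
  proof -
    have split: "x powr (2 - 4 * u) \<le> (\<delta> * s powr (u - 1)) * x powr (- 2 * u) + (\<delta> * s powr (2 * u)) * x\<^sup>2 + C0 * s powr (2 * u - 1)"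
      if x: "x > 0" for x
    proof -
      define y where "y = s powr (1 / 2) * x"
      have y: "y > 0" using s x by (simp add: y_def)
      have yp: "y powr p = s powr (p / 2) * x powr p" for p using s x by (simp add: y_def powr_mult powr_powr)
      have y2: "y\<^sup>2 = s * x\<^sup>2" using s by (simp add: y_def power_mult_distrib powr_power)
      have "s powr (2 * u - 1) * y powr (2 - 4 * u) \<le> s powr (2 * u - 1) * (\<delta> * y powr (- 2 * u) + \<delta> * y\<^sup>2 + C0)"
        using C0(2)[OF y] by (intro mult_left_mono) auto
      moreover have "s powr (2 * u - 1) * y powr (2 - 4 * u) = x powr (2 - 4 * u)"
      proof -
        have "s powr (2 * u - 1) * s powr ((2 - 4 * u) / 2) = s powr 0"
          unfolding powr_add[symmetric] by (rule arg_cong[of _ _ "\<lambda>p. s powr p"]) (simp add: field_simps)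
        then show ?thesis using s unfolding yp by (simp add: mult.assoc[symmetric])
      qed
      moreover have "s powr (2 * u - 1) * y powr (- 2 * u) = s powr (u - 1) * x powr (- 2 * u)"
      proof -
        have "s powr (2 * u - 1) * s powr (- 2 * u / 2) = s powr (u - 1)"
          unfolding powr_add[symmetric] by (rule arg_cong[of _ _ "\<lambda>p. s powr p"]) simp
        then show ?thesis unfolding yp by (simp add: mult.assoc[symmetric])
      qed
      moreover have "s powr (2 * u - 1) * y\<^sup>2 = s powr (2 * u) * x\<^sup>2"
      proof -
        have "s powr (2 * u) = s powr (2 * u - 1) * s" using s powr_add[of s "2 * u - 1" 1] by simp
        then show ?thesis by (simp add: y2)
      qed
      ultimately show ?thesis by (simp add: algebra_simps)
    qed
    define I0 where "I0 = wint (2 * \<sigma>) f"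
    define I1 where "I1 = wint (2 * \<sigma>) (vderiv f)"
    define I2 where "I2 = wint (2 * \<sigma> + 2) f"
    define Iu where "Iu = wint (2 * \<sigma> - 2 * u) f"
    have nn: "I0 \<ge> 0" "I1 \<ge> 0" "I2 \<ge> 0" "Iu \<ge> 0" by (auto simp: I0_def I1_def I2_def Iu_def wint_nonneg)
    define S where "S = s powr (u - 1)"
    have S: "S > 0" using s by (simp add: S_def)
    \<comment> \<open>The weight is \<open>\<eta> * S\<close> with S = s^(u-1), so that S cancels in
      front of \<open>Iu\<close> and the absorption is uniform in s.\<close>
    have h: "\<kappa> * Iu \<le> (\<eta> * S) * I1 + 1 / (\<eta> * S) * ((\<delta> * S) * Iu + (\<delta> * s powr (2 * u)) * I2 + (C0 * s powr (2 * u - 1)) * I0)"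
      unfolding I0_def I1_def I2_def Iu_def S_def
      by (rule hardy_integrated[OF f \<kappa>_def kap _ u split]) (use eta s in auto)
    have p1: "s powr (2 * u) = S * (S * s\<^sup>2)"
    proof -
      have "S * (S * s\<^sup>2) = s powr ((u - 1) + ((u - 1) + 2))" using s by (simp only: S_def powr_add powr_numeral)
      then show ?thesis by simp
    qed
    have p2: "s powr (2 * u - 1) = S * s powr u"
      unfolding S_def powr_add[symmetric] by (rule arg_cong[of _ _ "\<lambda>p. s powr p"]) simp
    have "1 / (\<eta> * S) * ((\<delta> * S) * Iu + (\<delta> * s powr (2 * u)) * I2 + (C0 * s powr (2 * u - 1)) * I0)
        = \<delta> / \<eta> * Iu + \<delta> / \<eta> * (S * (s\<^sup>2 * I2)) + C0 / \<eta> * (s powr u * I0)"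
      unfolding p1 p2 using S eta by (simp add: field_simps)
    also have "\<dots> \<le> \<kappa> / 2 * Iu + \<eta> * (S * (s\<^sup>2 * I2)) + C0 / \<eta> * (s powr u * I0)"
      using nn S by (intro add_mono mult_right_mono del2) auto
    finally have "\<kappa> * Iu \<le> \<eta> * S * I1 + (\<kappa> / 2 * Iu + \<eta> * (S * (s\<^sup>2 * I2)) + C0 / \<eta> * (s powr u * I0))"
      using h by linarith
    moreover have "\<eta> * S * I1 + \<eta> * (S * (s\<^sup>2 * I2)) = \<eta> * (S * (I1 + s\<^sup>2 * I2))" by (simp add: algebra_simps)
    moreover have "\<kappa> * Iu = \<kappa> / 2 * Iu + \<kappa> / 2 * Iu" by simp
    ultimately have "\<kappa> / 2 * Iu \<le> \<eta> * (S * (I1 + s\<^sup>2 * I2)) + C0 / \<eta> * (s powr u * I0)"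
      by linarith
    then have "2 / \<kappa> * (\<kappa> / 2 * Iu) \<le> 2 / \<kappa> * (\<eta> * (S * (I1 + s\<^sup>2 * I2)) + C0 / \<eta> * (s powr u * I0))"
      using kap by (intro mult_left_mono) auto
    moreover have "2 / \<kappa> * (\<kappa> / 2 * Iu) = Iu" using kap by simp
    moreover have "2 / \<kappa> * (\<eta> * (S * (I1 + s\<^sup>2 * I2)) + C0 / \<eta> * (s powr u * I0)) = \<epsilon> * S * (I1 + s\<^sup>2 * I2) + C * s powr u * I0"
      using kap eta by (simp add: \<eta>_def C_def distrib_left)
    ultimately show ?thesis unfolding I0_def I1_def I2_def Iu_def S_def by linarith
  qed
  ultimately show ?thesis using that by blast
qed

text \<open>By homogeneity only the ratio r = y/t matters, and r^(-u) \<ge> 1 - u ln r \<ge> 1 + u -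
  u r.\<close>

lemma tangent_powr:
  fixes y t u :: real
  assumes y: "y > 0" and t: "t > 0" and u: "u > 0"
  shows "(1 + u) * t powr (- u) - u * t powr (- u - 1) * y \<le> y powr (- u)"
proof -
  define r where "r = y / t"
  have r: "r > 0" using y t by (simp add: r_def)
  have "1 + (- u) * ln r \<le> exp ((- u) * ln r)" by (rule exp_ge_add_one_self)
  moreover have "ln r \<le> r - 1" using r by (rule ln_le_minus_one)
  then have "u * ln r \<le> u * (r - 1)" using u by (intro mult_left_mono) auto
  ultimately have "1 + u - u * r \<le> r powr (- u)" using r by (simp add: powr_def algebra_simps)
  then have "(1 + u - u * r) * t powr (- u) \<le> r powr (- u) * t powr (- u)" by (intro mult_right_mono) auto
  also have "r powr (- u) * t powr (- u) = y powr (- u)" using y t by (simp add: r_def flip: powr_mult)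
  also have "(1 + u - u * r) * t powr (- u) = (1 + u) * t powr (- u) - u * t powr (- u - 1) * y"
    using t powr_diff[of t "- u" 1] by (simp add: r_def field_simps)
  finally show ?thesis .
qed

lemma tangent_inequality:
  assumes f: "f \<in> schwartz_even" and sig: "\<sigma> > u - 1 / 2" and u: "u > 0" and t: "t > 0"
  shows "(1 + u) * t powr (- u) * wint (2 * \<sigma>) f - u * t powr (- u - 1) * wint (2 * \<sigma> + 2) f \<le> wint (2 * \<sigma> - 2 * u) f"
proof -
  note d = schwartz_evenD[OF f]
  have i: "set_integrable lborel {0<..} (\<lambda>x. x powr (2 * \<sigma> - 2 * u) * (norm (f x))\<^sup>2)"
    "set_integrable lborel {0<..} (\<lambda>x. x powr (2 * \<sigma>) * (norm (f x))\<^sup>2)"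
    "set_integrable lborel {0<..} (\<lambda>x. x powr (2 * \<sigma> + 2) * (norm (f x))\<^sup>2)"
    using sig u by (auto intro!: weighted_integrable[OF d(2)])
  have pt: "(1 + u) * t powr (- u) * (x powr (2 * \<sigma>) * (norm (f x))\<^sup>2) - u * t powr (- u - 1) * (x powr (2 * \<sigma> + 2) * (norm (f x))\<^sup>2)
      \<le> x powr (2 * \<sigma> - 2 * u) * (norm (f x))\<^sup>2" if x: "x > 0" for x
  proof -
    have "(1 + u) * t powr (- u) - u * t powr (- u - 1) * x\<^sup>2 \<le> (x\<^sup>2) powr (- u)"
      using x t u by (intro tangent_powr) auto
    also have "(x\<^sup>2) powr (- u) = x powr (- 2 * u)" using x by (simp add: powr_powr flip: powr_numeral)
    finally have "((1 + u) * t powr (- u) - u * t powr (- u - 1) * x\<^sup>2) * (x powr (2 * \<sigma>) * (norm (f x))\<^sup>2)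
        \<le> x powr (- 2 * u) * (x powr (2 * \<sigma>) * (norm (f x))\<^sup>2)" by (intro mult_right_mono) auto
    moreover have "x powr (2 * \<sigma> - 2 * u) = x powr (- 2 * u) * x powr (2 * \<sigma>)" by (simp flip: powr_add)
    moreover have "x powr (2 * \<sigma> + 2) = x\<^sup>2 * x powr (2 * \<sigma>)" using x by (simp add: powr_add powr_numeral)
    ultimately show ?thesis by (simp add: algebra_simps)
  qed
  have "(LINT x:{0<..}|lborel. (1 + u) * t powr (- u) * (x powr (2 * \<sigma>) * (norm (f x))\<^sup>2) - u * t powr (- u - 1) * (x powr (2 * \<sigma> + 2) * (norm (f x))\<^sup>2))
    \<le> (LINT x:{0<..}|lborel. x powr (2 * \<sigma> - 2 * u) * (norm (f x))\<^sup>2)"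
    by (rule set_integral_mono, intro set_integral_diff(1) set_integrable_mult_right i, rule i, rule pt, simp)
  then show ?thesis by (simp add: set_integral_diff set_integrable_mult_right i wint_def)
qed

section \<open>The unperturbed operator and its Laguerre basis\<close>

text \<open>\<open>indicial\<close> is the indicial equation of the operator at 0: it cancels the
  x^(-2) term once x^a is factored out. The bound on \<sigma> places x^a f in the weighted L2
  space.\<close>

locale oscillator =
  fixes s c1 c2 a \<sigma> :: real
  assumes s_pos: "s > 0" and indicial: "a\<^sup>2 + (2 * c1 - 1) * a - c2 = 0"
    and \<sigma>_def: "\<sigma> = a + c1" and \<sigma>_gt: "\<sigma> > - 1 / 2"
begin

abbreviation M :: "real measure" where "M \<equiv> half_line_measure c1"
abbreviation V :: "(real \<Rightarrow> complex) set" where "V \<equiv> powr_schwartz_even a"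

lemma V_E:
  assumes "\<phi> \<in> V"
  obtains f where "f \<in> schwartz_even" "\<forall>x>0. \<phi> x = (x powr a) *\<^sub>R f x"
  using assms unfolding powr_schwartz_even_def schwartz_even_def by blast

lemma V_I: "f \<in> schwartz_even \<Longrightarrow> \<forall>x>0. \<phi> x = (x powr a) *\<^sub>R f x \<Longrightarrow> \<phi> \<in> V"
  unfolding powr_schwartz_even_def schwartz_even_def by blast

text \<open>The factor 1/x is written as a real power so that \<open>decays_powr_scaleR\<close>
  applies to it.\<close>

definition Lop :: "(real \<Rightarrow> complex) \<Rightarrow> real \<Rightarrow> complex" where
  "Lop f x = - vderiv (vderiv f) x + (s\<^sup>2 * x\<^sup>2) *\<^sub>R f x - (2 * \<sigma> * x powr - 1) *\<^sub>R vderiv f x"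

lemma Lop_decays:
  assumes "f \<in> schwartz_even"
  shows "decays 0 (Lop f)"
proof -
  note d = schwartz_evenD[OF assms]
  have 1: "decays 0 (\<lambda>x. (- 1) *\<^sub>R vderiv (vderiv f) x)" by (rule decays_scale[OF d(4)])
  have "decays 0 (\<lambda>x. (x powr 2) *\<^sub>R f x)" by (rule decays_weaken[OF decays_powr_scaleR[OF d(2)]]) simp
  then have 2: "decays 0 (\<lambda>x. s\<^sup>2 *\<^sub>R ((x powr 2) *\<^sub>R f x))" by (rule decays_scale)
  have "decays 0 (\<lambda>x. (x powr - 1) *\<^sub>R vderiv f x)" using decays_powr_scaleR[OF d(3), of "- 1"] by simp
  then have 3: "decays 0 (\<lambda>x. (- (2 * \<sigma>)) *\<^sub>R ((x powr - 1) *\<^sub>R vderiv f x))" by (rule decays_scale)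
  show ?thesis
    by (rule decays_cong[THEN iffD1, OF _ decays_add[OF decays_add[OF 1 2] 3]])
       (simp add: Lop_def powr_numeral)
qed

text \<open>Conjugation by x^a changes the first order coefficient to 2(a + c1) = 2\<sigma>; the
  coefficient of f/x^2 becomes c2 - a(a-1) - 2 c1 a, which is zero.\<close>

lemma P0_eq:
  assumes f: "f \<in> schwartz_even" and \<phi>: "\<forall>x>0. \<phi> x = (x powr a) *\<^sub>R f x" and x: "x > 0"
  shows "P0 s c1 c2 \<phi> x = (x powr a) *\<^sub>R Lop f x"
proof -
  note d = schwartz_evenD[OF f]
  define \<phi>1 where "\<phi>1 x = (x powr a) *\<^sub>R vderiv f x + (a * x powr (a - 1)) *\<^sub>R f x" for x
  define \<phi>2 where "\<phi>2 x = ((x powr a) *\<^sub>R vderiv (vderiv f) x + (a * x powr (a - 1)) *\<^sub>R vderiv f x)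
      + ((a * x powr (a - 1)) *\<^sub>R vderiv f x + (a * ((a - 1) * x powr (a - 1 - 1))) *\<^sub>R f x)" for x
  have 1: "vderiv \<phi> y = \<phi>1 y" if "y > 0" for y
  proof (rule vderiv_eqI)
    have "((\<lambda>x. (x powr a) *\<^sub>R f x) has_vector_derivative \<phi>1 y) (at y)"
      unfolding \<phi>1_def by (rule has_vector_derivative_scaleR[OF has_real_derivative_powr[OF that] d(5)])
    then show "(\<phi> has_vector_derivative \<phi>1 y) (at y)"
      by (rule has_vector_derivative_transform_within_open[of _ _ _ "{0<..}"]) (use that \<phi> in auto)
  qed
  have 2: "vderiv (vderiv \<phi>) x = \<phi>2 x"
  proof (rule vderiv_eqI)
    have "(\<phi>1 has_vector_derivative \<phi>2 x) (at x)"
      unfolding \<phi>1_def[abs_def] \<phi>2_def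
      by (intro has_vector_derivative_add has_vector_derivative_scaleR has_real_derivative_powr DERIV_cmult d x)
    then show "(vderiv \<phi> has_vector_derivative \<phi>2 x) (at x)"
      by (rule has_vector_derivative_transform_within_open[of _ _ _ "{0<..}"]) (use x 1 in auto)
  qed
  define X where "X = x powr a"
  have X1: "x powr (a - 1) = X / x" using x by (simp add: X_def powr_diff)
  have X2: "x powr (a - 1 - 1) = X / x\<^sup>2" using x by (simp add: X_def powr_diff power2_eq_square)
  have Xm: "x powr - 1 = 1 / x" using x by (simp add: powr_minus_divide)
  have c2: "c2 = a\<^sup>2 + (2 * c1 - 1) * a" using indicial by simp
  define D0 D1 D2 where "D0 = f x" "D1 = vderiv f x" "D2 = vderiv (vderiv f) x"
  have "P0 s c1 c2 \<phi> x = - \<phi>2 x + (s\<^sup>2 * x\<^sup>2) *\<^sub>R (X *\<^sub>R D0) - (2 * c1 * inverse x) *\<^sub>R \<phi>1 x + (c2 * inverse (x\<^sup>2)) *\<^sub>R (X *\<^sub>R D0)"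
    unfolding P0_def 2 1[OF x] \<phi>[rule_format, OF x] by (simp add: X_def D0_D1_D2_def)
  also have "\<dots> = (- X) *\<^sub>R D2 + (- (2 * (a * (X / x))) - 2 * c1 * inverse x * X) *\<^sub>R D1
      + (- (a * ((a - 1) * (X / x\<^sup>2))) + s\<^sup>2 * x\<^sup>2 * X - 2 * c1 * inverse x * (a * (X / x)) + c2 * inverse (x\<^sup>2) * X) *\<^sub>R D0"
    unfolding \<phi>1_def \<phi>2_def X1 X2 X_def[symmetric] D0_D1_D2_def(1)[symmetric] D0_D1_D2_def(2)[symmetric] D0_D1_D2_def(3)[symmetric]
    by (simp add: scaleR_conv_of_real algebra_simps)
  also have "- (2 * (a * (X / x))) - 2 * c1 * inverse x * X = X * (- (2 * \<sigma> * (1 / x)))"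
    using x by (simp add: \<sigma>_def field_simps)
  also have "- (a * ((a - 1) * (X / x\<^sup>2))) + s\<^sup>2 * x\<^sup>2 * X - 2 * c1 * inverse x * (a * (X / x)) + c2 * inverse (x\<^sup>2) * X = X * (s\<^sup>2 * x\<^sup>2)"
    using x unfolding c2 by (simp add: field_simps power2_eq_square)
  finally show ?thesis
    unfolding Lop_def Xm X_def[symmetric] D0_D1_D2_def(1)[symmetric] D0_D1_D2_def(2)[symmetric] D0_D1_D2_def(3)[symmetric]
    by (simp add: scaleR_add_right scaleR_diff_right)
qed

lemma V_L2:
  assumes "\<phi> \<in> V"
  shows "\<phi> \<in> L2 M" "P0 s c1 c2 \<phi> \<in> L2 M"
    "\<sigma> > u - 1 / 2 \<Longrightarrow> (\<lambda>x. (x powr (- u)) *\<^sub>R \<phi> x) \<in> L2 M"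
proof -
  obtain f where f: "f \<in> schwartz_even" "\<forall>x>0. \<phi> x = (x powr a) *\<^sub>R f x" using assms by (rule V_E) blast
  note d = schwartz_evenD[OF f(1)]
  have lift: "(\<lambda>x. (x powr a) *\<^sub>R k x) \<in> L2 M" if "decays 0 k" for k :: "real \<Rightarrow> complex"
    by (rule decays_L2[OF decays_powr_scaleR[OF that]]) (use \<sigma>_gt \<sigma>_def in simp)
  show "\<phi> \<in> L2 M" using lift[OF d(2)] by (subst L2_half_line_cong[OF f(2)[rule_format]])
  show "P0 s c1 c2 \<phi> \<in> L2 M" using lift[OF Lop_decays[OF f(1)]] by (subst L2_half_line_cong[OF P0_eq[OF f]])
  assume u: "\<sigma> > u - 1 / 2"
  have "(\<lambda>x. (x powr (- u)) *\<^sub>R ((x powr a) *\<^sub>R f x)) \<in> L2 M"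
    by (rule decays_L2[OF decays_powr_scaleR[OF decays_powr_scaleR[OF d(2)]]]) (use u \<sigma>_def in simp)
  then show "(\<lambda>x. (x powr (- u)) *\<^sub>R \<phi> x) \<in> L2 M"
    by (subst L2_half_line_cong[of _ "\<lambda>x. (x powr (- u)) *\<^sub>R ((x powr a) *\<^sub>R f x)"]) (simp_all add: f(2))
qed

lemma norm_sq_wint:
  assumes f: "f \<in> schwartz_even" and \<phi>: "\<forall>x>0. \<phi> x = (x powr a) *\<^sub>R f x" and L: "(\<lambda>x. (x powr (- u)) *\<^sub>R \<phi> x) \<in> L2 M"
  shows "(L2_norm M (\<lambda>x. (x powr (- u)) *\<^sub>R \<phi> x))\<^sup>2 = wint (2 * \<sigma> - 2 * u) f"
proof -
  have "(L2_norm M (\<lambda>x. (x powr (- u)) *\<^sub>R \<phi> x))\<^sup>2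
      = (LINT x:{0<..}|lborel. (x powr (2 * c1)) *\<^sub>R (cmod ((x powr (- u)) *\<^sub>R \<phi> x))\<^sup>2)"
    unfolding L2_norm_sq_integral
    by (rule integral_half_line) (rule borel_measurable_integrable[OF L2_integrable[OF L]])
  also have "\<dots> = wint (2 * \<sigma> - 2 * u) f"
    unfolding wint_def
  proof (rule set_lebesgue_integral_cong)
    show "\<forall>x. x \<in> {0<..} \<longrightarrow> (x powr (2 * c1)) *\<^sub>R (cmod ((x powr (- u)) *\<^sub>R \<phi> x))\<^sup>2 = x powr (2 * \<sigma> - 2 * u) * (norm (f x))\<^sup>2"
    proof (intro allI impI)
      fix x :: real assume "x \<in> {0<..}"
      then have x: "x > 0" by simp
      have "2 * \<sigma> - 2 * u = 2 * c1 + (- u + - u) + (a + a)" by (simp add: \<sigma>_def)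
      then have "x powr (2 * \<sigma> - 2 * u) = x powr (2 * c1 + (- u + - u) + (a + a))" by (simp only:)
      also have "\<dots> = x powr (2 * c1) * (x powr (- u))\<^sup>2 * (x powr a)\<^sup>2" by (simp only: powr_add power2_eq_square)
      finally show "(x powr (2 * c1)) *\<^sub>R (cmod ((x powr (- u)) *\<^sub>R \<phi> x))\<^sup>2 = x powr (2 * \<sigma> - 2 * u) * (norm (f x))\<^sup>2"
        by (simp add: \<phi>[rule_format, OF x] power_mult_distrib)
    qed
  qed simp
  finally show ?thesis .
qed

definition energy :: "(real \<Rightarrow> complex) \<Rightarrow> (real \<Rightarrow> complex) \<Rightarrow> complex" where
  "energy f g = (LINT x:{0<..}|lborel. (x powr (2 * \<sigma>)) *\<^sub>R (vderiv f x * cnj (vderiv g x))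
     + (s\<^sup>2 * x powr (2 * \<sigma> + 2)) *\<^sub>R (f x * cnj (g x)))"

lemma energy_commute: "energy f g = cnj (energy g f)"
proof -
  have "cnj (energy g f) = (LINT x:{0<..}|lborel. cnj ((x powr (2 * \<sigma>)) *\<^sub>R (vderiv g x * cnj (vderiv f x))
     + (s\<^sup>2 * x powr (2 * \<sigma> + 2)) *\<^sub>R (g x * cnj (f x))))"
    unfolding energy_def set_lebesgue_integral_def
    by (subst Bochner_Integration.integral_cnj[symmetric]) simp
  then show ?thesis by (simp add: energy_def mult.commute)
qed

lemma energy_self:
  assumes f: "f \<in> schwartz_even"
  shows "energy f f = complex_of_real (wint (2 * \<sigma>) (vderiv f) + s\<^sup>2 * wint (2 * \<sigma> + 2) f)"
proof -
  note d = schwartz_evenD[OF f]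
  have i: "set_integrable lborel {0<..} (\<lambda>x. x powr (2 * \<sigma> + 2) * (norm (f x))\<^sup>2)"
    "set_integrable lborel {0<..} (\<lambda>x. x powr (2 * \<sigma>) * (norm (vderiv f x))\<^sup>2)"
    using \<sigma>_gt by (auto intro!: weighted_integrable[OF d(2)] weighted_integrable[OF d(3)])
  have "energy f f = (LINT x:{0<..}|lborel. complex_of_real (x powr (2 * \<sigma>) * (norm (vderiv f x))\<^sup>2
      + s\<^sup>2 * (x powr (2 * \<sigma> + 2) * (norm (f x))\<^sup>2)))"
    unfolding energy_def
    by (intro set_lebesgue_integral_cong) (auto simp: complex_norm_square scaleR_conv_of_real simp del: of_real_power)
  also have "\<dots> = complex_of_real (LINT x:{0<..}|lborel. x powr (2 * \<sigma>) * (norm (vderiv f x))\<^sup>2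
      + s\<^sup>2 * (x powr (2 * \<sigma> + 2) * (norm (f x))\<^sup>2))"
    by (rule set_integral_complex_of_real)
  also have "(LINT x:{0<..}|lborel. x powr (2 * \<sigma>) * (norm (vderiv f x))\<^sup>2
      + s\<^sup>2 * (x powr (2 * \<sigma> + 2) * (norm (f x))\<^sup>2)) = wint (2 * \<sigma>) (vderiv f) + s\<^sup>2 * wint (2 * \<sigma> + 2) f"
    by (simp add: set_integral_add(2)[OF i(2) set_integrable_mult_right[OF i(1)]] wint_def)
  finally show ?thesis .
qed

text \<open>The integrand of the inner product is the energy density minus the derivative of
  x^(2\<sigma>) f' times the conjugate of g. As f' is of order x at 0, this boundary expression has
  exponent 2\<sigma>+1 > 0.\<close>

lemma inner_energy:
  assumes f: "f \<in> schwartz_even" and \<phi>: "\<forall>x>0. \<phi> x = (x powr a) *\<^sub>R f x"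
    and g: "g \<in> schwartz_even" and \<psi>: "\<forall>x>0. \<psi> x = (x powr a) *\<^sub>R g x"
  shows "L2_inner M (P0 s c1 c2 \<phi>) \<psi> = energy f g"
proof -
  note df = schwartz_evenD[OF f] and dg = schwartz_evenD[OF g]
  define G where "G x = (x powr (2 * \<sigma>)) *\<^sub>R (vderiv f x * cnj (g x))" for x
  define G' where "G' x = (x powr (2 * \<sigma>)) *\<^sub>R (vderiv f x * cnj (vderiv g x) + vderiv (vderiv f) x * cnj (g x))
      + (2 * \<sigma> * x powr (2 * \<sigma> - 1)) *\<^sub>R (vderiv f x * cnj (g x))" for x
  have der: "(G has_vector_derivative G' x) (at x)" if "x > 0" for x
    unfolding G_def[abs_def] G'_def
    by (intro has_vector_derivative_scaleR has_real_derivative_powr that has_vector_derivative_mult has_vector_derivative_cnj df dg)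
  have dG: "decays (2 * \<sigma> + 1) G"
    unfolding G_def[abs_def] using decays_powr_scaleR[OF decays_mult_cnj[OF df(3) dg(2)], of "2 * \<sigma>"] by simp
  have dG': "decays (2 * \<sigma>) G'"
    unfolding G'_def[abs_def]
  proof (rule decays_add)
    have "decays 0 (\<lambda>x. vderiv f x * cnj (vderiv g x) + vderiv (vderiv f) x * cnj (g x))"
    proof (rule decays_add)
      show "decays 0 (\<lambda>x. vderiv f x * cnj (vderiv g x))"
        by (rule decays_weaken[OF decays_mult_cnj[OF df(3) dg(3)]]) simp
      show "decays 0 (\<lambda>x. vderiv (vderiv f) x * cnj (g x))"
        using decays_mult_cnj[OF df(4) dg(2)] by simp
    qed
    from decays_powr_scaleR[OF this, of "2 * \<sigma>"]
    show "decays (2 * \<sigma>) (\<lambda>x. (x powr (2 * \<sigma>)) *\<^sub>R (vderiv f x * cnj (vderiv g x) + vderiv (vderiv f) x * cnj (g x)))" by simp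
    from decays_scale[OF decays_powr_scaleR[OF decays_mult_cnj[OF df(3) dg(2)], of "2 * \<sigma> - 1"], of "2 * \<sigma>"]
    show "decays (2 * \<sigma>) (\<lambda>x. (2 * \<sigma> * x powr (2 * \<sigma> - 1)) *\<^sub>R (vderiv f x * cnj (g x)))" by simp
  qed
  have zero: "(LINT x:{0<..}|lborel. G' x) = 0"
    by (rule integral_derivative_zero[OF dG _ dG' _ der]) (use \<sigma>_gt in auto)
  have iG': "set_integrable lborel {0<..} G'" by (rule decays_integrable[OF dG']) (use \<sigma>_gt in simp)
  have \<phi>V: "\<phi> \<in> V" "\<psi> \<in> V" using V_I[OF f \<phi>] V_I[OF g \<psi>] by blast+
  have "L2_inner M (P0 s c1 c2 \<phi>) \<psi> = (LINT x:{0<..}|lborel. (x powr (2 * c1)) *\<^sub>R (P0 s c1 c2 \<phi> x * cnj (\<psi> x)))"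
    unfolding L2_inner_def
    by (rule integral_half_line) (intro borel_measurable_integrable L2_mult_integrable V_L2 \<phi>V)
  also have "\<dots> = (LINT x:{0<..}|lborel. ((x powr (2 * \<sigma>)) *\<^sub>R (vderiv f x * cnj (vderiv g x))
     + (s\<^sup>2 * x powr (2 * \<sigma> + 2)) *\<^sub>R (f x * cnj (g x))) - G' x)"
  proof (rule set_lebesgue_integral_cong)
    show "\<forall>x. x \<in> {0<..} \<longrightarrow> (x powr (2 * c1)) *\<^sub>R (P0 s c1 c2 \<phi> x * cnj (\<psi> x)) =
        ((x powr (2 * \<sigma>)) *\<^sub>R (vderiv f x * cnj (vderiv g x)) + (s\<^sup>2 * x powr (2 * \<sigma> + 2)) *\<^sub>R (f x * cnj (g x))) - G' x"
    proof (intro allI impI)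
      fix x :: real assume "x \<in> {0<..}"
      then have x: "x > 0" by simp
      define X where "X = x powr (2 * \<sigma>)"
      have X: "x powr (2 * c1) * (x powr a * x powr a) = X"
        unfolding X_def powr_add[symmetric] by (rule arg_cong[of _ _ "\<lambda>p. x powr p"]) (simp add: \<sigma>_def)
      have X2: "x powr (2 * \<sigma> + 2) = X * x\<^sup>2" using x by (simp add: X_def powr_add powr_numeral)
      have X1: "x powr (2 * \<sigma> - 1) = X * x powr - 1" unfolding X_def powr_add[symmetric] by simp
      have "(x powr (2 * c1)) *\<^sub>R (P0 s c1 c2 \<phi> x * cnj (\<psi> x)) = X *\<^sub>R (Lop f x * cnj (g x))"
        unfolding P0_eq[OF f \<phi> x] \<psi>[rule_format, OF x] X[symmetric] by simp
      then show "(x powr (2 * c1)) *\<^sub>R (P0 s c1 c2 \<phi> x * cnj (\<psi> x)) =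
        ((x powr (2 * \<sigma>)) *\<^sub>R (vderiv f x * cnj (vderiv g x)) + (s\<^sup>2 * x powr (2 * \<sigma> + 2)) *\<^sub>R (f x * cnj (g x))) - G' x"
        unfolding G'_def X2 X1 X_def[symmetric] Lop_def by (simp add: scaleR_conv_of_real algebra_simps)
    qed
  qed simp
  also have "\<dots> = energy f g"
  proof -
    have "decays (2 * \<sigma>) (\<lambda>x. (x powr (2 * \<sigma>)) *\<^sub>R (vderiv f x * cnj (vderiv g x)))"
      by (rule decays_weaken[OF decays_powr_scaleR[OF decays_mult_cnj[OF df(3) dg(3)]]]) simp
    moreover have "decays (2 * \<sigma>) (\<lambda>x. s\<^sup>2 *\<^sub>R ((x powr (2 * \<sigma> + 2)) *\<^sub>R (f x * cnj (g x))))"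
      by (rule decays_weaken[OF decays_scale[OF decays_powr_scaleR[OF decays_mult_cnj[OF df(2) dg(2)]]]]) simp
    ultimately have "set_integrable lborel {0<..} (\<lambda>x. (x powr (2 * \<sigma>)) *\<^sub>R (vderiv f x * cnj (vderiv g x))
      + (s\<^sup>2 * x powr (2 * \<sigma> + 2)) *\<^sub>R (f x * cnj (g x)))"
      using \<sigma>_gt by (intro decays_integrable[of "2 * \<sigma>"]) (auto dest: decays_add)
    then show ?thesis by (simp add: set_integral_diff(2) iG' zero energy_def)
  qed
  finally show ?thesis .
qed

lemma P0_symmetric:
  assumes "\<phi> \<in> V" "\<psi> \<in> V"
  shows "L2_inner M (P0 s c1 c2 \<phi>) \<psi> = cnj (L2_inner M (P0 s c1 c2 \<psi>) \<phi>)"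
proof -
  obtain f where f: "f \<in> schwartz_even" "\<forall>x>0. \<phi> x = (x powr a) *\<^sub>R f x" using assms(1) by (rule V_E) blast
  obtain g where g: "g \<in> schwartz_even" "\<forall>x>0. \<psi> x = (x powr a) *\<^sub>R g x" using assms(2) by (rule V_E) blast
  show ?thesis unfolding inner_energy[OF f g] inner_energy[OF g f] by (rule energy_commute)
qed

lemma V_linear:
  assumes "\<phi> \<in> V" "\<psi> \<in> V"
  shows "(\<lambda>x. c * \<phi> x + d * \<psi> x) \<in> V"
proof -
  obtain f where f: "f \<in> schwartz_even" "\<forall>x>0. \<phi> x = (x powr a) *\<^sub>R f x" using assms(1) by (rule V_E) blast
  obtain g where g: "g \<in> schwartz_even" "\<forall>x>0. \<psi> x = (x powr a) *\<^sub>R g x" using assms(2) by (rule V_E) blast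
  show ?thesis
  proof (rule V_I)
    show "(\<lambda>x. c * f x + d * g x) \<in> schwartz_even"
      using f(1) g(1) by (auto simp: schwartz_even_def intro: schwartz_linear)
  qed (simp add: f(2) g(2) scaleR_add_right)
qed

lemma V_sum:
  fixes N :: nat
  assumes "\<And>n. h n \<in> V"
  shows "(\<lambda>x. \<Sum>n<N. c n * h n x) \<in> V"
proof (induction N)
  case 0
  show ?case using V_linear[OF assms[of 0] assms[of 0], of 0 0] by simp
next
  case (Suc N)
  show ?case using V_linear[OF Suc assms[of N], of 1 "c N"] by simp
qed

end

lemma pderiv_sum: "pderiv (\<Sum>i\<in>A. f i) = (\<Sum>i\<in>A. pderiv (f i))"
  by (induction A rule: infinite_finite_induct) (auto simp: pderiv_add)

section \<open>Laguerre functions: eigenvalue equation, orthogonality, completeness\<close>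

context oscillator
begin

text \<open>Coefficients of the Laguerre polynomial of degree n and parameter \<sigma> - 1/2 in the
  variable s x^2, normalised to the value 1 at 0. The factor n - j makes the recursion
  terminate.\<close>

primrec lagc :: "nat \<Rightarrow> nat \<Rightarrow> real" where
  "lagc n 0 = 1"
| "lagc n (Suc j) = - 4 * s * (real n - real j) / ((2 * real j + 2) * (2 * real j + 1 + 2 * \<sigma>)) * lagc n j"

lemma lagc_Suc_mult:
  "(2 * real j + 2) * (2 * real j + 1 + 2 * \<sigma>) * lagc n (Suc j) = - 4 * s * (real n - real j) * lagc n j"
proof -
  have "(2 * real j + 2) * (2 * real j + 1 + 2 * \<sigma>) \<noteq> 0" using \<sigma>_gt by (simp add: add_pos_pos less_imp_neq[symmetric])
  then show ?thesis by simp
qed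

lemma lagc_nonzero: "j \<le> n \<Longrightarrow> lagc n j \<noteq> 0"
proof (induction j)
  case (Suc j)
  have "- 4 * s * (real n - real j) * lagc n j \<noteq> 0" using Suc s_pos by simp
  then show ?case using lagc_Suc_mult[of j n] by auto
qed simp

definition lagp :: "nat \<Rightarrow> real poly" where
  "lagp n = (\<Sum>j\<le>n. monom (lagc n j) (2 * j))"

lemma poly_lagp: "poly (lagp n) x = (\<Sum>j\<le>n. lagc n j * x ^ (2 * j))"
  by (simp add: lagp_def poly_sum poly_monom)

lemma x_pderiv_monom: "x * poly (pderiv (monom c k)) x = real k * c * x ^ k"
  by (cases k) (simp_all add: pderiv_monom poly_monom)

lemma pderiv_lagp:
  "x * poly (pderiv (lagp n)) x = (\<Sum>j\<le>n. 2 * real j * lagc n j * x ^ (2 * j))"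
  by (simp add: lagp_def pderiv_sum poly_sum sum_distrib_left x_pderiv_monom)

lemma pderiv2_lagp:
  "x\<^sup>2 * poly (pderiv (pderiv (lagp n))) x = (\<Sum>j\<le>n. 2 * real j * (2 * real j - 1) * lagc n j * x ^ (2 * j))"
proof -
  have "x\<^sup>2 * poly (pderiv (pderiv (monom c k))) x = real k * (real k - 1) * c * x ^ k" for c k
  proof (cases k)
    case (Suc i)
    have "x\<^sup>2 * poly (pderiv (pderiv (monom c k))) x = x * (x * poly (pderiv (monom (real k * c) i)) x)"
      by (simp add: Suc pderiv_monom power2_eq_square)
    also have "\<dots> = x * (real i * (real k * c) * x ^ i)" by (simp only: x_pderiv_monom)
    finally show ?thesis by (simp add: Suc)
  qed (simp add: pderiv_monom)
  then show ?thesis by (simp add: lagp_def pderiv_sum poly_sum sum_distrib_left)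
qed

lemma lagp_ode:
  "- (x\<^sup>2 * poly (pderiv (pderiv (lagp n))) x) - 2 * \<sigma> * (x * poly (pderiv (lagp n)) x)
    + 2 * s * x\<^sup>2 * (x * poly (pderiv (lagp n)) x) = 4 * real n * s * x\<^sup>2 * poly (lagp n) x"
proof -
  \<comment> \<open>Comparing coefficients becomes telescoping: by the recursion each summand of the
    equation is \<open>c (Suc j) - c j\<close>. Both ends vanish, the upper one because
    \<open>lagc n (Suc n)\<close> is 0.\<close>
  define c where "c j = 2 * real j * (2 * real j - 1 + 2 * \<sigma>) * lagc n j * x ^ (2 * j)" for j
  have "lagc n (Suc n) = 0" by simp
  then have cn: "c (Suc n) = 0" by (simp add: c_def del: lagc.simps)
  have "- (x\<^sup>2 * poly (pderiv (pderiv (lagp n))) x) - 2 * \<sigma> * (x * poly (pderiv (lagp n)) x)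
    + 2 * s * x\<^sup>2 * (x * poly (pderiv (lagp n)) x) - 4 * real n * s * x\<^sup>2 * poly (lagp n) x
    = (\<Sum>j\<le>n. c (Suc j) - c j)"
    unfolding pderiv2_lagp pderiv_lagp poly_lagp sum_distrib_left sum_negf[symmetric] sum_subtractf[symmetric] sum.distrib[symmetric]
  proof (intro sum.cong refl)
    fix j
    have "c (Suc j) = ((2 * real j + 2) * (2 * real j + 1 + 2 * \<sigma>) * lagc n (Suc j)) * (x\<^sup>2 * x ^ (2 * j))"
      by (simp add: c_def algebra_simps power2_eq_square del: lagc.simps)
    also have "\<dots> = - 4 * s * (real n - real j) * lagc n j * (x\<^sup>2 * x ^ (2 * j))"
      unfolding lagc_Suc_mult ..
    finally show "- (2 * real j * (2 * real j - 1) * lagc n j * x ^ (2 * j)) - 2 * \<sigma> * (2 * real j * lagc n j * x ^ (2 * j))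
      + 2 * s * x\<^sup>2 * (2 * real j * lagc n j * x ^ (2 * j)) - 4 * real n * s * x\<^sup>2 * (lagc n j * x ^ (2 * j)) = c (Suc j) - c j"
      by (simp add: c_def algebra_simps)
  qed
  also have "\<dots> = c (Suc n) - c 0"
    using sum_lessThan_telescope[of c "Suc n"] by (simp add: lessThan_Suc_atMost)
  also have "\<dots> = 0" by (simp add: cn) (simp add: c_def)
  finally show ?thesis by linarith
qed

definition lagf :: "nat \<Rightarrow> real \<Rightarrow> complex" where
  "lagf n = gauss_poly s (lagp n)"

definition \<mu> :: "nat \<Rightarrow> real" where
  "\<mu> n = (4 * real n + 1 + 2 * \<sigma>) * s"

lemma gauss_even: "s' > 0 \<Longrightarrow> (\<And>x. poly p (- x) = poly p x) \<Longrightarrow> gauss_poly s' p \<in> schwartz_even"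
  by (simp add: schwartz_even_def gauss_poly_schwartz) (simp add: gauss_poly_def)

lemma lagf_even: "lagf n \<in> schwartz_even"
  unfolding lagf_def by (rule gauss_even[OF s_pos]) (simp add: poly_lagp)

lemma Lop_lagf:
  assumes x: "x > 0"
  shows "Lop (lagf n) x = complex_of_real (\<mu> n) * lagf n x"
proof -
  define q q1 q2 where "q = poly (lagp n) x" "q1 = poly (pderiv (lagp n)) x" "q2 = poly (pderiv (pderiv (lagp n))) x"
  define E where "E = exp (- s * x\<^sup>2 / 2)"
  have v0: "lagf n x = complex_of_real (q * E)" by (simp add: lagf_def gauss_poly_def q_q1_q2_def E_def)
  have v1: "vderiv (lagf n) x = complex_of_real ((q1 - s * (x * q)) * E)"
    by (simp add: lagf_def vderiv_gauss_poly gauss_poly_def q_q1_q2_def E_def)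
  have v2: "vderiv (vderiv (lagf n)) x = complex_of_real ((q2 - s * (q + x * q1) - s * (x * (q1 - s * (x * q)))) * E)"
  proof -
    define r where "r = pderiv (lagp n) - smult s (pCons 0 (lagp n))"
    have "poly (pderiv r - smult s (pCons 0 r)) x = q2 - s * (q + x * q1) - s * (x * (q1 - s * (x * q)))"
      by (simp add: r_def q_q1_q2_def pderiv_diff pderiv_smult pderiv_pCons algebra_simps)
    moreover have "vderiv (vderiv (lagf n)) x = complex_of_real (poly (pderiv r - smult s (pCons 0 r)) x * E)"
      by (simp only: lagf_def vderiv_gauss_poly gauss_poly_def r_def E_def)
    ultimately show ?thesis by simp
  qed
  have ode: "- (x\<^sup>2 * q2) - 2 * \<sigma> * (x * q1) + 2 * s * x\<^sup>2 * (x * q1) = 4 * real n * s * x\<^sup>2 * q"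
    unfolding q_q1_q2_def by (rule lagp_ode)
  have "x\<^sup>2 * (- (q2 - s * (q + x * q1) - s * (x * (q1 - s * (x * q)))) + s\<^sup>2 * x\<^sup>2 * q - 2 * \<sigma> * (1 / x) * (q1 - s * (x * q)))
      = x\<^sup>2 * (\<mu> n * q)"
    using x ode by (simp add: \<mu>_def field_simps power2_eq_square) 
  then have key: "- (q2 - s * (q + x * q1) - s * (x * (q1 - s * (x * q)))) + s\<^sup>2 * x\<^sup>2 * q - 2 * \<sigma> * (1 / x) * (q1 - s * (x * q)) = \<mu> n * q"
    using x by simp
  define y where "y = x powr - 1"
  have y: "1 / x = y" using x by (simp add: y_def powr_minus_divide)
  have "Lop (lagf n) x = complex_of_real ((- (q2 - s * (q + x * q1) - s * (x * (q1 - s * (x * q)))) + s\<^sup>2 * x\<^sup>2 * q - 2 * \<sigma> * y * (q1 - s * (x * q))) * E)"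
    unfolding Lop_def v0 v1 v2 y_def[symmetric] by (simp add: scaleR_conv_of_real algebra_simps)
  then show ?thesis unfolding key[unfolded y] v0 by (simp add: mult.assoc)
qed

definition lag :: "nat \<Rightarrow> real \<Rightarrow> complex" where
  "lag n x = (x powr a) *\<^sub>R lagf n x"

lemma lag_V: "lag n \<in> V"
  by (rule V_I[OF lagf_even[of n]]) (simp add: lag_def)

lemma lag_L2: "lag n \<in> L2 M"
  by (rule V_L2(1)[OF lag_V])

lemma P0_lag: "x > 0 \<Longrightarrow> P0 s c1 c2 (lag n) x = complex_of_real (\<mu> n) * lag n x"
proof -
  assume x: "x > 0"
  have "P0 s c1 c2 (lag n) x = (x powr a) *\<^sub>R Lop (lagf n) x"
    by (rule P0_eq[OF lagf_even[of n] _ x]) (simp add: lag_def)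
  then show ?thesis by (simp add: Lop_lagf[OF x] lag_def)
qed

lemma P0_inner_lag:
  assumes "\<phi> \<in> V"
  shows "L2_inner M (P0 s c1 c2 \<phi>) (lag n) = complex_of_real (\<mu> n) * L2_inner M \<phi> (lag n)"
proof -
  have "L2_inner M (P0 s c1 c2 (lag n)) \<phi> = L2_inner M (\<lambda>x. complex_of_real (\<mu> n) * lag n x) \<phi>"
    by (rule L2_inner_half_line_cong) (simp_all add: P0_lag)
  then have "L2_inner M (P0 s c1 c2 \<phi>) (lag n) = cnj (complex_of_real (\<mu> n) * L2_inner M (lag n) \<phi>)"
    unfolding P0_symmetric[OF assms lag_V] by (simp add: L2_inner_scale_left)
  then show ?thesis by (simp add: L2_inner_commute[of M \<phi>])
qed

lemma lag_orthogonal: "m \<noteq> n \<Longrightarrow> L2_inner M (lag m) (lag n) = 0"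
proof -
  assume mn: "m \<noteq> n"
  have "L2_inner M (P0 s c1 c2 (lag m)) (lag n) = complex_of_real (\<mu> m) * L2_inner M (lag m) (lag n)"
    unfolding L2_inner_scale_left[symmetric] by (rule L2_inner_half_line_cong) (simp_all add: P0_lag)
  moreover have "\<mu> m \<noteq> \<mu> n" using mn s_pos by (simp add: \<mu>_def)
  ultimately show ?thesis unfolding P0_inner_lag[OF lag_V] by simp
qed

text \<open>The polynomial has constant term 1, hence finitely many zeros, and cannot vanish almost
  everywhere on the half-line.\<close>

lemma lag_norm_pos: "L2_norm M (lag n) > 0"
proof (rule ccontr)
  assume "\<not> ?thesis"
  then have "L2_norm M (lag n) = 0" using L2_norm_nonneg[of M "lag n"] by linarith
  then have "AE x in M. lag n x = 0" using L2_norm_zero_iff[OF lag_L2] by simp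
  then have ae: "AE x in lborel. x > 0 \<longrightarrow> poly (lagp n) x = 0"
    unfolding AE_half_line by eventually_elim (simp add: lag_def lagf_def gauss_poly_def)
  have "poly (lagp n) 0 = 1"
    unfolding poly_lagp by (simp add: power_0_left if_distrib[of "\<lambda>y. _ * y"] cong: if_cong)
  then have "lagp n \<noteq> 0" by auto
  then have "finite {x. poly (lagp n) x = 0}" by (rule poly_roots_finite)
  then have "{x. poly (lagp n) x = 0} \<in> null_sets lborel" by (rule finite_imp_null_set_lborel)
  then have "AE x in lborel. poly (lagp n) x \<noteq> 0" using AE_not_in by force
  with ae have "AE x in lborel. x \<notin> {0<..<1::real}" by eventually_elim auto
  then have "emeasure lborel {0<..<1::real} = 0" by (subst (asm) AE_iff_measurable[of "{0<..<1::real}"]) auto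
  then show False by simp
qed

definition lagn :: "nat \<Rightarrow> real \<Rightarrow> complex" where
  "lagn n x = complex_of_real (1 / L2_norm M (lag n)) * lag n x"

lemma lagn_V: "lagn n \<in> V"
  using V_linear[OF lag_V lag_V, of "complex_of_real (1 / L2_norm M (lag n))" n 0 n] by (simp add: lagn_def[abs_def])

lemma inner_lagn: "L2_inner M f (lagn n) = complex_of_real (1 / L2_norm M (lag n)) * L2_inner M f (lag n)"
proof -
  have "L2_inner M (lagn n) f = complex_of_real (1 / L2_norm M (lag n)) * L2_inner M (lag n) f"
    unfolding lagn_def[abs_def] by (rule L2_inner_scale_left)
  then show ?thesis by (simp add: L2_inner_commute[of M f])
qed

text \<open>Inner products with the Laguerre functions are triangular combinations, with nonzero
  diagonal, of the Gaussian moments of one function \<open>F\<close>. If all of them vanish, so do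
  the moments, and \<open>moments_determine\<close> applies.\<close>

lemma lag_complete:
  assumes \<phi>: "\<phi> \<in> L2 M" and zero: "\<And>n. L2_inner M \<phi> (lag n) = 0"
  shows "AE x in M. \<phi> x = 0"
proof -
  define F where "F x = indicator {0<..} x *\<^sub>R ((x powr (2 * c1)) *\<^sub>R ((x powr a) *\<^sub>R \<phi> x))" for x
  \<comment> \<open>The parameter is doubled because \<open>gauss_poly\<close> has exponent - s x^2
    / 2; the Laguerre functions then belong to t = s/2.\<close>
  define \<psi> where "\<psi> t k x = (x powr a) *\<^sub>R gauss_poly (2 * t) (monom 1 (2 * k)) x" for t k and x :: real
  have \<psi>: "\<psi> t k \<in> L2 M" if "t > 0" for t k
  proof (rule V_L2(1), rule V_I)
    show "gauss_poly (2 * t) (monom 1 (2 * k)) \<in> schwartz_even"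
      using that by (intro gauss_even) (auto simp: poly_monom)
  qed (simp add: \<psi>_def)
  have eq: "indicator {0<..} x *\<^sub>R ((x powr (2 * c1)) *\<^sub>R (\<phi> x * cnj (\<psi> t k x))) = (x ^ (2 * k) * exp (- t * x\<^sup>2)) *\<^sub>R F x" for t k and x :: real
    by (simp add: F_def \<psi>_def gauss_poly_def poly_monom scaleR_conv_of_real mult_ac)
  have meas: "(\<lambda>x. \<phi> x * cnj (\<psi> t k x)) \<in> borel_measurable M" if "t > 0" for t k
    by (rule borel_measurable_integrable[OF L2_mult_integrable[OF \<phi> \<psi>[OF that]]])
  have int: "integrable lborel (\<lambda>x. (x ^ (2 * k) * exp (- t * x\<^sup>2)) *\<^sub>R F x)" if "t > 0" for t k
    using L2_mult_integrable[OF \<phi> \<psi>[OF that, of k]]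
    unfolding integrable_half_line[OF meas[OF that]] set_integrable_def eq .
  interpret gaussian_integrable F by unfold_locales (rule int)
  have mom: "moment t k = L2_inner M \<phi> (\<psi> t k)" if "t > 0" for t k
    unfolding L2_inner_def integral_half_line[OF meas[OF that]] set_lebesgue_integral_def eq moment_def ..
  have s2: "s / 2 > 0" using s_pos by simp
  have lag_sum: "lag n x = (\<Sum>j\<le>n. complex_of_real (lagc n j) * \<psi> (s / 2) j x)" for n x
    unfolding lag_def lagf_def \<psi>_def gauss_poly_def poly_lagp poly_monom
    by (simp add: sum_distrib_right scaleR_sum_right) (simp add: scaleR_conv_of_real mult_ac)
  have inner_lag: "L2_inner M \<phi> (lag n) = (\<Sum>j\<le>n. complex_of_real (lagc n j) * moment (s / 2) j)" for n
    unfolding lag_sum[abs_def] mom[OF s2]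
    by (subst L2_inner_sum_right) (auto intro: \<psi>[OF s2] \<phi>)
  have m0: "moment (s / 2) k = 0" for k
  proof (induction k rule: less_induct)
    case (less k)
    have "(\<Sum>j\<le>k. complex_of_real (lagc k j) * moment (s / 2) j) = complex_of_real (lagc k k) * moment (s / 2) k"
      by (subst sum.remove[of _ k]) (auto intro!: sum.neutral less)
    then show ?case using inner_lag[of k] zero[of k] lagc_nonzero[of k k] by simp
  qed
  have "AE x in lborel. F x = 0" by (rule moments_determine[OF m0 s2]) (simp add: F_def)
  then show ?thesis unfolding AE_half_line by eventually_elim (auto simp: F_def)
qed

sublocale L2_basis M lagn
proof
  show "lagn n \<in> L2 M" for n by (rule V_L2(1)[OF lagn_V])
  show "L2_inner M (lagn m) (lagn n) = (if m = n then 1 else 0)" for m n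
  proof -
    have "L2_inner M (lagn m) (lagn n) = complex_of_real (1 / L2_norm M (lag n)) * (complex_of_real (1 / L2_norm M (lag m)) * L2_inner M (lag m) (lag n))"
      unfolding inner_lagn by (simp only: lagn_def[abs_def] L2_inner_scale_left)
    also have "\<dots> = (if m = n then 1 else 0)"
    proof (cases "m = n")
      case True
      have "complex_of_real (1 / L2_norm M (lag n)) * (complex_of_real (1 / L2_norm M (lag n)) * L2_inner M (lag n) (lag n)) = complex_of_real 1"
        unfolding L2_inner_self of_real_mult[symmetric]
        using lag_norm_pos[of n] by (simp add: power2_eq_square)
      then show ?thesis using True by simp
    next
      case False
      then show ?thesis by (simp add: lag_orthogonal)
    qed
    finally show ?thesis .
  qed
  fix f assume f: "f \<in> L2 M" and z: "\<And>n. L2_inner M f (lagn n) = 0"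
  have "L2_inner M f (lag n) = 0" for n using z[of n] lag_norm_pos[of n] by (simp add: inner_lagn)
  then show "AE x in M. f x = 0" by (rule lag_complete[OF f])
qed

lemma P0_inner_lagn: "\<phi> \<in> V \<Longrightarrow> L2_inner M (P0 s c1 c2 \<phi>) (lagn n) = complex_of_real (\<mu> n) * L2_inner M \<phi> (lagn n)"
  by (simp add: inner_lagn P0_inner_lag)

text \<open>The Laguerre functions are real valued; this supplies the real matrix entries on which
  the use of pairs of real sequences rests.\<close>

lemma weighted_lagn_inner_real:
  "L2_inner M (\<lambda>x. w x *\<^sub>R lagn m x) (\<lambda>x. w x *\<^sub>R lagn n x)
    = complex_of_real (Re (L2_inner M (\<lambda>x. w x *\<^sub>R lagn m x) (\<lambda>x. w x *\<^sub>R lagn n x)))"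
proof -
  have real: "cnj (lagn n x) = lagn n x" for n x by (simp add: lagn_def lag_def lagf_def gauss_poly_def)
  have "cnj (L2_inner M (\<lambda>x. w x *\<^sub>R lagn m x) (\<lambda>x. w x *\<^sub>R lagn n x)) = L2_inner M (\<lambda>x. w x *\<^sub>R lagn m x) (\<lambda>x. w x *\<^sub>R lagn n x)"
    unfolding L2_inner_def by (subst Bochner_Integration.integral_cnj[symmetric]) (simp add: real)
  then show ?thesis by (metis complex_In_mult_cnj_zero complex_is_Real_iff Reals_cnj_iff of_real_Re)
qed

lemma \<mu>_pos: "\<mu> n > 0"
proof -
  have "4 * real n + 1 + 2 * \<sigma> > 0" using \<sigma>_gt by linarith
  then show ?thesis using s_pos by (simp add: \<mu>_def)
qed

lemma \<mu>_mono: "m \<le> n \<Longrightarrow> \<mu> m \<le> \<mu> n"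
  using s_pos by (simp add: \<mu>_def)

lemma \<mu>_top: "filterlim \<mu> at_top sequentially"
proof -
  have "filterlim (\<lambda>n. (1 + 2 * \<sigma>) * s + (4 * s) * real n) at_top sequentially"
    using s_pos by (intro filterlim_tendsto_add_at_top[OF tendsto_const] filterlim_tendsto_pos_mult_at_top[OF tendsto_const] filterlim_real_sequentially) auto
  moreover have "(\<lambda>n. (1 + 2 * \<sigma>) * s + (4 * s) * real n) = \<mu>" by (auto simp: \<mu>_def algebra_simps)
  ultimately show ?thesis by simp
qed

text \<open>Lets the norm term in the Hardy inequality be absorbed into the energy, as the single
  constant in \<open>w_bound\<close> requires.\<close>

lemma energy_ge:
  assumes "\<phi> \<in> V"
  shows "\<mu> 0 * (L2_norm M \<phi>)\<^sup>2 \<le> Re (L2_inner M (P0 s c1 c2 \<phi>) \<phi>)"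
proof (rule sums_le)
  show "(\<lambda>n. \<mu> 0 * (cmod (co \<phi> n))\<^sup>2) sums (\<mu> 0 * (L2_norm M \<phi>)\<^sup>2)"
    by (intro sums_mult norm_sums V_L2 assms)
  show "(\<lambda>n. Re (co (P0 s c1 c2 \<phi>) n * cnj (co \<phi> n))) sums Re (L2_inner M (P0 s c1 c2 \<phi>) \<phi>)"
    by (intro sums_Re Parseval V_L2 assms)
  show "\<mu> 0 * (cmod (co \<phi> n))\<^sup>2 \<le> Re (co (P0 s c1 c2 \<phi>) n * cnj (co \<phi> n))" for n
  proof -
    have "Re (co (P0 s c1 c2 \<phi>) n * cnj (co \<phi> n)) = \<mu> n * (cmod (co \<phi> n))\<^sup>2"
      unfolding P0_inner_lagn[OF assms] mult.assoc complex_norm_square[symmetric] by simp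
    then show ?thesis using \<mu>_mono[of 0 n] by (simp add: mult_right_mono)
  qed
qed

end

section \<open>The perturbed operator\<close>

text \<open>Chosen without reference to \<open>s\<close>, as the theorem fixes C before s.
  Positivity stands outside the implication because C is required to be positive at all
  arguments.\<close>

definition hardy_const :: "real \<Rightarrow> real \<Rightarrow> real \<Rightarrow> real" where
  "hardy_const \<epsilon> \<sigma> u = (SOME C. C > 0 \<and> (0 < u \<and> u < 1 \<and> \<sigma> > u - 1 / 2 \<and> \<epsilon> > 0 \<longrightarrow>
    (\<forall>s>0. \<forall>f\<in>schwartz_even. wint (2 * \<sigma> - 2 * u) f \<le>
      \<epsilon> * s powr (u - 1) * (wint (2 * \<sigma>) (vderiv f) + s\<^sup>2 * wint (2 * \<sigma> + 2) f) + C * s powr u * wint (2 * \<sigma>) f)))"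

lemma hardy_const:
  shows "hardy_const \<epsilon> \<sigma> u > 0"
    and "0 < u \<Longrightarrow> u < 1 \<Longrightarrow> \<sigma> > u - 1 / 2 \<Longrightarrow> \<epsilon> > 0 \<Longrightarrow> s > 0 \<Longrightarrow> f \<in> schwartz_even \<Longrightarrow>
      wint (2 * \<sigma> - 2 * u) f \<le> \<epsilon> * s powr (u - 1) * (wint (2 * \<sigma>) (vderiv f) + s\<^sup>2 * wint (2 * \<sigma> + 2) f)
        + hardy_const \<epsilon> \<sigma> u * s powr u * wint (2 * \<sigma>) f"
proof -
  let ?P = "\<lambda>C. C > 0 \<and> (0 < u \<and> u < 1 \<and> \<sigma> > u - 1 / 2 \<and> \<epsilon> > 0 \<longrightarrow>
    (\<forall>s>0. \<forall>f\<in>schwartz_even. wint (2 * \<sigma> - 2 * u) f \<le>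
      \<epsilon> * s powr (u - 1) * (wint (2 * \<sigma>) (vderiv f) + s\<^sup>2 * wint (2 * \<sigma> + 2) f) + C * s powr u * wint (2 * \<sigma>) f))"
  have "\<exists>C. ?P C"
  proof (cases "0 < u \<and> u < 1 \<and> \<sigma> > u - 1 / 2 \<and> \<epsilon> > 0")
    case True
    then obtain C where "C > 0" "\<And>s f. s > 0 \<Longrightarrow> f \<in> schwartz_even \<Longrightarrow> wint (2 * \<sigma> - 2 * u) f \<le>
      \<epsilon> * s powr (u - 1) * (wint (2 * \<sigma>) (vderiv f) + s\<^sup>2 * wint (2 * \<sigma> + 2) f) + C * s powr u * wint (2 * \<sigma>) f"
      using hardy_inequality[of u \<sigma> \<epsilon>] by blast
    then show ?thesis by blast
  next
    case False
    then show ?thesis by (intro exI[of _ 1]) auto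
  qed
  then have "?P (hardy_const \<epsilon> \<sigma> u)" unfolding hardy_const_def by (rule someI_ex)
  then show "hardy_const \<epsilon> \<sigma> u > 0"
    and "0 < u \<Longrightarrow> u < 1 \<Longrightarrow> \<sigma> > u - 1 / 2 \<Longrightarrow> \<epsilon> > 0 \<Longrightarrow> s > 0 \<Longrightarrow> f \<in> schwartz_even \<Longrightarrow>
      wint (2 * \<sigma> - 2 * u) f \<le> \<epsilon> * s powr (u - 1) * (wint (2 * \<sigma>) (vderiv f) + s\<^sup>2 * wint (2 * \<sigma> + 2) f)
        + hardy_const \<epsilon> \<sigma> u * s powr u * wint (2 * \<sigma>) f"
    by blast+
qed

text \<open>The point \<open>tangent_factor \<mu> / s\<^sup>2\<close> is where the tangent to \<open>y powr (- u)\<close> is taken;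
  the factor is large enough for the comparison form to keep a nonnegative multiple of \<open>P0\<close>.\<close>

definition tangent_factor :: "real \<Rightarrow> real \<Rightarrow> real \<Rightarrow> real \<Rightarrow> real" where
  "tangent_factor s \<xi> \<sigma> u = max 1 (s / (1 + 2 * \<sigma>) * (\<xi> * u / s\<^sup>2) powr (1 / (u + 1)))"

text \<open>The tangent point for index k is \<open>tangent_factor\<close> times (2k+1+2\<sigma>)/s.
  Its power -u produces the first factor, and the bound 2k+1+2\<sigma> \<le> (2+2|\<sigma>|)(k+1)
  the second.\<close>

definition lower_const :: "real \<Rightarrow> real \<Rightarrow> real \<Rightarrow> real \<Rightarrow> real" where
  "lower_const s \<xi> \<sigma> u = tangent_factor s \<xi> \<sigma> u powr (- u) * (2 + 2 * \<bar>\<sigma>\<bar>) powr (- u)"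

lemma lower_const_pos: "lower_const s \<xi> \<sigma> u > 0"
proof -
  have "tangent_factor s \<xi> \<sigma> u > 0" by (simp add: tangent_factor_def)
  then show ?thesis by (simp add: lower_const_def)
qed

section \<open>Form bounds for x^(-2u) and the resulting constants\<close>

context oscillator
begin

lemma form_values:
  assumes "\<phi> \<in> V" "\<sigma> > u - 1 / 2"
  obtains f where "f \<in> schwartz_even" "(L2_norm M \<phi>)\<^sup>2 = wint (2 * \<sigma>) f"
    "(L2_norm M (\<lambda>x. (x powr (- u)) *\<^sub>R \<phi> x))\<^sup>2 = wint (2 * \<sigma> - 2 * u) f"
    "Re (L2_inner M (P0 s c1 c2 \<phi>) \<phi>) = wint (2 * \<sigma>) (vderiv f) + s\<^sup>2 * wint (2 * \<sigma> + 2) f"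
proof -
  obtain f where f: "f \<in> schwartz_even" "\<forall>x>0. \<phi> x = (x powr a) *\<^sub>R f x" using assms(1) by (rule V_E) blast
  have "(L2_norm M (\<lambda>x. (x powr (- 0)) *\<^sub>R \<phi> x))\<^sup>2 = wint (2 * \<sigma> - 2 * 0) f"
    by (rule norm_sq_wint[OF f V_L2(3)[OF assms(1)]]) (use \<sigma>_gt in simp)
  moreover have "L2_norm M (\<lambda>x. (x powr (- 0)) *\<^sub>R \<phi> x) = L2_norm M \<phi>"
    by (rule L2_norm_half_line_cong) simp
  ultimately have "(L2_norm M \<phi>)\<^sup>2 = wint (2 * \<sigma>) f" by simp
  moreover have "Re (L2_inner M (P0 s c1 c2 \<phi>) \<phi>) = wint (2 * \<sigma>) (vderiv f) + s\<^sup>2 * wint (2 * \<sigma> + 2) f"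
    unfolding inner_energy[OF f f] energy_self[OF f(1)] by simp
  ultimately show ?thesis using that[OF f(1)] norm_sq_wint[OF f V_L2(3)[OF assms(1,2)]] by blast
qed

lemma upper_form_bound:
  assumes "\<phi> \<in> V" "0 < u" "u < 1" "\<sigma> > u - 1 / 2" "\<epsilon> > 0"
  shows "(L2_norm M (\<lambda>x. (x powr (- u)) *\<^sub>R \<phi> x))\<^sup>2 \<le>
    \<epsilon> * s powr (u - 1) * Re (L2_inner M (P0 s c1 c2 \<phi>) \<phi>) + hardy_const \<epsilon> \<sigma> u * s powr u * (L2_norm M \<phi>)\<^sup>2"
proof -
  obtain f where f: "f \<in> schwartz_even" "(L2_norm M \<phi>)\<^sup>2 = wint (2 * \<sigma>) f"
    "(L2_norm M (\<lambda>x. (x powr (- u)) *\<^sub>R \<phi> x))\<^sup>2 = wint (2 * \<sigma> - 2 * u) f"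
    "Re (L2_inner M (P0 s c1 c2 \<phi>) \<phi>) = wint (2 * \<sigma>) (vderiv f) + s\<^sup>2 * wint (2 * \<sigma> + 2) f"
    using assms(1,4) by (rule form_values)
  show ?thesis unfolding f by (rule hardy_const(2)) (use assms s_pos f(1) in auto)
qed

lemma lower_form_bound:
  assumes "\<phi> \<in> V" "0 < u" "\<sigma> > u - 1 / 2" "\<tau> > 0"
  shows "(1 + u) * \<tau> powr (- u) * (L2_norm M \<phi>)\<^sup>2 - u * \<tau> powr (- u - 1) / s\<^sup>2 * Re (L2_inner M (P0 s c1 c2 \<phi>) \<phi>)
    \<le> (L2_norm M (\<lambda>x. (x powr (- u)) *\<^sub>R \<phi> x))\<^sup>2"
proof -
  obtain f where f: "f \<in> schwartz_even" "(L2_norm M \<phi>)\<^sup>2 = wint (2 * \<sigma>) f"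
    "(L2_norm M (\<lambda>x. (x powr (- u)) *\<^sub>R \<phi> x))\<^sup>2 = wint (2 * \<sigma> - 2 * u) f"
    "Re (L2_inner M (P0 s c1 c2 \<phi>) \<phi>) = wint (2 * \<sigma>) (vderiv f) + s\<^sup>2 * wint (2 * \<sigma> + 2) f"
    using assms(1,3) by (rule form_values)
  have "u * \<tau> powr (- u - 1) / s\<^sup>2 * (wint (2 * \<sigma>) (vderiv f) + s\<^sup>2 * wint (2 * \<sigma> + 2) f)
      = u * \<tau> powr (- u - 1) / s\<^sup>2 * wint (2 * \<sigma>) (vderiv f) + u * \<tau> powr (- u - 1) * wint (2 * \<sigma> + 2) f"
    using s_pos by (simp add: field_simps)
  moreover have "0 \<le> u * \<tau> powr (- u - 1) / s\<^sup>2 * wint (2 * \<sigma>) (vderiv f)"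
    using assms(2) by (intro mult_nonneg_nonneg divide_nonneg_nonneg wint_nonneg) auto
  ultimately show ?thesis
    unfolding f using tangent_inequality[OF f(1) assms(3,2,4)] by linarith
qed

text \<open>At a tangent point proportional to the unperturbed eigenvalue, the loss from subtracting
  a multiple of P0 is at most u \<tau>^(-u), against a gain of (1+u) \<tau>^(-u). The net gain
  \<tau>^(-u) decays like (k+1)^(-u).\<close>

lemma lower_const_bound:
  assumes u: "0 < u" and \<xi>: "\<xi> > 0" and k: "even k"
  obtains \<tau> where "\<tau> > 0" "\<xi> * (u * \<tau> powr (- u - 1) / s\<^sup>2) \<le> 1"
    "(2 * real k + 1 + 2 * \<sigma>) * s + \<xi> * lower_const s \<xi> \<sigma> u * s powr u * (real k + 1) powr (- u)
      \<le> (1 - \<xi> * (u * \<tau> powr (- u - 1) / s\<^sup>2)) * \<mu> (k div 2) + \<xi> * ((1 + u) * \<tau> powr (- u))"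
proof -
  define m where "m = 2 * real k + 1 + 2 * \<sigma>"
  define T where "T = tangent_factor s \<xi> \<sigma> u"
  have T1: "T \<ge> 1" by (simp add: T_def tangent_factor_def)
  have sig: "1 + 2 * \<sigma> > 0" using \<sigma>_gt by linarith
  have m: "m \<ge> 1 + 2 * \<sigma>" "m > 0" using sig by (auto simp: m_def)
  have \<mu>k: "\<mu> (k div 2) = m * s" using k by (auto elim!: evenE simp: \<mu>_def m_def)
  \<comment> \<open>Since \<open>\<mu> (k div 2)\<close> is m s, this is T times the unperturbed
    eigenvalue over s^2.\<close>
  define \<tau> where "\<tau> = T * m / s"
  have \<tau>: "\<tau> > 0" using T1 m(2) s_pos by (simp add: \<tau>_def)
  define A where "A = \<xi> * u / s\<^sup>2"
  have A: "A > 0" using \<xi> u s_pos by (simp add: A_def)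
  \<comment> \<open>The second entry of the maximum in \<open>tangent_factor\<close> is made for
    this: as m \<ge> 1 + 2\<sigma>, the bound on \<tau> holds for every k, and it says that the
    subtracted multiple of P0 is at most P0.\<close>
  have "A powr (1 / (u + 1)) = s / (1 + 2 * \<sigma>) * A powr (1 / (u + 1)) * (1 + 2 * \<sigma>) / s" using sig s_pos by simp
  also have "\<dots> \<le> T * m / s"
    using s_pos sig m T1 by (intro divide_right_mono mult_mono) (auto simp: T_def tangent_factor_def A_def)
  finally have "A powr (1 / (u + 1)) \<le> \<tau>" by (simp add: \<tau>_def)
  then have "(A powr (1 / (u + 1))) powr (u + 1) \<le> \<tau> powr (u + 1)" using u by (intro powr_mono2) auto
  then have "A \<le> \<tau> powr (u + 1)" using A u by (simp add: powr_powr)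
  then have "A * \<tau> powr (- (u + 1)) \<le> \<tau> powr (u + 1) * \<tau> powr (- (u + 1))" by (intro mult_right_mono) auto
  also have "\<dots> = 1" using \<tau> by (simp flip: powr_add)
  finally have c1: "\<xi> * (u * \<tau> powr (- u - 1) / s\<^sup>2) \<le> 1" by (simp add: A_def mult.assoc)
  \<comment> \<open>The loss on the eigenvalue m s equals u \<tau>^(-u) / T, and T \<ge> 1.\<close>
  have "u * \<tau> powr (- u - 1) / s\<^sup>2 * (m * s) = u * \<tau> powr (- u) / T"
    using s_pos T1 m \<tau> powr_diff[of \<tau> "- u" 1] by (simp add: \<tau>_def[symmetric]) (simp add: \<tau>_def field_simps power2_eq_square)
  also have "\<dots> \<le> u * \<tau> powr (- u) / 1" using T1 u by (intro divide_left_mono) auto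
  finally have "\<tau> powr (- u) \<le> (1 + u) * \<tau> powr (- u) - u * \<tau> powr (- u - 1) / s\<^sup>2 * (m * s)" by (simp add: algebra_simps)
  moreover have "lower_const s \<xi> \<sigma> u * s powr u * (real k + 1) powr (- u) \<le> \<tau> powr (- u)"
  proof -
    have "m \<le> (2 + 2 * \<bar>\<sigma>\<bar>) * (real k + 1)"
    proof -
      have "0 \<le> \<bar>\<sigma>\<bar> * real k" by simp
      moreover have "(2 + 2 * \<bar>\<sigma>\<bar>) * (real k + 1) = 2 * real k + 2 + 2 * (\<bar>\<sigma>\<bar> * real k) + 2 * \<bar>\<sigma>\<bar>"
        by (simp add: algebra_simps)
      ultimately show ?thesis unfolding m_def by linarith
    qed
    then have "((2 + 2 * \<bar>\<sigma>\<bar>) * (real k + 1)) powr (- u) \<le> m powr (- u)" using m(2) u by (intro powr_mono2') auto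
    then have "T powr (- u) * s powr u * ((2 + 2 * \<bar>\<sigma>\<bar>) * (real k + 1)) powr (- u) \<le> T powr (- u) * s powr u * m powr (- u)"
      by (intro mult_left_mono) auto
    also have "T powr (- u) * s powr u * m powr (- u) = \<tau> powr (- u)"
      using T1 m(2) s_pos by (simp add: \<tau>_def powr_mult powr_divide powr_minus field_simps)
    also have "T powr (- u) * s powr u * ((2 + 2 * \<bar>\<sigma>\<bar>) * (real k + 1)) powr (- u) = lower_const s \<xi> \<sigma> u * s powr u * (real k + 1) powr (- u)"
      unfolding lower_const_def T_def by (subst powr_mult) (simp_all add: mult_ac)
    finally show ?thesis .
  qed
  ultimately have "lower_const s \<xi> \<sigma> u * s powr u * (real k + 1) powr (- u)
      \<le> (1 + u) * \<tau> powr (- u) - u * \<tau> powr (- u - 1) / s\<^sup>2 * (m * s)" by linarith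
  then have "\<xi> * (lower_const s \<xi> \<sigma> u * s powr u * (real k + 1) powr (- u))
      \<le> \<xi> * ((1 + u) * \<tau> powr (- u) - u * \<tau> powr (- u - 1) / s\<^sup>2 * (m * s))" using \<xi> by (intro mult_left_mono) auto
  then have "m * s + \<xi> * lower_const s \<xi> \<sigma> u * s powr u * (real k + 1) powr (- u)
      \<le> (1 - \<xi> * (u * \<tau> powr (- u - 1) / s\<^sup>2)) * (m * s) + \<xi> * ((1 + u) * \<tau> powr (- u))"
    by (simp add: algebra_simps)
  then show ?thesis using that[OF \<tau> c1] unfolding \<mu>k m_def by simp
qed

text \<open>The constant is the Hardy inequality at \<epsilon> = 1 with its norm term estimated by
  the energy through \<open>energy_ge\<close>. It serves only to bound the form; the sharper bounds
  enter later through \<alpha> and \<gamma>.\<close>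

lemma perturbed:
  assumes u: "0 < u" "u < 1" "\<sigma> > u - 1 / 2" and \<xi>: "\<xi> > 0"
  shows "perturbed_form M lagn \<mu> (\<lambda>x. x powr (- u)) V (P0 s c1 c2)
    (\<lambda>m n. Re (L2_inner M (\<lambda>x. x powr (- u) *\<^sub>R lagn m x) (\<lambda>x. x powr (- u) *\<^sub>R lagn n x))) \<xi>
    (1 * s powr (u - 1) + hardy_const 1 \<sigma> u * s powr u / \<mu> 0)"
proof
  show "0 < \<mu> 0" by (rule \<mu>_pos)
  show "m \<le> n \<Longrightarrow> \<mu> m \<le> \<mu> n" for m n by (rule \<mu>_mono)
  show "filterlim \<mu> at_top sequentially" by (rule \<mu>_top)
  show "\<phi> \<in> L2 M" "P0 s c1 c2 \<phi> \<in> L2 M" "(\<lambda>x. x powr (- u) *\<^sub>R \<phi> x) \<in> L2 M" if "\<phi> \<in> V" for \<phi>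
    using V_L2[OF that] u(3) by auto
  show "L2_inner M (P0 s c1 c2 \<phi>) (lagn n) = complex_of_real (\<mu> n) * L2_inner M \<phi> (lagn n)" if "\<phi> \<in> V" for \<phi> n
    by (rule P0_inner_lagn[OF that])
  show "(\<lambda>x. \<Sum>n<N. c n * lagn n x) \<in> V" for N c by (rule V_sum) (rule lagn_V)
  show "(\<lambda>x. \<phi> x - \<psi> x) \<in> V" if "\<phi> \<in> V" "\<psi> \<in> V" for \<phi> \<psi>
    using V_linear[OF that, of 1 "- 1"] by simp
  show "(L2_norm M (\<lambda>x. x powr (- u) *\<^sub>R \<phi> x))\<^sup>2
      \<le> (1 * s powr (u - 1) + hardy_const 1 \<sigma> u * s powr u / \<mu> 0) * Re (L2_inner M (P0 s c1 c2 \<phi>) \<phi>)" if "\<phi> \<in> V" for \<phi>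
  proof -
    have "hardy_const 1 \<sigma> u * s powr u / \<mu> 0 * (\<mu> 0 * (L2_norm M \<phi>)\<^sup>2)
        \<le> hardy_const 1 \<sigma> u * s powr u / \<mu> 0 * Re (L2_inner M (P0 s c1 c2 \<phi>) \<phi>)"
      using hardy_const(1)[of 1 \<sigma> u] \<mu>_pos[of 0] by (intro mult_left_mono energy_ge[OF that]) auto
    moreover have "hardy_const 1 \<sigma> u * s powr u / \<mu> 0 * (\<mu> 0 * (L2_norm M \<phi>)\<^sup>2) = hardy_const 1 \<sigma> u * s powr u * (L2_norm M \<phi>)\<^sup>2"
      using \<mu>_pos[of 0] by simp
    ultimately show ?thesis
      using upper_form_bound[OF that u zero_less_one] unfolding distrib_right by linarith
  qed
  show "\<xi> > 0" by (rule \<xi>)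
qed (rule weighted_lagn_inner_real)

lemma perturbed_oscillator:
  assumes u: "0 < u" "u < 1" "\<sigma> > u - 1 / 2" and \<xi>: "\<xi> > 0"
  shows "\<exists>P. positive_self_adjoint M P \<and>
    (\<exists>R. is_square_root M R P \<and> is_core M V R \<and>
       (\<forall>\<phi>\<in>V. \<forall>\<psi>\<in>V. \<forall>R\<phi> R\<psi>. (\<phi>, R\<phi>) \<in> R \<longrightarrow> (\<psi>, R\<psi>) \<in> R \<longrightarrow>
          L2_inner M R\<phi> R\<psi> = L2_inner M (P0 s c1 c2 \<phi>) \<psi> + complex_of_real \<xi> *
            L2_inner M (\<lambda>x. (x powr (- u)) *\<^sub>R \<phi> x) (\<lambda>x. (x powr (- u)) *\<^sub>R \<psi> x))) \<and>
    discrete_spectrum M P \<and>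
    (\<exists>lam. lists_eigenvalues M P lam \<and>
       (\<forall>k. even k \<longrightarrow> (2 * real k + 1 + 2 * \<sigma>) * s
          + \<xi> * lower_const s \<xi> \<sigma> u * s powr u * (real k + 1) powr (- u) \<le> lam k) \<and>
       (\<forall>\<epsilon>>0. \<forall>k. even k \<longrightarrow> lam k \<le>
          (2 * real k + 1 + 2 * \<sigma>) * (s + \<xi> * \<epsilon> * s powr u) + \<xi> * hardy_const \<epsilon> \<sigma> u * s powr u))"
proof -
  interpret perturbed_form M lagn \<mu> "\<lambda>x. x powr (- u)" V "P0 s c1 c2"
    "\<lambda>m n. Re (L2_inner M (\<lambda>x. x powr (- u) *\<^sub>R lagn m x) (\<lambda>x. x powr (- u) *\<^sub>R lagn n x))" \<xi>
    "1 * s powr (u - 1) + hardy_const 1 \<sigma> u * s powr u / \<mu> 0"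
    by (rule perturbed[OF u \<xi>])
  obtain P R lam where P: "positive_self_adjoint M P" and R: "is_square_root M R P" "is_core M V R"
    and form: "\<forall>\<phi>\<in>V. \<forall>\<psi>\<in>V. \<forall>k k'. (\<phi>, k) \<in> R \<longrightarrow> (\<psi>, k') \<in> R \<longrightarrow>
      L2_inner M k k' = L2_inner M (P0 s c1 c2 \<phi>) \<psi> + complex_of_real \<xi> * L2_inner M (wm \<phi>) (wm \<psi>)"
    and sp: "discrete_spectrum M P" "lists_eigenvalues M P lam"
    and low: "\<forall>\<alpha> \<gamma> k. \<xi> * \<alpha> \<le> 1 \<longrightarrow>
      (\<forall>\<phi>\<in>V. \<gamma> * (L2_norm M \<phi>)\<^sup>2 - \<alpha> * Re (L2_inner M (P0 s c1 c2 \<phi>) \<phi>) \<le> (L2_norm M (wm \<phi>))\<^sup>2) \<longrightarrow>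
      (1 - \<xi> * \<alpha>) * \<mu> (k div 2) + \<xi> * \<gamma> \<le> lam k"
    and up: "\<forall>\<alpha> \<gamma> k. 0 \<le> \<alpha> \<longrightarrow>
      (\<forall>\<phi>\<in>V. (L2_norm M (wm \<phi>))\<^sup>2 \<le> \<alpha> * Re (L2_inner M (P0 s c1 c2 \<phi>) \<phi>) + \<gamma> * (L2_norm M \<phi>)\<^sup>2) \<longrightarrow>
      lam k \<le> (1 + \<xi> * \<alpha>) * \<mu> (k div 2) + \<xi> * \<gamma>"
    using perturbed_operator_exists by (elim exE conjE) (rule that)
  have lower: "(2 * real k + 1 + 2 * \<sigma>) * s + \<xi> * lower_const s \<xi> \<sigma> u * s powr u * (real k + 1) powr (- u) \<le> lam k"
    if k: "even k" for k
  proof -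
    obtain \<tau> where \<tau>: "\<tau> > 0" "\<xi> * (u * \<tau> powr (- u - 1) / s\<^sup>2) \<le> 1"
      and le: "(2 * real k + 1 + 2 * \<sigma>) * s + \<xi> * lower_const s \<xi> \<sigma> u * s powr u * (real k + 1) powr (- u)
        \<le> (1 - \<xi> * (u * \<tau> powr (- u - 1) / s\<^sup>2)) * \<mu> (k div 2) + \<xi> * ((1 + u) * \<tau> powr (- u))"
      by (rule lower_const_bound[OF u(1) \<xi> k])
    have "(1 - \<xi> * (u * \<tau> powr (- u - 1) / s\<^sup>2)) * \<mu> (k div 2) + \<xi> * ((1 + u) * \<tau> powr (- u)) \<le> lam k"
      by (rule low[rule_format, OF \<tau>(2)]) (rule lower_form_bound[OF _ u(1,3) \<tau>(1)])
    with le show ?thesis by linarith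
  qed
  have upper: "lam k \<le> (2 * real k + 1 + 2 * \<sigma>) * (s + \<xi> * \<epsilon> * s powr u) + \<xi> * hardy_const \<epsilon> \<sigma> u * s powr u"
    if \<epsilon>: "\<epsilon> > 0" and k: "even k" for \<epsilon> k
  proof -
    \<comment> \<open>The Hardy coefficient carries s^(u-1); multiplied by the factor s of the
      unperturbed eigenvalue it becomes the s^u of the claim.\<close>
    have "lam k \<le> (1 + \<xi> * (\<epsilon> * s powr (u - 1))) * \<mu> (k div 2) + \<xi> * (hardy_const \<epsilon> \<sigma> u * s powr u)"
      by (rule up[rule_format]) (use \<epsilon> in simp, rule upper_form_bound[OF _ u \<epsilon>])
    also have "\<mu> (k div 2) = (2 * real k + 1 + 2 * \<sigma>) * s" using k by (auto elim!: evenE simp: \<mu>_def)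
    also have "(1 + \<xi> * (\<epsilon> * s powr (u - 1))) * ((2 * real k + 1 + 2 * \<sigma>) * s)
        = (2 * real k + 1 + 2 * \<sigma>) * (s + \<xi> * \<epsilon> * (s powr (u - 1) * s))" by (simp add: algebra_simps)
    also have "s powr (u - 1) * s = s powr u" using s_pos powr_add[of s "u - 1" 1] by simp
    finally show ?thesis by (simp add: mult.assoc)
  qed
  show ?thesis
    by (intro exI[of _ P] exI[of _ R] exI[of _ lam] conjI P R form sp allI impI lower upper)
qed

end

theorem corollary8p1:
  shows "\<exists>C :: real \<Rightarrow> real \<Rightarrow> real \<Rightarrow> real. (\<forall>\<epsilon> \<sigma> u. C \<epsilon> \<sigma> u > 0) \<and>
    (\<forall>s>0. \<forall>\<xi>>0. \<exists>D :: real \<Rightarrow> real \<Rightarrow> real. (\<forall>\<sigma> u. D \<sigma> u > 0) \<and>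
      (\<forall>c1 c2 a u \<sigma> :: real.
         a\<^sup>2 + (2 * c1 - 1) * a - c2 = 0 \<longrightarrow> 0 < u \<longrightarrow> u < 1 \<longrightarrow>
         \<sigma> = a + c1 \<longrightarrow> \<sigma> > u - 1 / 2 \<longrightarrow>
         (let M = half_line_measure c1; V = powr_schwartz_even a in
          \<exists>P. positive_self_adjoint M P \<and>
            (\<exists>R. is_square_root M R P \<and> is_core M V R \<and>
               (\<forall>\<phi>\<in>V. \<forall>\<psi>\<in>V. \<forall>R\<phi> R\<psi>. (\<phi>, R\<phi>) \<in> R \<longrightarrow> (\<psi>, R\<psi>) \<in> R \<longrightarrow>
                  L2_inner M R\<phi> R\<psi> =
                    L2_inner M (P0 s c1 c2 \<phi>) \<psi>
                    + complex_of_real \<xi> * L2_inner M (\<lambda>x. (x powr (- u)) *\<^sub>R \<phi> x)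
                                                     (\<lambda>x. (x powr (- u)) *\<^sub>R \<psi> x))) \<and>
            discrete_spectrum M P \<and>
            (\<exists>lam. lists_eigenvalues M P lam \<and>
               (\<forall>k. even k \<longrightarrow>
                  (2 * real k + 1 + 2 * \<sigma>) * s
                    + \<xi> * D \<sigma> u * s powr u * (real k + 1) powr (- u) \<le> lam k) \<and>
               (\<forall>\<epsilon>>0. \<forall>k. even k \<longrightarrow>
                  lam k \<le> (2 * real k + 1 + 2 * \<sigma>) * (s + \<xi> * \<epsilon> * s powr u)
                           + \<xi> * C \<epsilon> \<sigma> u * s powr u)))))"
  \<comment> \<open>\<open>hardy_const\<close> is supplied before s and \<xi> are fixed,
    \<open>lower_const s \<xi>\<close> after them.\<close>
  apply (intro exI[of _ hardy_const] conjI allI impI hardy_const(1))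
  subgoal for s \<xi>
    apply (intro exI[of _ "lower_const s \<xi>"] conjI allI impI lower_const_pos)
    unfolding Let_def
    by (rule oscillator.perturbed_oscillator) (auto intro!: oscillator.intro)
  done

end
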